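(* Let $\mathrm{Diff}^3$ be the group of orientation preserving $C^3$-diffeomorphisms of the circle, equipped with the $C^3$-topology, where the circle is realized as the real projective line $\mathbb{RP}^1=\mathbb{R}\cup\{\infty\}$, and let $\mathrm{PSL}_2(\mathbb{R})\subset \mathrm{Diff}^3$ be the subgroup of linear fractional transformations. Then $\mathrm{PSL}_2(\mathbb{R})$ is a spherical subgroup of $\mathrm{Diff}^3$.
   Context: A subgroup $K$ of a topological group $G$ is called spherical in $G$ if for every irreducible unitary representation $\rho$ of $G$ (continuous, in a complex Hilbert space $H$) the space of $K$-invariant vectors $\{v\in H:\rho(k)v=v\ \text{for all } k\in K\}$ has dimension $\le 1$. $\mathrm{PSL}_2(\mathbb{R})$ is the quotient of $\mathrm{SL}_2(\mathbb{R})$ (real $2\times2$ matrices of determinant $1$) by its center; it acts on $\mathbb{RP}^1$ by linear fractional transformations. *)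

theory Defs
  imports "HOL-Analysis.Analysis" "HOL-Algebra.Group"
begin

class complex_vector = real_vector +
  fixes scaleC :: "complex \<Rightarrow> 'a \<Rightarrow> 'a" (infixr "*\<^sub>C" 75)
  assumes scaleC_add_right: "a *\<^sub>C (x + y) = a *\<^sub>C x + a *\<^sub>C y"
    and scaleC_add_left: "(a + b) *\<^sub>C x = a *\<^sub>C x + b *\<^sub>C x"
    and scaleC_scaleC: "a *\<^sub>C (b *\<^sub>C x) = (a * b) *\<^sub>C x"
    and scaleC_one: "1 *\<^sub>C x = x"
    and scaleR_scaleC: "r *\<^sub>R x = complex_of_real r *\<^sub>C x"

class complex_hilbert_space = complex_vector + banach +
  fixes cinner :: "'a \<Rightarrow> 'a \<Rightarrow> complex"
  assumes cinner_commute: "cinner x y = cnj (cinner y x)"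
    and cinner_add_right: "cinner x (y + z) = cinner x y + cinner x z"
    and cinner_scaleC_right: "cinner x (a *\<^sub>C y) = a * cinner x y"
    and cinner_eq_norm_square: "cinner x x = complex_of_real ((norm x)\<^sup>2)"

instantiation complex :: complex_hilbert_space
begin

definition scaleC_complex :: "complex \<Rightarrow> complex \<Rightarrow> complex" where
  "scaleC_complex a x = a * x"

definition cinner_complex :: "complex \<Rightarrow> complex \<Rightarrow> complex" where
  "cinner_complex x y = cnj x * y"

instance
proof
  show "cinner x x = complex_of_real ((norm x)\<^sup>2)" for x :: complex
    unfolding cinner_complex_def by (metis complex_norm_square mult.commute)
qed (auto simp: scaleC_complex_def cinner_complex_def algebra_simps scaleR_conv_of_real)

end

global_interpretation complex_vector:
  vector_space "scaleC :: complex \<Rightarrow> 'a \<Rightarrow> 'a :: complex_vector"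
  defines csubspace = complex_vector.subspace
    and cspan = complex_vector.span
    and cdependent = complex_vector.dependent
  by unfold_locales (auto simp: scaleC_add_right scaleC_add_left scaleC_scaleC scaleC_one)

text \<open>
  The library's dimension function returns \<open>0\<close> on spaces without a finite basis, so a bound on
  the dimension is expressed by exhibiting a finite basis.
\<close>

definition cdim_le :: "'h::complex_vector set \<Rightarrow> nat \<Rightarrow> bool" where
  "cdim_le V n \<longleftrightarrow> (\<exists>B. finite B \<and> card B \<le> n \<and> \<not> cdependent B \<and> cspan B = V)"

definition unitary_group :: "('h::complex_hilbert_space \<Rightarrow> 'h) monoid" where
  "unitary_group =
    \<lparr>carrier = {U. Vector_Spaces.linear scaleC scaleC U \<and> surj U \<and>
                   (\<forall>x y. cinner (U x) (U y) = cinner x y)},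
     mult = (\<circ>), one = id\<rparr>"

text \<open>Continuity is understood in the strong operator topology, as usual for unitary representations.\<close>

definition unitary_rep ::
  "('g, 'b) monoid_scheme \<Rightarrow> 'g topology \<Rightarrow> ('g \<Rightarrow> 'h::complex_hilbert_space \<Rightarrow> 'h) \<Rightarrow> bool" where
  "unitary_rep G T \<rho> \<longleftrightarrow>
     \<rho> \<in> hom G unitary_group \<and> (\<forall>v. continuous_map T euclidean (\<lambda>g. \<rho> g v))"

definition irreducible_unitary_rep ::
  "('g, 'b) monoid_scheme \<Rightarrow> 'g topology \<Rightarrow> ('g \<Rightarrow> 'h::complex_hilbert_space \<Rightarrow> 'h) \<Rightarrow> bool" where
  "irreducible_unitary_rep G T \<rho> \<longleftrightarrow>
     unitary_rep G T \<rho> \<and> (\<exists>v::'h. v \<noteq> 0) \<and>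
     (\<forall>V. csubspace V \<and> closed V \<and> (\<forall>g\<in>carrier G. \<rho> g ` V \<subseteq> V) \<longrightarrow> V = {0} \<or> V = UNIV)"

definition invariant_vectors :: "'g set \<Rightarrow> ('g \<Rightarrow> 'h \<Rightarrow> 'h) \<Rightarrow> 'h set" where
  "invariant_vectors K \<rho> = {v. \<forall>k\<in>K. \<rho> k v = v}"

text \<open>
  HOL cannot quantify over types inside a formula, so the type \<open>'h\<close> of the Hilbert spaces is an
  explicit parameter; a theorem in which \<open>'h\<close> is a type variable speaks about all complex
  Hilbert spaces.
\<close>

definition spherical_subgroup ::
  "'h::complex_hilbert_space itself \<Rightarrow> ('g, 'b) monoid_scheme \<Rightarrow> 'g topology \<Rightarrow> 'g set \<Rightarrow> bool" where
  "spherical_subgroup _ G T K \<longleftrightarrow>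
     subgroup K G \<and>
     (\<forall>\<rho> :: 'g \<Rightarrow> 'h \<Rightarrow> 'h. irreducible_unitary_rep G T \<rho> \<longrightarrow> cdim_le (invariant_vectors K \<rho>) 1)"

datatype rp1 = Fin real | Infty

text \<open>
  The two standard charts are \<open>x\<close> on the complement of \<open>\<infinity>\<close> and \<open>- 1 / x\<close> on the complement
  of \<open>0\<close>. They are represented by their inverses, the parametrizations below. The sign makes
  the transition map \<open>y \<mapsto> - 1 / y\<close> increasing, so that the atlas is oriented.
\<close>

definition param_infty :: "real \<Rightarrow> rp1" where
  "param_infty y = (if y = 0 then Infty else Fin (- 1 / y))"

definition atlas :: "(real \<Rightarrow> rp1) set" where
  "atlas = {Fin, param_infty}"

instantiation rp1 :: topological_space
begin

definition open_rp1 :: "rp1 set \<Rightarrow> bool" where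
  "open_rp1 U \<longleftrightarrow> (\<forall>p\<in>atlas. open (p -` U))"

instance
  by standard (auto simp: open_rp1_def vimage_Union)

end

definition Ck_on :: "nat \<Rightarrow> (real \<Rightarrow> real) \<Rightarrow> real set \<Rightarrow> bool" where
  "Ck_on k f S \<longleftrightarrow>
     (\<forall>i<k. \<forall>x\<in>S. (deriv ^^ i) f differentiable at x) \<and>
     (\<forall>i\<le>k. continuous_on S ((deriv ^^ i) f))"

text \<open>
  The expression of \<open>f\<close> in the charts \<open>p\<^sup>-\<^sup>1\<close> and \<open>q\<^sup>-\<^sup>1\<close>, and the open set on
  which it is meaningful.
\<close>

definition local_rep :: "(real \<Rightarrow> rp1) \<Rightarrow> (real \<Rightarrow> rp1) \<Rightarrow> (rp1 \<Rightarrow> rp1) \<Rightarrow> real \<Rightarrow> real" where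
  "local_rep p q f = (\<lambda>x. inv_into UNIV q (f (p x)))"

definition local_dom :: "(real \<Rightarrow> rp1) \<Rightarrow> (real \<Rightarrow> rp1) \<Rightarrow> (rp1 \<Rightarrow> rp1) \<Rightarrow> real set" where
  "local_dom p q f = {x. f (p x) \<in> range q}"

definition C3_map :: "(rp1 \<Rightarrow> rp1) \<Rightarrow> bool" where
  "C3_map f \<longleftrightarrow>
     continuous_on UNIV f \<and> (\<forall>p\<in>atlas. \<forall>q\<in>atlas. Ck_on 3 (local_rep p q f) (local_dom p q f))"

definition orientation_preserving :: "(rp1 \<Rightarrow> rp1) \<Rightarrow> bool" where
  "orientation_preserving f \<longleftrightarrow>
     (\<forall>p\<in>atlas. \<forall>q\<in>atlas. \<forall>x\<in>local_dom p q f. deriv (local_rep p q f) x > 0)"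

definition Diff3 :: "(rp1 \<Rightarrow> rp1) monoid" where
  "Diff3 =
    \<lparr>carrier = {f. bij f \<and> C3_map f \<and> C3_map (inv_into UNIV f) \<and> orientation_preserving f},
     mult = (\<circ>), one = id\<rparr>"

text \<open>
  The \<open>C\<^sup>3\<close>-topology: uniform closeness, on compact subsets of charts, of the chart
  expressions and their derivatives up to order three. The two charts of the atlas suffice.
\<close>

definition C3_nbhd ::
  "(real \<Rightarrow> rp1) \<Rightarrow> (real \<Rightarrow> rp1) \<Rightarrow> real set \<Rightarrow> real \<Rightarrow> (rp1 \<Rightarrow> rp1) \<Rightarrow> (rp1 \<Rightarrow> rp1) set" where
  "C3_nbhd p q L e f =
     {g \<in> carrier Diff3. L \<subseteq> local_dom p q g \<and>
        (\<forall>i\<le>3. \<forall>x\<in>L. \<bar>(deriv ^^ i) (local_rep p q g) x - (deriv ^^ i) (local_rep p q f) x\<bar> < e)}"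

definition C3_topology :: "(rp1 \<Rightarrow> rp1) topology" where
  "C3_topology = topology_generated_by
     {C3_nbhd p q L e f | p q L e f.
        p \<in> atlas \<and> q \<in> atlas \<and> compact L \<and> e > 0 \<and> f \<in> carrier Diff3 \<and> L \<subseteq> local_dom p q f}"

fun mobius :: "real^2^2 \<Rightarrow> rp1 \<Rightarrow> rp1" where
  "mobius A (Fin x) =
     (if A$2$1 * x + A$2$2 = 0 then Infty
      else Fin ((A$1$1 * x + A$1$2) / (A$2$1 * x + A$2$2)))"
| "mobius A Infty = (if A$2$1 = 0 then Infty else Fin (A$1$1 / A$2$1))"

definition SL2 :: "(real^2^2) set" where
  "SL2 = {A. det A = 1}"

text \<open>
  \<open>A\<close> and \<open>B\<close> in \<open>SL\<^sub>2(\<real>)\<close> act by the same transformation iff \<open>A = \<plusminus>B\<close>, so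
  \<open>PSL\<^sub>2(\<real>)\<close>, the quotient by the center \<open>{\<plusminus>1}\<close>, acts faithfully and is
  identified with its image in the group of diffeomorphisms.
\<close>

definition PSL2 :: "(rp1 \<Rightarrow> rp1) set" where
  "PSL2 = mobius ` SL2"

end

theory Submission
  imports Defs
begin

text \<open>
  Write \<open>K\<close> for \<open>PSL2\<close>, let \<open>\<rho>\<close> be an irreducible unitary representation of the group of
  diffeomorphisms, \<open>V\<close> the space of \<open>K\<close>-invariant vectors and \<open>P\<close> the orthogonal projection onto
  \<open>V\<close>. The compressions \<open>P \<circ> \<rho> g \<circ> P\<close> act irreducibly on \<open>V\<close>: the vectors \<open>\<rho> g w\<close> span a dense
  subspace for every \<open>w \<noteq> 0\<close> in \<open>V\<close>, and \<open>P\<close> maps them to the vectors \<open>P (\<rho> g w)\<close>. The family of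
  compressions is closed under adjoints. If it commutes, every member acts on \<open>V\<close> as a scalar
  (\<open>commuting_selfadjoint_scalar\<close>), and then every line in \<open>V\<close> is all of \<open>V\<close>
  (\<open>commuting_compressions_imp_cdim_le_1\<close>). So it has to be shown that the compressions commute.

  Suppose first that \<open>d\<close> and \<open>e\<close> are the identity near the point at infinity. For large \<open>n\<close>, the
  conjugate of \<open>e\<close> by the translation \<open>u\<^sup>n\<close> by \<open>n\<close> has a support disjoint from that of \<open>d\<close>, so it
  commutes with \<open>d\<close>. For \<open>x\<close> and \<open>y\<close> in \<open>V\<close> this reads
    \<open>\<langle>\<rho> d (\<rho> u\<^sup>n (\<rho> e x)), y\<rangle> = \<langle>\<rho> e (\<rho> u\<^sup>-\<^sup>n (\<rho> d x)), y\<rangle>\<close>.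
  Average over \<open>n\<close>. By the mean ergodic theorem the averages of \<open>\<rho> u\<^sup>n\<close> tend strongly to the
  projection onto the vectors fixed by \<open>u\<close>, and by the Mautner phenomenon
  (\<open>fixed_by_translation_imp_fixed_by_PSL2\<close>) these are exactly the elements of \<open>V\<close>. In the limit
  \<open>\<langle>\<rho> d (P (\<rho> e x)), y\<rangle> = \<langle>\<rho> e (P (\<rho> d x)), y\<rangle>\<close>, which is the commutation sought.

  A compression depends only on the double coset of the diffeomorphism modulo \<open>K\<close>, and it depends
  continuously on the diffeomorphism. Hence it is enough that every double coset contains a limit,
  in the \<open>C\<^sup>3\<close>-topology, of diffeomorphisms that are the identity on an arc
  (\<open>double_coset_approximation\<close>). This is where three derivatives matter. A linear fractional
  transformation can be prescribed to second order at a point, and it then agrees with \<open>f\<close> to third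
  order exactly when the Schwarzian derivative of \<open>f\<close> vanishes there. The Schwarzian has a zero: if
  \<open>f\<close> fixes infinity, then \<open>y = 1 / sqrt f'\<close> satisfies \<open>y'' = - (S f / 2) y\<close>, and \<open>y\<close> is bounded on
  the whole line because \<open>f\<close> is smooth at infinity too, so \<open>y''\<close> cannot keep a constant sign. After
  multiplication by elements of \<open>K\<close> on both sides, \<open>f\<close> is therefore the identity up to
  \<open>o(x\<^sup>3)\<close> at the origin, and cutting off this remainder on shrinking intervals changes \<open>f\<close> by
  arbitrarily little in \<open>C\<^sup>3\<close>.
\<close>

section \<open>Complex Hilbert spaces\<close>

lemma cinner_add_left: "cinner (x + y) z = cinner x z + cinner y (z::'h::complex_hilbert_space)"
  by (metis cinner_commute cinner_add_right complex_cnj_add)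

lemma cinner_scaleC_left: "cinner (a *\<^sub>C x) y = cnj a * cinner x (y::'h::complex_hilbert_space)"
  by (metis cinner_commute cinner_scaleC_right complex_cnj_mult)

lemma cinner_scaleR_right: "cinner x (r *\<^sub>R y) = r *\<^sub>R cinner x (y::'h::complex_hilbert_space)"
  by (subst scaleR_scaleC) (simp add: cinner_scaleC_right scaleR_conv_of_real)

lemma cinner_scaleR_left: "cinner (r *\<^sub>R x) y = r *\<^sub>R cinner x (y::'h::complex_hilbert_space)"
  by (subst scaleR_scaleC) (simp add: cinner_scaleC_left scaleR_conv_of_real)

lemma cinner_zero [simp]: "cinner 0 (x::'h::complex_hilbert_space) = 0" "cinner x 0 = 0"
  using cinner_scaleR_left[of 0 0 x] cinner_scaleR_right[of x 0 0] by simp_all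

lemma cinner_minus_left [simp]: "cinner (- x) y = - cinner x (y::'h::complex_hilbert_space)"
  using cinner_scaleR_left[of "-1" x y] by simp

lemma cinner_minus_right [simp]: "cinner x (- y) = - cinner x (y::'h::complex_hilbert_space)"
  using cinner_scaleR_right[of x "-1" y] by simp

lemma cinner_diff_left: "cinner (x - y) z = cinner x z - cinner y (z::'h::complex_hilbert_space)"
  using cinner_add_left[of x "-y" z] by simp

lemma cinner_diff_right: "cinner x (y - z) = cinner x y - cinner x (z::'h::complex_hilbert_space)"
  using cinner_add_right[of x y "-z"] by simp

lemma cinner_self_eq_0 [simp]: "cinner x x = 0 \<longleftrightarrow> x = (0::'h::complex_hilbert_space)"
  by (simp add: cinner_eq_norm_square)

lemma norm_add_square:
  "(norm (x + y))\<^sup>2 = (norm x)\<^sup>2 + (norm y)\<^sup>2 + 2 * Re (cinner x (y::'h::complex_hilbert_space))"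
proof -
  have "Re (cinner (x + y) (x + y)) = Re (cinner x x) + Re (cinner y y) + Re (cinner x y) + Re (cinner y x)"
    by (simp add: cinner_add_left cinner_add_right)
  moreover have "Re (cinner y x) = Re (cinner x y)"
    by (subst cinner_commute) simp
  ultimately show ?thesis by (simp add: cinner_eq_norm_square)
qed

lemma norm_diff_square:
  "(norm (x - y))\<^sup>2 = (norm x)\<^sup>2 + (norm y)\<^sup>2 - 2 * Re (cinner x (y::'h::complex_hilbert_space))"
  using norm_add_square[of x "-y"] by simp

lemma norm_scaleC: "norm (a *\<^sub>C x) = cmod a * norm (x::'h::complex_hilbert_space)"
proof -
  have "complex_of_real ((norm (a *\<^sub>C x))\<^sup>2) = (a * cnj a) * cinner x x"
    unfolding cinner_eq_norm_square[symmetric] by (simp add: cinner_scaleC_left cinner_scaleC_right)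
  also have "... = complex_of_real ((cmod a * norm x)\<^sup>2)"
    by (simp only: cinner_eq_norm_square complex_norm_square[symmetric] power_mult_distrib of_real_mult)
  finally have "(norm (a *\<^sub>C x))\<^sup>2 = (cmod a * norm x)\<^sup>2"
    by (simp only: of_real_eq_iff)
  then show ?thesis by (simp add: power2_eq_iff_nonneg)
qed

text \<open>
  The vector \<open>a *\<^sub>C y\<close> is the component of \<open>x\<close> along \<open>y\<close>. The formula gives the Cauchy-Schwarz
  inequality because its left-hand side is nonnegative, and it gives orthogonality to a subspace
  because a nearest point of the subspace leaves no room for a nonzero component.
\<close>

lemma norm_minus_component_square:
  fixes x y :: "'h::complex_hilbert_space"
  assumes y: "y \<noteq> 0"
  defines "a \<equiv> cinner y x / complex_of_real ((norm y)\<^sup>2)"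
  shows "(norm (x - a *\<^sub>C y))\<^sup>2 = (norm x)\<^sup>2 - (cmod (cinner x y))\<^sup>2 / (norm y)\<^sup>2"
proof -
  have "cinner y x * cinner x y = complex_of_real ((cmod (cinner x y))\<^sup>2)"
    by (metis cinner_commute complex_norm_square mult.commute)
  then have *: "cinner x (a *\<^sub>C y) = complex_of_real ((cmod (cinner x y))\<^sup>2 / (norm y)\<^sup>2)"
    by (simp add: cinner_scaleC_right a_def)
  have "cmod (cinner y x) = cmod (cinner x y)" by (subst cinner_commute) simp
  then have "cmod a = cmod (cinner x y) / (norm y)\<^sup>2"
    by (simp only: a_def norm_divide norm_of_real) simp
  then have **: "(norm (a *\<^sub>C y))\<^sup>2 = (cmod (cinner x y))\<^sup>2 / (norm y)\<^sup>2"
    using y by (simp add: norm_scaleC field_simps power2_eq_square)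
  show ?thesis unfolding norm_diff_square * ** by simp
qed

lemma cauchy_schwarz: "cmod (cinner x y) \<le> norm x * norm (y::'h::complex_hilbert_space)"
proof (cases "y = 0")
  case False
  then have ny: "norm y > 0" by simp
  have "0 \<le> (norm x)\<^sup>2 - (cmod (cinner x y))\<^sup>2 / (norm y)\<^sup>2"
    unfolding norm_minus_component_square[OF False, symmetric] by simp
  then have "(cmod (cinner x y))\<^sup>2 \<le> (norm x * norm y)\<^sup>2"
    using ny by (simp add: field_simps power_mult_distrib)
  then show ?thesis by (meson norm_ge_zero mult_nonneg_nonneg power2_le_imp_le)
qed simp

lemma bounded_bilinear_cinner: "bounded_bilinear (cinner :: 'h::complex_hilbert_space \<Rightarrow> _)"
  by (unfold_locales)
    (auto simp: cinner_add_left cinner_add_right cinner_scaleR_left cinner_scaleR_right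
      intro!: exI[of _ 1] cauchy_schwarz)

lemmas tendsto_cinner [tendsto_intros] = bounded_bilinear.tendsto[OF bounded_bilinear_cinner]
lemma cinner_eqI:
  assumes "\<And>z. cinner x z = cinner y (z::'h::complex_hilbert_space)" shows "x = y"
  using assms[of "x - y"] by (metis cinner_diff_left cinner_self_eq_0 eq_iff_diff_eq_0)

lemma bounded_linear_scaleC: "bounded_linear (\<lambda>x::'h::complex_hilbert_space. a *\<^sub>C x)"
  by (rule bounded_linear_intro[of _ "cmod a"])
    (auto simp: scaleC_add_right scaleR_scaleC scaleC_scaleC norm_scaleC mult.commute)

lemmas tendsto_scaleC [tendsto_intros] = bounded_linear.tendsto[OF bounded_linear_scaleC]
lemma csubspaceD:
  assumes "csubspace V"
  shows "0 \<in> V" "x \<in> V \<Longrightarrow> y \<in> V \<Longrightarrow> x + y \<in> V" "x \<in> V \<Longrightarrow> a *\<^sub>C x \<in> V"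
    "x \<in> V \<Longrightarrow> y \<in> V \<Longrightarrow> x - y \<in> V" "x \<in> V \<Longrightarrow> r *\<^sub>R x \<in> V"
  using assms complex_vector.subspace_diff[OF assms]
  by (auto simp: complex_vector.subspace_def scaleR_scaleC)

lemma csubspace_closure:
  assumes "csubspace (V::'h::complex_hilbert_space set)"
  shows "csubspace (closure V)"
  unfolding complex_vector.subspace_def
proof safe
  show "0 \<in> closure V" using csubspaceD(1)[OF assms] closure_subset by blast
next
  fix x y assume "x \<in> closure V" "y \<in> closure V"
  then obtain f g where "\<And>n. f n \<in> V" "f \<longlonglongrightarrow> x" "\<And>n. g n \<in> V" "g \<longlonglongrightarrow> y"
    unfolding closure_sequential by blast
  then have "(\<lambda>n. f n + g n) \<longlonglongrightarrow> x + y" "\<And>n. f n + g n \<in> V"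
    using csubspaceD(2)[OF assms] by (auto intro: tendsto_intros)
  then show "x + y \<in> closure V" unfolding closure_sequential
    by (intro exI[of _ "\<lambda>n. f n + g n"]) simp
next
  fix a x assume "x \<in> closure V"
  then obtain f where "\<And>n. f n \<in> V" "f \<longlonglongrightarrow> x"
    unfolding closure_sequential by blast
  then have "(\<lambda>n. a *\<^sub>C f n) \<longlonglongrightarrow> a *\<^sub>C x" "\<And>n. a *\<^sub>C f n \<in> V"
    using csubspaceD(3)[OF assms] by (auto intro: tendsto_intros)
  then show "a *\<^sub>C x \<in> closure V" unfolding closure_sequential
    by (intro exI[of _ "\<lambda>n. a *\<^sub>C f n"]) simp
qed

text \<open>
  By the parallelogram law, points of \<open>M\<close> that nearly minimize the distance to \<open>x\<close> are close to each
  other, so a minimizing sequence converges.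
\<close>

lemma nearest_point_exists:
  fixes M :: "'h::complex_hilbert_space set"
  assumes M: "csubspace M" "closed M"
  shows "\<exists>m\<in>M. \<forall>y\<in>M. norm (x - m) \<le> norm (x - y)"
proof -
  define D where "D = (INF y\<in>M. (norm (x - y))\<^sup>2)"
  have bdd: "bdd_below ((\<lambda>y. (norm (x - y))\<^sup>2) ` M)" by (rule bdd_belowI2[of _ 0]) simp
  have ne: "M \<noteq> {}" using csubspaceD(1)[OF M(1)] by auto
  have Dle: "D \<le> (norm (x - y))\<^sup>2" if "y \<in> M" for y
    unfolding D_def by (rule cINF_lower[OF bdd that])
  have "\<exists>y\<in>M. (norm (x - y))\<^sup>2 < D + 1 / Suc n" for n
  proof (rule ccontr)
    assume "\<not> ?thesis"
    then have "D + 1 / Suc n \<le> D" unfolding D_def[of]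
      by (intro cINF_greatest[OF ne]) (auto simp: D_def not_less)
    then show False by (simp add: field_simps)
  qed
  then obtain f where f: "\<And>n. f n \<in> M" "\<And>n. (norm (x - f n))\<^sup>2 < D + 1 / Suc n" by metis
  have par: "(norm (u - v))\<^sup>2 \<le> 2 * ((norm (x - u))\<^sup>2 - D) + 2 * ((norm (x - v))\<^sup>2 - D)"
    if "u \<in> M" "v \<in> M" for u v
  proof -
    \<comment> \<open>The midpoint of \<open>u\<close> and \<open>v\<close> lies in \<open>M\<close>, so its distance from \<open>x\<close> is at least the infimum.\<close>
    have "(1/2) *\<^sub>R (u + v) \<in> M" using that csubspaceD[OF M(1)] by simp
    from Dle[OF this] have "4 * D \<le> (2 * norm (x - (1/2) *\<^sub>R (u + v)))\<^sup>2" by (simp add: power_mult_distrib)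
    also have "2 * norm (x - (1/2) *\<^sub>R (u + v)) = norm (2 *\<^sub>R (x - (1/2) *\<^sub>R (u + v)))" by simp
    also have "2 *\<^sub>R (x - (1/2) *\<^sub>R (u + v)) = (x - u) + (x - v)" by (simp add: algebra_simps scaleR_2)
    finally have "4 * D \<le> (norm ((x - u) + (x - v)))\<^sup>2" .
    moreover have "(norm ((x - u) + (x - v)))\<^sup>2 + (norm ((x - v) - (x - u)))\<^sup>2 =
        2 * (norm (x - u))\<^sup>2 + 2 * (norm (x - v))\<^sup>2"
      using norm_add_square[of "x-v" "x-u"] norm_diff_square[of "x-v" "x-u"] by (simp add: add.commute)
    ultimately show ?thesis by simp
  qed
  have "Cauchy f"
  proof (rule metric_CauchyI)
    fix e :: real assume e: "e > 0"
    obtain N where N: "4 / Suc N < e\<^sup>2"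
    proof -
      obtain N :: nat where "4 / e\<^sup>2 < real N" using reals_Archimedean2 by blast
      then have "4 < e\<^sup>2 * real N" using e by (simp add: field_simps)
      also have "... \<le> e\<^sup>2 * real (Suc N)" by (simp add: algebra_simps)
      finally show thesis using that[of N] e by (simp add: field_simps)
    qed
    show "\<exists>N. \<forall>m\<ge>N. \<forall>n\<ge>N. dist (f m) (f n) < e"
    proof (intro exI allI impI)
      fix m n assume mn: "m \<ge> N" "n \<ge> N"
      have "1 / real (Suc m) \<le> 1 / Suc N" "1 / real (Suc n) \<le> 1 / Suc N"
        using mn by (auto simp: field_simps)
      then have "(norm (f m - f n))\<^sup>2 < e\<^sup>2"
        using par[OF f(1) f(1), of m n] f(2)[of m] f(2)[of n] N by argo
      then show "dist (f m) (f n) < e" using e by (simp add: dist_norm power2_less_imp_less)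
    qed
  qed
  then obtain m where m: "f \<longlonglongrightarrow> m" using Cauchy_convergent convergent_def by blast
  have "m \<in> M" using closed_sequentially[OF M(2) f(1) m] .
  have "(\<lambda>n. (norm (x - f n))\<^sup>2) \<longlonglongrightarrow> (norm (x - m))\<^sup>2" by (intro tendsto_intros m)
  moreover have "(\<lambda>n. D + 1 / Suc n) \<longlonglongrightarrow> D + 0"
    by (intro tendsto_intros LIMSEQ_Suc[OF lim_const_over_n])
  ultimately have "(norm (x - m))\<^sup>2 \<le> D + 0"
    by (rule LIMSEQ_le) (intro exI allI impI less_imp_le f(2))
  then have "norm (x - m) \<le> norm (x - y)" if "y \<in> M" for y
    using Dle[OF that] by (auto intro: power2_le_imp_le[OF order_trans])
  then show ?thesis using \<open>m \<in> M\<close> by blast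
qed

lemma orthogonal_decomposition:
  fixes M :: "'h::complex_hilbert_space set"
  assumes M: "csubspace M" "closed M"
  shows "\<exists>m\<in>M. \<forall>y\<in>M. cinner (x - m) y = 0"
proof -
  obtain m where m: "m \<in> M" "\<And>y. y \<in> M \<Longrightarrow> norm (x - m) \<le> norm (x - y)"
    using nearest_point_exists[OF M] by blast
  have "cinner (x - m) y = 0" if y: "y \<in> M" for y
  proof (cases "y = 0")
    case False
    define a where "a = cinner y (x - m) / complex_of_real ((norm y)\<^sup>2)"
    have ny: "norm y > 0" using False by simp
    have "m + a *\<^sub>C y \<in> M" using m(1) y csubspaceD[OF M(1)] by blast
    from m(2)[OF this] have "(norm (x - m))\<^sup>2 \<le> (norm ((x - m) - a *\<^sub>C y))\<^sup>2"
      by (simp add: diff_diff_add)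
    also have "... = (norm (x-m))\<^sup>2 - (cmod (cinner (x-m) y))\<^sup>2 / (norm y)\<^sup>2"
      unfolding a_def by (rule norm_minus_component_square[OF False])
    finally have "(cmod (cinner (x-m) y))\<^sup>2 / (norm y)\<^sup>2 \<le> 0" by simp
    then show ?thesis using ny by (simp add: field_simps)
  qed simp
  then show ?thesis using m by blast
qed

lemma orthogonal_projection_exists:
  fixes V :: "'h::complex_hilbert_space set"
  assumes V: "csubspace V" "closed V"
  obtains P where "bounded_linear P" "\<And>a x. P (a *\<^sub>C x) = a *\<^sub>C P x"
    "\<And>x. P x \<in> V" "\<And>x. x \<in> V \<Longrightarrow> P x = x" "\<And>x y. cinner (P x) y = cinner x (P y)"
proof -
  obtain P where P: "\<And>x. P x \<in> V" "\<And>x y. y \<in> V \<Longrightarrow> cinner (x - P x) y = 0"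
    using orthogonal_decomposition[OF V] by metis
  note sub = csubspaceD[OF V(1)]
  have uniq: "P x = m" if "m \<in> V" "\<And>y. y \<in> V \<Longrightarrow> cinner (x - m) y = 0" for x m
  proof -
    have d: "P x - m \<in> V" by (intro sub P that)
    have "cinner (P x - m) (P x - m) = cinner (x - m) (P x - m) - cinner (x - P x) (P x - m)"
      by (simp add: cinner_diff_left)
    also have "... = 0" using P(2)[OF d] that(2)[OF d] by simp
    finally show ?thesis by simp
  qed
  have add: "P (x + y) = P x + P y" for x y
  proof (rule uniq)
    show "P x + P y \<in> V" by (intro sub P)
    fix z assume z: "z \<in> V"
    have "x + y - (P x + P y) = (x - P x) + (y - P y)" by simp
    then show "cinner (x + y - (P x + P y)) z = 0" using P(2)[OF z] by (simp only: cinner_add_left) simp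
  qed
  have sc: "P (a *\<^sub>C x) = a *\<^sub>C P x" for a x
  proof (rule uniq)
    show "a *\<^sub>C P x \<in> V" by (intro sub P)
    fix z assume z: "z \<in> V"
    have "a *\<^sub>C x - a *\<^sub>C P x = a *\<^sub>C (x - P x)"
      by (simp add: complex_vector.scale_right_diff_distrib)
    then show "cinner (a *\<^sub>C x - a *\<^sub>C P x) z = 0" using P(2)[OF z] by (simp only: cinner_scaleC_left) simp
  qed
  have idem: "P x = x" if "x \<in> V" for x using that by (intro uniq) auto
  have self: "cinner (P x) y = cinner x (P y)" for x y
  proof -
    have "cinner (P x) (y - P y) = 0" using P(2)[OF P(1)] by (metis cinner_commute complex_cnj_zero)
    then show ?thesis using P(2)[OF P(1), of x y] by (simp add: cinner_diff_left cinner_diff_right)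
  qed
  have "norm (P x) \<le> norm x * 1" for x
  proof (cases "P x = 0")
    case False
    have "complex_of_real ((norm (P x))\<^sup>2) = cinner (P x) x"
      unfolding cinner_eq_norm_square[symmetric] by (simp add: self idem P(1))
    then have "(norm (P x))\<^sup>2 \<le> norm (P x) * norm x"
      by (metis cauchy_schwarz norm_of_real abs_of_nonneg zero_le_power2)
    then show ?thesis using False by (simp add: power2_eq_square)
  qed simp
  then have "bounded_linear P"
    by (intro bounded_linear_intro[of _ 1]) (auto simp: add scaleR_scaleC sc)
  then show ?thesis using that[OF _ sc P(1) idem self] by blast
qed

lemma unitary_groupD:
  assumes "U \<in> carrier unitary_group"
  shows "U (x + y) = U x + U y" "U (a *\<^sub>C x) = a *\<^sub>C U x" "cinner (U x) (U y) = cinner x y"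
    "norm (U x) = norm x" "U (x - y) = U x - U y" "bounded_linear U" "surj U"
proof -
  show add: "U (x + y) = U x + U y" and sc: "U (a *\<^sub>C x) = a *\<^sub>C U x" and "cinner (U x) (U y) = cinner x y"
    and "surj U" for x y a
    using assms by (auto simp: unitary_group_def Vector_Spaces.linear_iff)
  then have "complex_of_real ((norm (U x))\<^sup>2) = complex_of_real ((norm x)\<^sup>2)" for x
    unfolding cinner_eq_norm_square[symmetric] by blast
  then show n: "norm (U x) = norm x" for x
    unfolding of_real_eq_iff by (simp add: power2_eq_iff_nonneg)
  show bl: "bounded_linear U"
    by (intro bounded_linear_intro[of _ 1]) (auto simp: add scaleR_scaleC sc n)
  show "U (x - y) = U x - U y" using bl by (simp add: bounded_linear.linear linear_diff)
qed

section \<open>The mean ergodic theorem\<close>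

text \<open>
  Every vector splits into a fixed vector and a limit of coboundaries \<open>U y - y\<close>: what is orthogonal to
  all coboundaries is fixed by the adjoint of \<open>U\<close>, hence by \<open>U\<close>. The averages keep the fixed part,
  and they tend to zero on coboundaries because the sum telescopes.
\<close>

lemma mean_ergodic:
  fixes U :: "'h::complex_hilbert_space \<Rightarrow> 'h"
  assumes U: "U \<in> carrier unitary_group"
    and p: "U p = p" "\<And>y. U y = y \<Longrightarrow> cinner (x - p) y = 0"
  shows "(\<lambda>N. (1 / real N) *\<^sub>R (\<Sum>n<N. (U ^^ n) x)) \<longlonglongrightarrow> p"
proof -
  note D = unitary_groupD[OF U]
  define M where "M = closure (range (\<lambda>y. U y - y))"
  define z where "z = x - p"
  have "csubspace (range (\<lambda>y. U y - y))"
    unfolding complex_vector.subspace_def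
  proof safe
    show "0 \<in> range (\<lambda>y. U y - y)"
      using D(5)[of 0 0] by (intro image_eqI[of _ _ 0]) auto
    show "(U a - a) + (U b - b) \<in> range (\<lambda>y. U y - y)" for a b
      by (intro image_eqI[of _ _ "a + b"]) (auto simp: D(1))
    show "c *\<^sub>C (U a - a) \<in> range (\<lambda>y. U y - y)" for a c
      by (intro image_eqI[of _ _ "c *\<^sub>C a"]) (auto simp: D(2) complex_vector.scale_right_diff_distrib)
  qed
  then have M: "csubspace M" "closed M" by (auto simp: M_def csubspace_closure)
  obtain m where m: "m \<in> M" "\<And>y. y \<in> M \<Longrightarrow> cinner (z - m) y = 0"
    using orthogonal_decomposition[OF M] by blast
  define q where "q = z - m"
  \<comment> \<open>\<open>q\<close> is the part of \<open>x - p\<close> orthogonal to all coboundaries. It is fixed by \<open>U\<close>, and \<open>x - p\<close> is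
    orthogonal to fixed vectors, so \<open>q = 0\<close>.\<close>
  have "U y - y \<in> M" for y unfolding M_def using closure_subset by fastforce
  then have "cinner q (U q) = cinner q q" using m(2)[of "U q - q"] by (simp add: q_def[symmetric] cinner_diff_right)
  then have "(norm (q - U q))\<^sup>2 = 0"
    by (simp add: norm_diff_square D(4) cinner_eq_norm_square)
  then have Uq: "U q = q" by simp
  have "cinner q q = cinner z q - cinner m q" unfolding q_def by (simp add: cinner_diff_left)
  moreover have "cinner z q = 0" using p(2)[OF Uq] by (simp add: z_def)
  moreover have "cinner m q = 0" using m(2)[OF m(1)] by (metis q_def cinner_commute complex_cnj_zero)
  ultimately have "q = 0" by simp
  then have zM: "z \<in> M" using m(1) by (simp add: q_def)
  define A where "A = (\<lambda>(N::nat) x. (1 / real N) *\<^sub>R (\<Sum>n<N. (U ^^ n) x))"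
  have pow_diff: "(U ^^ n) (a - b) = (U ^^ n) a - (U ^^ n) b" for n a b
    by (induction n) (auto simp: D(5))
  have pow_norm: "norm ((U ^^ n) a) = norm a" for n a by (induction n) (auto simp: D(4))
  have A_diff: "A N (a - b) = A N a - A N b" for N a b
    by (simp add: A_def pow_diff sum_subtractf scaleR_diff_right)
  have A_norm: "norm (A N a) \<le> norm a" for N a
  proof (cases "N = 0")
    case False
    have "norm (\<Sum>n<N. (U ^^ n) a) \<le> (\<Sum>n<N. norm a)"
      by (rule sum_norm_le) (simp add: pow_norm)
    then show ?thesis using False by (simp add: A_def field_simps)
  qed (simp add: A_def)
  have A_cob: "norm (A N (U y - y)) \<le> (1 / real N) * (2 * norm y)" for N y
  proof -
    have "(\<Sum>n<N. (U ^^ n) (U y - y)) = (\<Sum>n<N. (U ^^ Suc n) y - (U ^^ n) y)"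
      by (intro sum.cong) (auto simp: pow_diff funpow_swap1)
    also have "... = (U ^^ N) y - y" by (subst sum_lessThan_telescope) simp
    finally have "A N (U y - y) = (1 / real N) *\<^sub>R ((U ^^ N) y - y)" by (simp add: A_def)
    moreover have "norm ((U ^^ N) y - y) \<le> 2 * norm y"
      using norm_triangle_ineq4[of "(U ^^ N) y" y] by (simp add: pow_norm)
    ultimately show ?thesis by (simp add: divide_right_mono)
  qed
  have "(\<lambda>N. A N z) \<longlonglongrightarrow> 0"
  proof (rule LIMSEQ_I)
    fix e :: real assume e: "e > 0"
    obtain y where y: "dist (U y - y) z < e / 2"
      using zM e unfolding M_def closure_approachable by (metis (no_types, lifting) half_gt_zero imageE)
    obtain N0 where N0: "4 * norm y / e < real N0" using reals_Archimedean2 by blast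
    show "\<exists>no. \<forall>n\<ge>no. norm (A n z - 0) < e"
    proof (intro exI allI impI)
      fix n assume n: "n \<ge> Suc N0"
      have "4 * norm y / e < real n" using N0 n by linarith
      then have "(1 / real n) * (2 * norm y) < e / 2" using e n by (simp add: field_simps)
      moreover have "norm (A n (z - (U y - y))) < e / 2"
        using A_norm[of n "z - (U y - y)"] y by (simp add: dist_norm norm_minus_commute)
      moreover have "A n z = A n (z - (U y - y)) + A n (U y - y)" by (simp add: A_diff)
      ultimately show "norm (A n z - 0) < e"
        using norm_triangle_ineq[of "A n (z - (U y - y))" "A n (U y - y)"] A_cob[of n y] by simp
    qed
  qed
  then have "(\<lambda>N. A N z + p) \<longlonglongrightarrow> 0 + p" by (intro tendsto_intros)
  moreover have "\<forall>\<^sub>F N in sequentially. A N z + p = A N x"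
  proof (rule eventually_sequentiallyI)
    fix N :: nat assume "N \<ge> 1"
    have "(U ^^ n) p = p" for n by (induction n) (auto simp: p)
    then have "A N p = p" using \<open>N \<ge> 1\<close> by (simp add: A_def scaleR_right.sum[symmetric] sum_constant_scaleR)
    then show "A N z + p = A N x" by (simp add: z_def A_diff)
  qed
  ultimately show ?thesis unfolding A_def by (simp add: tendsto_cong)
qed

section \<open>The absolute value of a self-adjoint operator\<close>

lemmas blinfun_compose_distribs =
  bounded_bilinear.add_left[OF bounded_bilinear_blinfun_compose]
  bounded_bilinear.add_right[OF bounded_bilinear_blinfun_compose]
  bounded_bilinear.diff_left[OF bounded_bilinear_blinfun_compose]
  bounded_bilinear.diff_right[OF bounded_bilinear_blinfun_compose]
  bounded_bilinear.scaleR_left[OF bounded_bilinear_blinfun_compose]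
  bounded_bilinear.scaleR_right[OF bounded_bilinear_blinfun_compose]

text \<open>
  The equation says \<open>(1 - R)\<^sup>2 = 1 - s\<close>. The iteration \<open>R \<mapsto> (s + R\<^sup>2) / 2\<close>, started at \<open>0\<close>, is
  dominated term by term by the same iteration for the number \<open>1\<close>, which is increasing and bounded;
  this works up to and including \<open>norm s = 1\<close>, where the map is not a contraction. The last clause
  records that \<open>R\<close> inherits every closed property that the iteration preserves, such as commuting
  with a given operator.
\<close>

lemma sqrt_iteration:
  fixes s :: "'a::banach \<Rightarrow>\<^sub>L 'a"
  assumes s: "norm s \<le> 1"
  obtains R where "R = (1/2) *\<^sub>R (s + (R o\<^sub>L R))" "norm R \<le> 1"
    "\<And>Q. closed Q \<Longrightarrow> 0 \<in> Q \<Longrightarrow> (\<And>r. r \<in> Q \<Longrightarrow> (1/2) *\<^sub>R (s + (r o\<^sub>L r)) \<in> Q) \<Longrightarrow> R \<in> Q"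
proof -
  define f where "f = rec_nat (0::'a \<Rightarrow>\<^sub>L 'a) (\<lambda>_ r. (1/2) *\<^sub>R (s + (r o\<^sub>L r)))"
  have f: "f 0 = 0" "\<And>n. f (Suc n) = (1/2) *\<^sub>R (s + (f n o\<^sub>L f n))" by (auto simp: f_def)
  define r where "r = rec_nat (0::real) (\<lambda>_ r. (1/2) * (1 + r * r))"
  have r: "r 0 = 0" "\<And>n. r (Suc n) = (1/2) * (1 + r n * r n)" by (auto simp: r_def)
  have r01: "0 \<le> r n \<and> r n \<le> 1" for n
    by (induction n) (auto simp: r mult_le_one intro: add_nonneg_nonneg)
  have fr: "norm (f n) \<le> r n" for n
  proof (induction n)
    case (Suc n)
    have "norm (f (Suc n)) \<le> (1/2) * (norm s + norm (f n o\<^sub>L f n))"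
      using norm_triangle_ineq[of s "(f n o\<^sub>L f n)"] by (simp add: f)
    also have "norm (f n o\<^sub>L f n) \<le> r n * r n"
      using norm_blinfun_compose[of "f n" "f n"] mult_mono[OF Suc Suc] r01[of n] by simp
    finally show ?case using s by (simp add: r)
  qed (simp add: f r)
  \<comment> \<open>Splitting \<open>u\<^sup>2 - v\<^sup>2\<close> as \<open>u (u - v) + (u - v) v\<close> avoids any commutation between \<open>u\<close> and \<open>v\<close>.\<close>
  have step: "norm (f (Suc n) - f n) \<le> r (Suc n) - r n" for n
  proof (induction n)
    case 0 show ?case using s by (simp add: f r)
  next
    case (Suc n)
    let ?u = "f (Suc n)" and ?v = "f n"
    have "f (Suc (Suc n)) - f (Suc n) = (1/2) *\<^sub>R ((?u o\<^sub>L (?u - ?v)) + ((?u - ?v) o\<^sub>L ?v))"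
      using f(2)[of "Suc n"] f(2)[of n]
      by (simp add: blinfun_compose_distribs algebra_simps)
    then have "norm (f (Suc (Suc n)) - f (Suc n)) \<le>
        (1/2) * (norm ((?u o\<^sub>L (?u - ?v))) + norm (((?u - ?v) o\<^sub>L ?v)))"
      using norm_triangle_ineq[of "(?u o\<^sub>L (?u - ?v))" "((?u - ?v) o\<^sub>L ?v)"] by simp
    also have "... \<le> (1/2) * (r (Suc n) * (r (Suc n) - r n) + (r (Suc n) - r n) * r n)"
    proof -
      have "norm ((?u o\<^sub>L (?u - ?v))) \<le> r (Suc n) * (r (Suc n) - r n)"
        by (rule order_trans[OF norm_blinfun_compose mult_mono]) (use fr Suc r01 in auto)
      moreover have "norm (((?u - ?v) o\<^sub>L ?v)) \<le> (r (Suc n) - r n) * r n"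
        by (rule order_trans[OF norm_blinfun_compose mult_mono])
          (use fr Suc order_trans[OF norm_ge_zero Suc] in auto)
      ultimately show ?thesis by simp
    qed
    also have "... = r (Suc (Suc n)) - r (Suc n)" using r(2)[of "Suc n"] r(2)[of n] by (simp add: algebra_simps)
    finally show ?case .
  qed
  have mono: "r n \<le> r (Suc n)" for n using order_trans[OF norm_ge_zero step[of n]] by simp
  have inc: "incseq r" using mono by (rule incseq_SucI)
  obtain l where "r \<longlonglongrightarrow> l" using incseq_convergent[OF inc, of 1] r01 by blast
  then have Cr: "Cauchy r" using LIMSEQ_imp_Cauchy by blast
  have dist_le: "norm (f (n + k) - f n) \<le> r (n + k) - r n" for n k
  proof (induction k)
    case (Suc k)
    then show ?case using norm_triangle_ineq[of "f (Suc (n + k)) - f (n + k)" "f (n + k) - f n"] step[of "n + k"] by simp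
  qed simp
  have "Cauchy f"
  proof (rule metric_CauchyI)
    fix e :: real assume "e > 0"
    then obtain N where N: "\<And>m n. m \<ge> N \<Longrightarrow> n \<ge> N \<Longrightarrow> dist (r m) (r n) < e"
      using metric_CauchyD[OF Cr] by blast
    have "dist (f m) (f n) < e" if "m \<ge> n" "n \<ge> N" for m n
      using dist_le[of n "m - n"] N[of m n] that by (simp add: dist_norm)
    then show "\<exists>N. \<forall>m\<ge>N. \<forall>n\<ge>N. dist (f m) (f n) < e"
      by (metis dist_commute nle_le)
  qed
  then obtain R where R: "f \<longlonglongrightarrow> R" using Cauchy_convergent convergent_def by blast
  show thesis
  proof (rule that)
    have "(\<lambda>n. f (Suc n)) \<longlonglongrightarrow> (1/2) *\<^sub>R (s + (R o\<^sub>L R))"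
      unfolding f by (intro tendsto_intros R bounded_bilinear.tendsto[OF bounded_bilinear_blinfun_compose])
    then show "R = (1/2) *\<^sub>R (s + (R o\<^sub>L R))"
      using LIMSEQ_unique LIMSEQ_Suc[OF R] by blast
    have "norm (f n) \<le> 1" for n using fr[of n] r01[of n] by simp
    then show "norm R \<le> 1"
      by (intro LIMSEQ_le_const2[OF tendsto_norm[OF R]]) auto
    fix Q assume Q: "closed Q" "0 \<in> Q" "\<And>r. r \<in> Q \<Longrightarrow> (1/2) *\<^sub>R (s + (r o\<^sub>L r)) \<in> Q"
    have "f n \<in> Q" for n by (induction n) (auto simp: f Q)
    then show "R \<in> Q" using closed_sequentially[OF Q(1) _ R] by blast
  qed
qed

lemma blinfun_compose_assoc: "(f o\<^sub>L g) o\<^sub>L h = f o\<^sub>L (g o\<^sub>L h)"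
  by (auto intro!: blinfun_eqI)

lemma commute_square: "B o\<^sub>L A = A o\<^sub>L B \<Longrightarrow> B o\<^sub>L (A o\<^sub>L A) = (A o\<^sub>L A) o\<^sub>L B"
  by (metis blinfun_compose_assoc)

definition selfadjoint :: "('h::complex_hilbert_space \<Rightarrow>\<^sub>L 'h) \<Rightarrow> bool" where
  "selfadjoint A \<longleftrightarrow> (\<forall>x y. cinner (A x) y = cinner x (A y))"

text \<open>
  With \<open>s = 1 - A\<^sup>2\<close>, which has norm at most \<open>1\<close> because \<open>A\<close> is a self-adjoint contraction, the
  operator \<open>D = 1 - R\<close> of the previous lemma squares to \<open>A\<^sup>2\<close>. It is positive because \<open>norm R \<le> 1\<close>.
\<close>

lemma abs_operator_contraction:
  fixes A :: "'h::complex_hilbert_space \<Rightarrow>\<^sub>L 'h"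
  assumes A: "selfadjoint A" "norm A \<le> 1"
  obtains D where "(D o\<^sub>L D) = (A o\<^sub>L A)" "\<And>x. 0 \<le> Re (cinner (D x) x)"
    "\<And>B. (B o\<^sub>L A) = (A o\<^sub>L B) \<Longrightarrow> (B o\<^sub>L D) = (D o\<^sub>L B)"
proof -
  define s where "s = id_blinfun - (A o\<^sub>L A)"
  have "norm (s x) \<le> 1 * norm x" for x
  proof -
    have sa: "cinner (A x) y = cinner x (A y)" for x y using A(1) by (simp add: selfadjoint_def)
    have "(norm (s x))\<^sup>2 = (norm x)\<^sup>2 + (norm (A (A x)))\<^sup>2 - 2 * Re (cinner x (A (A x)))"
      by (simp add: s_def blinfun.diff_left norm_diff_square)
    also have "cinner x (A (A x)) = complex_of_real ((norm (A x))\<^sup>2)"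
      by (simp add: sa[symmetric] cinner_eq_norm_square)
    also have "norm (A (A x)) \<le> norm (A x)"
      using norm_blinfun[of A "A x"] A(2) mult_right_mono[OF A(2), of "norm (A x)"] by simp
    then have "(norm (A (A x)))\<^sup>2 \<le> (norm (A x))\<^sup>2" by (simp add: power_mono)
    finally have "(norm (s x))\<^sup>2 \<le> (norm x)\<^sup>2 - (norm (A x))\<^sup>2" by simp
    then have "(norm (s x))\<^sup>2 \<le> (norm x)\<^sup>2" using zero_le_power2[of "norm (A x)"] by linarith
    from power2_le_imp_le[OF this norm_ge_zero] show ?thesis by simp
  qed
  then have "norm s \<le> 1" by (intro norm_blinfun_bound) auto
  then obtain R where R: "R = (1/2) *\<^sub>R (s + (R o\<^sub>L R))" "norm R \<le> 1"
    "\<And>Q. closed Q \<Longrightarrow> 0 \<in> Q \<Longrightarrow> (\<And>r. r \<in> Q \<Longrightarrow> (1/2) *\<^sub>R (s + (r o\<^sub>L r)) \<in> Q) \<Longrightarrow> R \<in> Q"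
    using sqrt_iteration by blast
  define D where "D = id_blinfun - R"
  have [simp]: "(X o\<^sub>L id_blinfun) = X" "(id_blinfun o\<^sub>L X) = X" for X :: "'h \<Rightarrow>\<^sub>L 'h"
    by (auto intro!: blinfun_eqI)
  show thesis
  proof (rule that)
    have "2 *\<^sub>R R = s + (R o\<^sub>L R)" by (subst R(1)) simp
    then have "R + R = id_blinfun - (A o\<^sub>L A) + (R o\<^sub>L R)" by (simp add: s_def scaleR_2)
    then show "(D o\<^sub>L D) = (A o\<^sub>L A)"
      by (simp add: D_def blinfun_compose_distribs algebra_simps)
    fix x
    have "Re (cinner (R x) x) \<le> norm (R x) * norm x"
      using cauchy_schwarz[of "R x" x] complex_Re_le_cmod order_trans by blast
    also have "... \<le> (1 * norm x) * norm x"
      using norm_blinfun[of R x] mult_right_mono[OF R(2), of "norm x"]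
      by (intro mult_right_mono) auto
    finally show "0 \<le> Re (cinner (D x) x)"
      by (simp add: D_def blinfun.diff_left cinner_diff_left cinner_eq_norm_square power2_eq_square)
  next
    fix B assume B: "(B o\<^sub>L A) = (A o\<^sub>L B)"
    have "(B o\<^sub>L (A o\<^sub>L A)) = ((A o\<^sub>L A) o\<^sub>L B)" by (rule commute_square[OF B])
    then have Bs: "(B o\<^sub>L s) = (s o\<^sub>L B)"
      by (simp add: s_def blinfun_compose_distribs)
    have "R \<in> {R. (B o\<^sub>L R) = (R o\<^sub>L B)}"
    proof (rule R(3))
      show "closed {R. (B o\<^sub>L R) = (R o\<^sub>L B)}"
        by (intro closed_Collect_eq bounded_bilinear.continuous_on[OF bounded_bilinear_blinfun_compose] continuous_intros)
      fix r assume r: "r \<in> {R. (B o\<^sub>L R) = (R o\<^sub>L B)}"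
      then have "(B o\<^sub>L (r o\<^sub>L r)) = ((r o\<^sub>L r) o\<^sub>L B)" by (auto intro: commute_square)
      then show "(1/2) *\<^sub>R (s + (r o\<^sub>L r)) \<in> {R. (B o\<^sub>L R) = (R o\<^sub>L B)}"
        using Bs by (simp add: blinfun_compose_distribs)
    qed simp
    then show "(B o\<^sub>L D) = (D o\<^sub>L B)"
      by (simp add: D_def blinfun_compose_distribs)
  qed
qed

text \<open>
  The absolute value \<open>D\<close> of \<open>A\<close>. It replaces the spectral theorem in the proof of Schur's lemma below:
  the kernel of \<open>D - A\<close> is a spectral subspace of \<open>A\<close>, and it is invariant under everything that
  commutes with \<open>A\<close>.
\<close>

lemma abs_operator:
  fixes A :: "'h::complex_hilbert_space \<Rightarrow>\<^sub>L 'h"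
  assumes A: "selfadjoint A"
  obtains D where "(D o\<^sub>L D) = (A o\<^sub>L A)" "\<And>x. 0 \<le> Re (cinner (D x) x)"
    "\<And>B. (B o\<^sub>L A) = (A o\<^sub>L B) \<Longrightarrow> (B o\<^sub>L D) = (D o\<^sub>L B)"
proof -
  define c where "c = norm A + 1"
  have c: "c > 0" by (simp add: c_def add_nonneg_pos)
  define A' where "A' = (1/c) *\<^sub>R A"
  have "selfadjoint A'" using A
    by (simp add: A'_def selfadjoint_def blinfun.scaleR_left cinner_scaleR_left cinner_scaleR_right)
  moreover have "norm A' \<le> 1" using c by (simp add: A'_def c_def field_simps)
  ultimately obtain D where D: "(D o\<^sub>L D) = (A' o\<^sub>L A')" "\<And>x. 0 \<le> Re (cinner (D x) x)"
    "\<And>B. (B o\<^sub>L A') = (A' o\<^sub>L B) \<Longrightarrow> (B o\<^sub>L D) = (D o\<^sub>L B)"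
    using abs_operator_contraction by blast
  show thesis
  proof (rule that)
    show "((c *\<^sub>R D) o\<^sub>L (c *\<^sub>R D)) = (A o\<^sub>L A)"
      using D(1) c by (simp add: A'_def blinfun_compose_distribs)
    show "0 \<le> Re (cinner ((c *\<^sub>R D) x) x)" for x
      using D(2)[of x] c by (simp add: blinfun.scaleR_left cinner_scaleR_left)
    show "(B o\<^sub>L (c *\<^sub>R D)) = ((c *\<^sub>R D) o\<^sub>L B)" if "(B o\<^sub>L A) = (A o\<^sub>L B)" for B
      using D(3)[of B] that by (simp add: A'_def blinfun_compose_distribs)
  qed
qed

section \<open>Irreducible representations with commuting compressions\<close>

text \<open>
  Polarization, applied to the pair of \<open>x\<close> and \<open>S x\<close>.
\<close>

lemma selfadjoint_eq_zeroI:
  fixes S :: "'h::complex_hilbert_space \<Rightarrow>\<^sub>L 'h"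
  assumes "selfadjoint S" "csubspace V" "\<And>x. x \<in> V \<Longrightarrow> S x \<in> V"
    and zero: "\<And>x. x \<in> V \<Longrightarrow> Re (cinner (S x) x) = 0" and x: "x \<in> V"
  shows "S x = 0"
proof -
  have y: "S x \<in> V" and xy: "x + S x \<in> V" using assms(2,3) x csubspaceD(2) by metis+
  have "Re (cinner (S (x + S x)) (x + S x)) = Re (cinner (S x) x) + Re (cinner (S (S x)) (S x))
      + Re (cinner (S x) (S x)) + Re (cinner (S (S x)) x)"
    by (simp add: blinfun.add_right cinner_add_left cinner_add_right)
  also have "cinner (S (S x)) x = cinner (S x) (S x)" using assms(1) by (simp add: selfadjoint_def)
  finally have "Re (cinner (S x) (S x)) = 0" using zero[OF xy] zero[OF x] zero[OF y] by simp
  then show ?thesis by (simp add: cinner_eq_norm_square)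
qed

text \<open>
  A Schur lemma: if \<open>T\<close> were not a scalar on \<open>V\<close>, two of its Rayleigh quotients would differ. Subtract
  a number strictly between them to get an indefinite operator \<open>A\<close>, and let \<open>D\<close> be its absolute value.
  The kernel of \<open>D - A\<close> in \<open>V\<close> is a closed subspace that is invariant under \<open>\<T>\<close>. It is not \<open>V\<close>,
  since \<open>A\<close> is not positive on \<open>V\<close>, and it is not \<open>{0}\<close>, since otherwise \<open>D = - A\<close> on \<open>V\<close> and \<open>A\<close>
  would be negative there.
\<close>

lemma commuting_selfadjoint_scalar:
  fixes T :: "'h::complex_hilbert_space \<Rightarrow>\<^sub>L 'h"
  assumes V: "csubspace V" "closed V"
    and irr: "\<And>W. csubspace W \<Longrightarrow> closed W \<Longrightarrow> W \<subseteq> V \<Longrightarrow> W \<noteq> {0} \<Longrightarrow>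
                 (\<And>B x. B \<in> \<T> \<Longrightarrow> x \<in> W \<Longrightarrow> blinfun_apply B x \<in> W) \<Longrightarrow> W = V"
    and \<T>: "\<And>B x. B \<in> \<T> \<Longrightarrow> x \<in> V \<Longrightarrow> blinfun_apply B x \<in> V"
    and T: "selfadjoint T" "\<And>a x. T (a *\<^sub>C x) = a *\<^sub>C T x"
    and comm: "\<And>B. B \<in> \<T> \<Longrightarrow> B o\<^sub>L T = T o\<^sub>L B"
    and P: "P o\<^sub>L T = T o\<^sub>L P" "\<And>x. blinfun_apply P x \<in> V" "\<And>x. x \<in> V \<Longrightarrow> blinfun_apply P x = x"
  shows "\<exists>c::real. \<forall>x\<in>V. T x = c *\<^sub>R x"
proof (rule ccontr)
  assume no: "\<not> ?thesis"
  have TV: "T x \<in> V" if "x \<in> V" for x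
    using P that by (metis blinfun_apply_blinfun_compose)
  have shift: "Re (cinner ((T - c *\<^sub>R id_blinfun) x) x) = Re (cinner (T x) x) - c * (norm x)\<^sup>2" for x and c :: real
    by (simp add: blinfun.diff_left blinfun.scaleR_left cinner_diff_left cinner_scaleR_left cinner_eq_norm_square)
  have sa: "selfadjoint (T - c *\<^sub>R id_blinfun)" for c :: real
    using T(1) by (simp add: selfadjoint_def blinfun.diff_left blinfun.scaleR_left cinner_diff_left
        cinner_diff_right cinner_scaleR_left cinner_scaleR_right)
  have ex: "\<exists>w\<in>V. w \<noteq> 0 \<and> Re (cinner (T w) w) \<noteq> c * (norm w)\<^sup>2" for c
  proof (rule ccontr)
    assume neg: "\<not> ?thesis"
    have "(T - c *\<^sub>R id_blinfun) x = 0" if x: "x \<in> V" for x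
    proof (rule selfadjoint_eq_zeroI[OF sa V(1) _ _ x])
      show "(T - c *\<^sub>R id_blinfun) y \<in> V" if "y \<in> V" for y
        using that TV csubspaceD[OF V(1)] by (simp add: blinfun.diff_left blinfun.scaleR_left)
      show "Re (cinner ((T - c *\<^sub>R id_blinfun) y) y) = 0" if "y \<in> V" for y
        using neg that unfolding shift by (cases "y = 0") auto
    qed
    then have "\<forall>x\<in>V. T x = c *\<^sub>R x" by (simp add: blinfun.diff_left blinfun.scaleR_left)
    then show False using no by blast
  qed
  obtain v where v: "v \<in> V" "v \<noteq> 0" using ex[of 0] by blast
  define c where "c = Re (cinner (T v) v) / (norm v)\<^sup>2"
  obtain w where w: "w \<in> V" "w \<noteq> 0" "Re (cinner (T w) w) \<noteq> c * (norm w)\<^sup>2" using ex by blast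
  define d where "d = Re (cinner (T w) w) / (norm w)\<^sup>2"
  have cd: "c \<noteq> d" "Re (cinner (T v) v) = c * (norm v)\<^sup>2" "Re (cinner (T w) w) = d * (norm w)\<^sup>2"
    using w v by (auto simp: c_def d_def field_simps)
  define m where "m = (c + d) / 2"
  define A where "A = T - m *\<^sub>R id_blinfun"
  have "Re (cinner (A v) v) = (c - m) * (norm v)\<^sup>2" "Re (cinner (A w) w) = (d - m) * (norm w)\<^sup>2"
    unfolding A_def shift cd by (auto simp: algebra_simps)
  moreover have "(norm v)\<^sup>2 > 0" "(norm w)\<^sup>2 > 0" using v w by auto
  moreover have "c - m < 0 \<and> 0 < d - m \<or> 0 < c - m \<and> d - m < 0" using cd(1) by (auto simp: m_def field_simps)
  ultimately have "Re (cinner (A v) v) < 0 \<and> 0 < Re (cinner (A w) w) \<or> 0 < Re (cinner (A v) v) \<and> Re (cinner (A w) w) < 0"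
    by (metis mult_neg_pos mult_pos_pos)
  then have opp: "\<not> (\<forall>x\<in>V. 0 \<le> Re (cinner (A x) x))" "\<not> (\<forall>x\<in>V. Re (cinner (A x) x) \<le> 0)"
    using v(1) w(1) by (meson not_le)+
  obtain D where D: "D o\<^sub>L D = A o\<^sub>L A" "\<And>x. 0 \<le> Re (cinner (D x) x)"
    "\<And>B. B o\<^sub>L A = A o\<^sub>L B \<Longrightarrow> B o\<^sub>L D = D o\<^sub>L B"
    using abs_operator[OF sa] unfolding A_def by blast
  have commA: "B o\<^sub>L A = A o\<^sub>L B" if "B o\<^sub>L T = T o\<^sub>L B" for B :: "'h \<Rightarrow>\<^sub>L 'h"
  proof (rule blinfun_eqI)
    fix x show "(B o\<^sub>L A) x = (A o\<^sub>L B) x"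
      using arg_cong[OF that, of "\<lambda>F. F x"]
      by (simp add: A_def blinfun.diff_left blinfun.diff_right blinfun.scaleR_left blinfun.scaleR_right)
  qed
  have commD: "B (D x) = D (B x)" "B (A x) = A (B x)" if "B o\<^sub>L T = T o\<^sub>L B" for B :: "'h \<Rightarrow>\<^sub>L 'h" and x
    using D(3)[OF commA[OF that]] commA[OF that] by (metis blinfun_apply_blinfun_compose)+
  have DA: "A (D x) = D (A x)" for x
    using D(3)[of A] by (metis blinfun_apply_blinfun_compose)
  have DD: "D (D x) = A (A x)" for x using D(1) by (metis blinfun_apply_blinfun_compose)
  define W where "W = {x\<in>V. D x = A x}"
  have "closed W"
  proof -
    have "W = V \<inter> {x. D x = A x}" by (auto simp: W_def)
    moreover have "closed {x. D x = A x}" by (intro closed_Collect_eq continuous_intros)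
    ultimately show ?thesis using V(2) by auto
  qed
  moreover have "csubspace W"
    unfolding complex_vector.subspace_def
  proof (intro conjI ballI allI)
    show "0 \<in> W" using csubspaceD(1)[OF V(1)] by (simp add: W_def)
    show "x + y \<in> W" if "x \<in> W" "y \<in> W" for x y
      using that csubspaceD(2)[OF V(1)] by (simp add: W_def blinfun.add_right)
    show "a *\<^sub>C x \<in> W" if "x \<in> W" for a x
    proof -
      \<comment> \<open>Bounded operators are real-linear here; \<open>D\<close> is complex-linear because it commutes with
        multiplication by \<open>a\<close>, as \<open>T\<close> does.\<close>
      have bl: "blinfun_apply (Blinfun (\<lambda>x::'h. a *\<^sub>C x)) = (\<lambda>x. a *\<^sub>C x)"
        by (rule bounded_linear_Blinfun_apply[OF bounded_linear_scaleC])
      have "Blinfun (\<lambda>x::'h. a *\<^sub>C x) o\<^sub>L T = T o\<^sub>L Blinfun (\<lambda>x. a *\<^sub>C x)"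
        by (rule blinfun_eqI) (simp add: bl T(2))
      from commD[OF this, of x] have "D (a *\<^sub>C x) = a *\<^sub>C D x" "A (a *\<^sub>C x) = a *\<^sub>C A x"
        by (simp_all add: bl)
      then show ?thesis using that csubspaceD(3)[OF V(1)] by (simp add: W_def)
    qed
  qed
  moreover have "B x \<in> W" if "B \<in> \<T>" "x \<in> W" for B x
    using commD[OF comm[OF that(1)], of x] that \<T> by (simp add: W_def)
  moreover have "W \<noteq> V"
  proof
    assume "W = V"
    then have "D x = A x" if "x \<in> V" for x using that by (auto simp: W_def)
    then show False using opp(1) D(2) by metis
  qed
  ultimately have W0: "W = {0}" using irr[of W] by (auto simp: W_def)
  have "D x = - A x" if x: "x \<in> V" for x
  proof -
    have AV: "A y \<in> V" "D y \<in> V" if "y \<in> V" for y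
      using that P(2)[of "A y"] P(2)[of "D y"] commD[OF P(1)] P(3) by simp_all
    \<comment> \<open>\<open>(D - A) (D + A) = D\<^sup>2 - A\<^sup>2 = 0\<close>, as \<open>D\<close> and \<open>A\<close> commute.\<close>
    have "D x + A x \<in> W"
      using AV[OF x] csubspaceD(2)[OF V(1)] by (simp add: W_def blinfun.add_right DA DD)
    then show ?thesis using W0 by (simp add: eq_neg_iff_add_eq_0)
  qed
  then have "Re (cinner (A x) x) = - Re (cinner (D x) x)" if "x \<in> V" for x using that by simp
  then have "\<forall>x\<in>V. Re (cinner (A x) x) \<le> 0" using D(2) by simp
  then show False using opp(2) by blast
qed

lemma unitary_repD:
  assumes "unitary_rep G T \<rho>"
  shows "g \<in> carrier G \<Longrightarrow> \<rho> g \<in> carrier unitary_group"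
    "g \<in> carrier G \<Longrightarrow> h \<in> carrier G \<Longrightarrow> \<rho> (g \<otimes>\<^bsub>G\<^esub> h) x = \<rho> g (\<rho> h x)"
    "continuous_map T euclidean (\<lambda>g. \<rho> g v)"
proof -
  have h: "\<rho> \<in> hom G unitary_group" and c: "\<forall>v. continuous_map T euclidean (\<lambda>g. \<rho> g v)"
    using assms by (auto simp: unitary_rep_def)
  show "g \<in> carrier G \<Longrightarrow> \<rho> g \<in> carrier unitary_group" using h by (rule hom_in_carrier)
  show "\<rho> (g \<otimes>\<^bsub>G\<^esub> h) x = \<rho> g (\<rho> h x)" if "g \<in> carrier G" "h \<in> carrier G"
    using hom_mult[OF h that] by (simp add: unitary_group_def)
  show "continuous_map T euclidean (\<lambda>g. \<rho> g v)" using c by blast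
qed

lemma unitary_rep_one:
  assumes "group G" "unitary_rep G T \<rho>"
  shows "\<rho> \<one>\<^bsub>G\<^esub> x = x"
proof -
  interpret group G by fact
  note R = unitary_repD[OF assms(2)]
  have "\<rho> \<one>\<^bsub>G\<^esub> (\<rho> \<one>\<^bsub>G\<^esub> x) = \<rho> \<one>\<^bsub>G\<^esub> x" using R(2)[of "\<one>\<^bsub>G\<^esub>" "\<one>\<^bsub>G\<^esub>" x] by simp
  then have "norm (\<rho> \<one>\<^bsub>G\<^esub> x - x) = 0"
    using unitary_groupD(4,5)[OF R(1)[OF one_closed]] by (metis diff_self norm_zero)
  then show ?thesis by simp
qed

lemma unitary_rep_inv:
  assumes "group G" "unitary_rep G T \<rho>" "g \<in> carrier G"
  shows "\<rho> (inv\<^bsub>G\<^esub> g) (\<rho> g x) = x" "\<rho> g (\<rho> (inv\<^bsub>G\<^esub> g) x) = x"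
    "cinner (\<rho> g x) y = cinner x (\<rho> (inv\<^bsub>G\<^esub> g) y)"
proof -
  interpret group G by fact
  note R = unitary_repD[OF assms(2)]
  note g = assms(3)
  show 1: "\<rho> (inv\<^bsub>G\<^esub> g) (\<rho> g x) = x" "\<rho> g (\<rho> (inv\<^bsub>G\<^esub> g) x) = x" for x
    using R(2)[of "inv\<^bsub>G\<^esub> g" g x] R(2)[of g "inv\<^bsub>G\<^esub> g" x] g unitary_rep_one[OF assms(1,2)] by simp_all
  show "cinner (\<rho> g x) y = cinner x (\<rho> (inv\<^bsub>G\<^esub> g) y)"
    using unitary_groupD(3)[OF R(1)[OF g], of x "\<rho> (inv\<^bsub>G\<^esub> g) y"] 1(2)[of y] by simp
qed

lemma invariant_vectors_subspace:
  assumes "unitary_rep G T \<rho>" "K \<subseteq> carrier G"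
  shows "csubspace (invariant_vectors K \<rho>)" "closed (invariant_vectors K \<rho>)"
proof -
  have U: "\<rho> k \<in> carrier unitary_group" if "k \<in> K" for k using unitary_repD(1)[OF assms(1)] that assms(2) by blast
  show "csubspace (invariant_vectors K \<rho>)"
    unfolding complex_vector.subspace_def invariant_vectors_def
    using unitary_groupD(1,2)[OF U] bounded_linear.linear[OF unitary_groupD(6)[OF U]]
    by (auto simp: linear_0)
  have "closed {v. \<rho> k v = v}" if "k \<in> K" for k
    by (intro closed_Collect_eq continuous_intros linear_continuous_on unitary_groupD(6) U that)
  then have "closed (\<Inter>k\<in>K. {v. \<rho> k v = v})" by blast
  moreover have "(\<Inter>k\<in>K. {v. \<rho> k v = v}) = invariant_vectors K \<rho>" by (auto simp: invariant_vectors_def)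
  ultimately show "closed (invariant_vectors K \<rho>)" by simp
qed

text \<open>
  The operators \<open>C g = P \<circ> \<rho> g \<circ> P\<close> form a commuting family that is closed under adjoints, and \<open>V\<close>
  has no closed subspace invariant under it except \<open>{0}\<close> and \<open>V\<close> (the fact \<open>irrW\<close> below). By Schur's
  lemma the real and imaginary parts of \<open>C g\<close> are scalars on \<open>V\<close>. Then every line in \<open>V\<close> is invariant.
\<close>

lemma commuting_compressions_imp_cdim_le_1:
  fixes \<rho> :: "'g \<Rightarrow> 'h::complex_hilbert_space \<Rightarrow> 'h"
  assumes G: "group G" and irr: "irreducible_unitary_rep G T \<rho>"
    and V: "csubspace V" "closed V"
    and P: "bounded_linear P" "\<And>a x. P (a *\<^sub>C x) = a *\<^sub>C P x"
      "\<And>x. P x \<in> V" "\<And>x. x \<in> V \<Longrightarrow> P x = x" "\<And>x y. cinner (P x) y = cinner x (P y)"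
    and comm: "\<And>g h x y. g \<in> carrier G \<Longrightarrow> h \<in> carrier G \<Longrightarrow> x \<in> V \<Longrightarrow> y \<in> V \<Longrightarrow>
        cinner (\<rho> g (P (\<rho> h x))) y = cinner (\<rho> h (P (\<rho> g x))) y"
  shows "cdim_le V 1"
proof -
  interpret group G by fact
  have rep: "unitary_rep G T \<rho>" using irr by (simp add: irreducible_unitary_rep_def)
  note R = unitary_repD[OF rep]
  note U = unitary_groupD[OF R(1)]
  define C where "C = (\<lambda>g. Blinfun (\<lambda>x. P (\<rho> g (P x))))"
  have C: "blinfun_apply (C g) x = P (\<rho> g (P x))" if "g \<in> carrier G" for g x
    unfolding C_def
    by (subst bounded_linear_Blinfun_apply) (intro bounded_linear_compose[OF P(1)] bounded_linear_compose[OF U(6)[OF that] P(1)], simp)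
  define \<T> where "\<T> = C ` carrier G"
  have irrW: "W = V" if W: "csubspace W" "closed W" "W \<subseteq> V" "W \<noteq> {0}"
    "\<And>B x. B \<in> \<T> \<Longrightarrow> x \<in> W \<Longrightarrow> blinfun_apply B x \<in> W" for W
  proof
    \<comment> \<open>The translates of \<open>W\<close> span a dense subspace, by irreducibility. The projection \<open>P\<close> maps it into
      \<open>W\<close> and fixes \<open>V\<close> pointwise.\<close>
    show "W \<subseteq> V" by fact
    define S where "S = {\<rho> g w | g w. g \<in> carrier G \<and> w \<in> W}"
    define M where "M = closure (cspan S)"
    have inS: "\<rho> h s \<in> S" if "s \<in> S" "h \<in> carrier G" for s h
    proof -
      from that obtain g w where "s = \<rho> g w" "g \<in> carrier G" "w \<in> W" by (auto simp: S_def)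
      then show ?thesis using R(2)[OF that(2), of g w] that(2) unfolding S_def by (metis (mono_tags, lifting) m_closed mem_Collect_eq)
    qed
    have "\<rho> h x \<in> cspan S" if h: "h \<in> carrier G" and x: "x \<in> cspan S" for h x
      using x
    proof (induction rule: complex_vector.span_induct_alt)
      case base show ?case using linear_0[OF bounded_linear.linear[OF U(6)[OF h]]] by (simp add: complex_vector.span_zero)
    next
      case (step c y z)
      then show ?case using inS[OF step(1) h]
        by (simp add: U(1)[OF h] U(2)[OF h] complex_vector.span_add complex_vector.span_scale complex_vector.span_base)
    qed
    then have "\<rho> h ` M \<subseteq> M" if "h \<in> carrier G" for h
      unfolding M_def using that
      by (intro image_closure_subset linear_continuous_on U(6)) (auto intro: closure_subset[THEN subsetD])
    moreover have "csubspace M" "closed M" by (auto simp: M_def csubspace_closure)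
    moreover have "M \<noteq> {0}"
    proof -
      obtain w where "w \<in> W" "w \<noteq> 0" using W(4) csubspaceD(1)[OF W(1)] by blast
      moreover have "w \<in> S" if "w \<in> W" unfolding S_def using unitary_rep_one[OF G rep, of w] that by force
      ultimately have "w \<in> M" unfolding M_def using complex_vector.span_base closure_subset by fastforce
      then show ?thesis using \<open>w \<noteq> 0\<close> by auto
    qed
    ultimately have M: "M = UNIV" using irr unfolding irreducible_unitary_rep_def by blast
    have "P x \<in> W" if "x \<in> cspan S" for x
      using that
    proof (induction rule: complex_vector.span_induct_alt)
      case base show ?case using linear_0[OF bounded_linear.linear[OF P(1)]] csubspaceD(1)[OF W(1)] by simp
    next
      case (step c y z)
      then obtain g w where "y = \<rho> g w" "g \<in> carrier G" "w \<in> W" by (auto simp: S_def)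
      moreover from this have "P w = w" using P(4) W(3) by blast
      ultimately have "P y \<in> W" using W(5)[of "C g" w] C[of g w] by (simp add: \<T>_def)
      then show ?case using step csubspaceD(2,3)[OF W(1)]
        by (simp add: P(2) linear_add[OF bounded_linear.linear[OF P(1)]])
    qed
    then have "P ` M \<subseteq> W" unfolding M_def
      by (intro image_closure_subset linear_continuous_on P W) auto
    then show "V \<subseteq> W" using M P(4) by (metis UNIV_I image_subset_iff subsetI)
  qed
  have adj: "cinner (C g x) y = cinner x (C (inv\<^bsub>G\<^esub> g) y)" if "g \<in> carrier G" for g x y
    using that by (simp add: C P(5) unitary_rep_inv(3)[OF G rep])
  have CV: "C g x \<in> V" if "g \<in> carrier G" for g x using that by (simp add: C P(3))
  have CC: "C g (C h x) = C h (C g x)" if "g \<in> carrier G" "h \<in> carrier G" for g h x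
  proof (rule cinner_eqI)
    fix y
    show "cinner (C g (C h x)) y = cinner (C h (C g x)) y"
      using comm[OF that P(3) P(3), of x y] that by (simp add: C P(4)[OF P(3)] P(5))
  qed
  have Csc: "C g (a *\<^sub>C x) = a *\<^sub>C C g x" if "g \<in> carrier G" for g a x
    using that by (simp add: C P(2) U(2))
  define J where "J = Blinfun (\<lambda>x::'h. \<i> *\<^sub>C x)"
  have J: "blinfun_apply J x = \<i> *\<^sub>C x" for x
    unfolding J_def by (simp add: bounded_linear_Blinfun_apply[OF bounded_linear_scaleC])
  define PB where "PB = Blinfun P"
  have PB: "blinfun_apply PB x = P x" for x
    unfolding PB_def by (simp add: bounded_linear_Blinfun_apply[OF P(1)])
  have TV: "blinfun_apply B x \<in> V" if "B \<in> \<T>" for B x using that CV by (auto simp: \<T>_def)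
  have scal: "\<exists>c. \<forall>x\<in>V. C g x = c *\<^sub>C x" if g: "g \<in> carrier G" for g
  proof -
    have ig: "inv\<^bsub>G\<^esub> g \<in> carrier G" and ii: "inv\<^bsub>G\<^esub> (inv\<^bsub>G\<^esub> g) = g" using g by auto
    \<comment> \<open>Up to the factor \<open>2\<close>, the real part of \<open>C g\<close> and the negative of its imaginary part.\<close>
    let ?a = "C g + C (inv\<^bsub>G\<^esub> g)" and ?b = "J o\<^sub>L (C g - C (inv\<^bsub>G\<^esub> g))"
    note simps = blinfun.add_left blinfun.diff_left J PB Csc[OF g] Csc[OF ig] complex_vector.scale_right_diff_distrib
      scaleC_add_right scaleC_scaleC mult.commute
    have "\<exists>c::real. \<forall>x\<in>V. blinfun_apply ?a x = c *\<^sub>R x"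
    proof (rule commuting_selfadjoint_scalar[OF V irrW TV, where P = PB])
      show "selfadjoint ?a" unfolding selfadjoint_def
        by (auto simp: simps cinner_add_left cinner_add_right adj g ig)
      show "?a (a *\<^sub>C x) = a *\<^sub>C ?a x" for a x by (simp add: simps)
      show "B o\<^sub>L ?a = ?a o\<^sub>L B" if "B \<in> \<T>" for B
        using that g ig by (auto intro!: blinfun_eqI simp: \<T>_def simps blinfun.add_right CC)
      show "PB o\<^sub>L ?a = ?a o\<^sub>L PB"
        by (rule blinfun_eqI) (simp add: simps blinfun.add_right C g ig P(4)[OF P(3)] linear_add[OF bounded_linear.linear[OF P(1)]])
    qed (auto simp: PB P)
    then obtain c :: real where c: "\<And>x. x \<in> V \<Longrightarrow> ?a x = c *\<^sub>R x" by blast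
    have "\<exists>c::real. \<forall>x\<in>V. blinfun_apply ?b x = c *\<^sub>R x"
    proof (rule commuting_selfadjoint_scalar[OF V irrW TV, where P = PB])
      show "selfadjoint ?b" unfolding selfadjoint_def
        by (auto simp: simps cinner_diff_left cinner_diff_right adj g ig cinner_scaleC_left cinner_scaleC_right algebra_simps)
      show "?b (a *\<^sub>C x) = a *\<^sub>C ?b x" for a x by (simp add: simps)
      show "B o\<^sub>L ?b = ?b o\<^sub>L B" if "B \<in> \<T>" for B
        using that g ig by (auto intro!: blinfun_eqI simp: \<T>_def simps blinfun.diff_right CC Csc)
      show "PB o\<^sub>L ?b = ?b o\<^sub>L PB"
        by (rule blinfun_eqI) (simp add: simps blinfun.diff_right C g ig P(2) P(4)[OF P(3)] linear_diff[OF bounded_linear.linear[OF P(1)]])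
    qed (auto simp: PB P)
    then obtain d :: real where d: "\<And>x. x \<in> V \<Longrightarrow> ?b x = d *\<^sub>R x" by blast
    have "C g x = (complex_of_real c / 2 - \<i> * complex_of_real d / 2) *\<^sub>C x" if x: "x \<in> V" for x
    proof -
      have "(1/2) *\<^sub>C ?a x + (- \<i> / 2) *\<^sub>C ?b x = (1/2) *\<^sub>C (C g x + C (inv\<^bsub>G\<^esub> g) x) + (1/2) *\<^sub>C (C g x - C (inv\<^bsub>G\<^esub> g) x)"
        by (simp add: blinfun.add_left blinfun.diff_left J scaleC_scaleC)
      also have "... = (1/2) *\<^sub>C (C g x + C g x)" by (simp add: scaleC_add_right[symmetric])
      also have "... = C g x" by (simp add: scaleC_add_right scaleC_add_left[symmetric] scaleC_one)
      finally show ?thesis unfolding c[OF x] d[OF x]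
        by (simp add: scaleR_scaleC scaleC_scaleC complex_vector.scale_left_diff_distrib)
    qed
    then show ?thesis by blast
  qed
  show ?thesis
  proof (cases "V = {0}")
    case True
    then show ?thesis unfolding cdim_le_def by (intro exI[of _ "{}"]) (auto simp: complex_vector.independent_empty)
  next
    case False
    then obtain v where v: "v \<in> V" "v \<noteq> 0" using csubspaceD(1)[OF V(1)] by blast
    \<comment> \<open>The line through \<open>v\<close>, written as the kernel of a bounded operator so that it is visibly closed.\<close>
    define W where "W = {x\<in>V. complex_of_real ((norm v)\<^sup>2) *\<^sub>C x = cinner v x *\<^sub>C v}"
    have "bounded_linear (\<lambda>c. c *\<^sub>C v)"
      by (rule bounded_linear_intro[of _ "norm v"])
        (auto simp: scaleC_add_left norm_scaleC scaleR_scaleC scaleC_scaleC scaleR_conv_of_real scaleC_complex_def)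
    from bounded_linear_compose[OF this bounded_bilinear.bounded_linear_right[OF bounded_bilinear_cinner]]
    have lin: "bounded_linear (\<lambda>x. cinner v x *\<^sub>C v)" .
    have "W = V"
    proof (rule irrW)
      show "csubspace W" unfolding complex_vector.subspace_def W_def using csubspaceD(1-3)[OF V(1)]
        by (auto simp: cinner_add_right scaleC_add_left scaleC_add_right cinner_scaleC_right)
          (metis mult.commute scaleC_scaleC)
      have "W = V \<inter> {x. complex_of_real ((norm v)\<^sup>2) *\<^sub>C x = cinner v x *\<^sub>C v}" by (auto simp: W_def)
      moreover have "closed {x. complex_of_real ((norm v)\<^sup>2) *\<^sub>C x = cinner v x *\<^sub>C v}"
        by (intro closed_Collect_eq linear_continuous_on lin bounded_linear_scaleC)
      ultimately show "closed W" using V(2) by auto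
      have "v \<in> W" using v by (simp add: W_def cinner_eq_norm_square)
      then show "W \<noteq> {0}" using v by auto
      show "blinfun_apply B x \<in> W" if B: "B \<in> \<T>" and x: "x \<in> W" for B x
      proof -
        obtain g where g: "B = C g" "g \<in> carrier G" using B by (auto simp: \<T>_def)
        then obtain c where c: "\<And>x. x \<in> V \<Longrightarrow> C g x = c *\<^sub>C x" using scal by blast
        have xV: "x \<in> V" and xe: "complex_of_real ((norm v)\<^sup>2) *\<^sub>C x = cinner v x *\<^sub>C v"
          using x by (auto simp: W_def)
        have "complex_of_real ((norm v)\<^sup>2) *\<^sub>C c *\<^sub>C x = c *\<^sub>C complex_of_real ((norm v)\<^sup>2) *\<^sub>C x"
          by (simp add: scaleC_scaleC mult.commute)
        also have "... = cinner v (c *\<^sub>C x) *\<^sub>C v" by (simp only: xe cinner_scaleC_right scaleC_scaleC)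
        finally show ?thesis unfolding g(1) c[OF xV] using csubspaceD(3)[OF V(1) xV] by (simp add: W_def)
      qed
    qed (auto simp: W_def)
    have "x \<in> cspan {v}" if "x \<in> V" for x
    proof -
      define n where "n = complex_of_real ((norm v)\<^sup>2)"
      have n: "n \<noteq> 0" using v by (simp add: n_def)
      have "x = (1 / n) *\<^sub>C n *\<^sub>C x" using n by (simp add: scaleC_scaleC scaleC_one)
      also have "n *\<^sub>C x = cinner v x *\<^sub>C v" using \<open>W = V\<close> that by (auto simp: W_def n_def)
      finally show ?thesis
        by (metis complex_vector.span_base complex_vector.span_scale insertI1)
    qed
    moreover have "cspan {v} \<subseteq> V" using v(1) V(1) by (intro complex_vector.span_minimal) auto
    ultimately have "cspan {v} = V" by blast
    then show ?thesis unfolding cdim_le_def using v by (intro exI[of _ "{v}"]) (auto simp: complex_vector.dependent_single)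
  qed
qed

section \<open>Functions of class \<open>C\<^sup>k\<close> on the line\<close>

lemma Ck_on_0: "Ck_on 0 f S \<longleftrightarrow> continuous_on S f"
  by (simp add: Ck_on_def)

lemma Ck_on_Suc:
  "Ck_on (Suc k) f S \<longleftrightarrow> (\<forall>x\<in>S. f differentiable at x) \<and> Ck_on k (deriv f) S"
proof -
  have sh: "(deriv ^^ i) (deriv f) = (deriv ^^ Suc i) f" for i by (simp add: funpow_swap1)
  have c: "(\<forall>x\<in>S. f differentiable at x) \<Longrightarrow> continuous_on S f"
    by (meson continuous_at_imp_continuous_on differentiable_imp_continuous_within)
  show ?thesis unfolding Ck_on_def sh
  proof safe
    fix i assume A: "\<forall>i<Suc k. \<forall>x\<in>S. (deriv ^^ i) f differentiable at x" "\<forall>i\<le>Suc k. continuous_on S ((deriv ^^ i) f)"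
    show "f differentiable at x" if "x \<in> S" for x using A(1)[rule_format, of 0] that by simp
    show "(deriv ^^ Suc i) f differentiable at x" if "i < k" "x \<in> S" for x
      using A(1) that by (meson Suc_less_eq)
    show "continuous_on S ((deriv ^^ Suc i) f)" if "i \<le> k" using A(2) that by (meson Suc_le_mono)
  next
    fix i assume A: "\<forall>x\<in>S. f differentiable at x" "\<forall>i<k. \<forall>x\<in>S. (deriv ^^ Suc i) f differentiable at x"
      "\<forall>i\<le>k. continuous_on S ((deriv ^^ Suc i) f)"
    show "(deriv ^^ i) f differentiable at x" if "i < Suc k" "x \<in> S" for x
      using A(1,2) that by (cases i) auto
    show "continuous_on S ((deriv ^^ i) f)" if "i \<le> Suc k"
      using A(3) c[OF A(1)] that by (cases i) auto
  qed
qed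

text \<open>
  Higher derivatives are local. This is needed everywhere because \<open>deriv\<close> is a total operator, and the
  functions that are to be compared agree only on open sets.
\<close>

lemma deriv_funpow_cong:
  assumes "open S" "\<And>x. x \<in> S \<Longrightarrow> f x = g x" "x \<in> S"
  shows "(deriv ^^ i) f x = (deriv ^^ i) (g :: real \<Rightarrow> real) x"
  using assms(3)
proof (induction i arbitrary: x)
  case (Suc i)
  have "\<forall>\<^sub>F y in nhds x. (deriv ^^ i) f y = (deriv ^^ i) g y"
    using eventually_nhds_in_open[OF assms(1) Suc.prems] by eventually_elim (rule Suc.IH)
  then show ?case by (simp add: deriv_cong_ev)
qed (use assms in auto)

text \<open>
  The introduction rule for induction on the order of differentiability. The closure properties
  below follow from it, since the derivative of each construction is again built from functions of
  class \<open>C\<^sup>k\<close>.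
\<close>

lemma Ck_on_SucI:
  assumes "open S" "\<And>x. x \<in> S \<Longrightarrow> (f has_real_derivative f' x) (at x)" "Ck_on k f' S"
  shows "Ck_on (Suc k) f S"
proof -
  have d: "deriv f x = f' x" if "x \<in> S" for x using assms(2)[OF that] by (rule DERIV_imp_deriv)
  have e: "(deriv ^^ i) (deriv f) x = (deriv ^^ i) f' x" if "x \<in> S" for i x
    using deriv_funpow_cong[OF assms(1) d that] .
  have "(deriv ^^ i) (deriv f) differentiable at x" if "i < k" "x \<in> S" for i x
  proof -
    have "((deriv ^^ i) f' has_real_derivative deriv ((deriv ^^ i) f') x) (at x)"
      using assms(3) that by (simp add: Ck_on_def DERIV_deriv_iff_real_differentiable)
    then have "((deriv ^^ i) (deriv f) has_real_derivative deriv ((deriv ^^ i) f') x) (at x)"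
      by (rule has_field_derivative_transform_within_open[OF _ assms(1) that(2)]) (simp add: e)
    then show ?thesis using real_differentiable_def by blast
  qed
  moreover have "continuous_on S ((deriv ^^ i) (deriv f))" if "i \<le> k" for i
    using assms(3) that by (subst continuous_on_cong[OF refl e]) (auto simp: Ck_on_def)
  moreover have "\<forall>x\<in>S. f differentiable at x" using assms(2) real_differentiable_def by blast
  ultimately show ?thesis unfolding Ck_on_Suc by (simp add: Ck_on_def)
qed

lemma Ck_on_SucE:
  assumes "Ck_on (Suc k) f S"
  shows "x \<in> S \<Longrightarrow> (f has_real_derivative deriv f x) (at x)" "Ck_on k (deriv f) S"
  using assms by (auto simp: Ck_on_Suc DERIV_deriv_iff_real_differentiable)

lemma Ck_on_cong:
  assumes "open S" "\<And>x. x \<in> S \<Longrightarrow> f x = g x" "Ck_on k g S"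
  shows "Ck_on k f S"
proof (cases k)
  case 0
  then show ?thesis using assms by (simp add: Ck_on_0 cong: continuous_on_cong)
next
  case (Suc j)
  have "(f has_real_derivative deriv g x) (at x)" if "x \<in> S" for x
    by (rule has_field_derivative_transform_within_open[OF Ck_on_SucE(1)[OF assms(3)[unfolded Suc] that] assms(1) that])
      (simp add: assms(2))
  then show ?thesis unfolding Suc
    by (rule Ck_on_SucI[OF assms(1) _ Ck_on_SucE(2)[OF assms(3)[unfolded Suc]]])
qed

lemma Ck_on_subset: "Ck_on k f S \<Longrightarrow> T \<subseteq> S \<Longrightarrow> Ck_on k f T"
  unfolding Ck_on_def by (meson continuous_on_subset subsetD)

lemma Ck_on_le: "Ck_on k f S \<Longrightarrow> j \<le> k \<Longrightarrow> Ck_on j f S"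
  unfolding Ck_on_def by (meson le_trans less_le_trans)

lemma Ck_on_imp_continuous_on: "Ck_on k f S \<Longrightarrow> continuous_on S f"
  using Ck_on_le[of k f S 0] by (simp add: Ck_on_0)

lemma Ck_on_Suc_imp: "Ck_on (Suc k) f S \<Longrightarrow> Ck_on k f S"
  by (erule Ck_on_le) simp

lemma Ck_on_local:
  assumes "\<And>x. x \<in> S \<Longrightarrow> \<exists>T. open T \<and> x \<in> T \<and> Ck_on k f T"
  shows "Ck_on k f S"
  unfolding Ck_on_def
proof (intro conjI allI impI ballI)
  fix i x assume "i < k" "x \<in> S"
  then show "(deriv ^^ i) f differentiable at x" using assms[of x] unfolding Ck_on_def by blast
next
  fix i assume i: "i \<le> k"
  show "continuous_on S ((deriv ^^ i) f)"
  proof (rule continuous_at_imp_continuous_on, rule ballI)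
    fix x assume "x \<in> S"
    then obtain T where T: "open T" "x \<in> T" "Ck_on k f T" using assms by blast
    then have "continuous_on T ((deriv ^^ i) f)" using i unfolding Ck_on_def by blast
    then show "isCont ((deriv ^^ i) f) x" using T continuous_on_eq_continuous_at by blast
  qed
qed

lemma Ck_on_const: "open S \<Longrightarrow> Ck_on k (\<lambda>x. c) S"
proof (induction k arbitrary: c)
  case (Suc k)
  show ?case by (rule Ck_on_SucI[OF Suc(2) _ Suc(1)[OF Suc(2), of 0]]) (auto intro!: derivative_eq_intros)
qed (simp add: Ck_on_0)

lemma Ck_on_ident: "open S \<Longrightarrow> Ck_on k (\<lambda>x. x) S"
proof (cases k)
  case (Suc j)
  assume "open S"
  then show ?thesis unfolding Suc by (intro Ck_on_SucI[where f' = "\<lambda>_. 1"] Ck_on_const) (auto intro!: derivative_eq_intros)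
qed (simp add: Ck_on_0)

lemma Ck_on_add:
  assumes "open S" shows "Ck_on k f S \<Longrightarrow> Ck_on k g S \<Longrightarrow> Ck_on k (\<lambda>x. f x + g x) S"
proof (induction k arbitrary: f g)
  case (Suc k)
  show ?case
    by (rule Ck_on_SucI[OF assms _ Suc.IH[OF Ck_on_SucE(2)[OF Suc.prems(1)] Ck_on_SucE(2)[OF Suc.prems(2)]]])
      (intro DERIV_add Ck_on_SucE(1)[OF Suc.prems(1)] Ck_on_SucE(1)[OF Suc.prems(2)])
qed (auto simp: Ck_on_0 intro: continuous_intros)

lemma Ck_on_mult:
  assumes "open S" shows "Ck_on k f S \<Longrightarrow> Ck_on k g S \<Longrightarrow> Ck_on k (\<lambda>x. f x * g x) S"
proof (induction k arbitrary: f g)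
  case (Suc k)
  have "Ck_on k (\<lambda>x. f x * deriv g x + deriv f x * g x) S"
    by (intro Ck_on_add assms Suc.IH Ck_on_SucE(2) Suc.prems Ck_on_Suc_imp[OF Suc.prems(1)] Ck_on_Suc_imp[OF Suc.prems(2)])
  then show ?case
    by (rule Ck_on_SucI[OF assms, rotated])
      (auto intro!: derivative_eq_intros Ck_on_SucE(1)[OF Suc.prems(1)] Ck_on_SucE(1)[OF Suc.prems(2)])
qed (auto simp: Ck_on_0 intro: continuous_intros)

lemma Ck_on_cmult: "open S \<Longrightarrow> Ck_on k f S \<Longrightarrow> Ck_on k (\<lambda>x. c * f x) S"
  by (intro Ck_on_mult Ck_on_const)

lemma Ck_on_diff:
  assumes "open S" "Ck_on k f S" "Ck_on k g S" shows "Ck_on k (\<lambda>x. f x - g x) S"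
  using Ck_on_add[OF assms(1,2) Ck_on_cmult[OF assms(1,3), of "-1"]] by simp

lemma Ck_on_power: "open S \<Longrightarrow> Ck_on k f S \<Longrightarrow> Ck_on k (\<lambda>x. f x ^ n) S"
  by (induction n) (auto intro: Ck_on_mult Ck_on_const)

lemma Ck_on_inverse:
  assumes "open S" "\<And>x. x \<in> S \<Longrightarrow> f x \<noteq> 0"
  shows "Ck_on k f S \<Longrightarrow> Ck_on k (\<lambda>x. inverse (f x)) S"
proof (induction k)
  case (Suc k)
  have "Ck_on k (\<lambda>x. - 1 * (inverse (f x) * deriv f x * inverse (f x))) S"
    using Suc.IH[OF Ck_on_Suc_imp[OF Suc.prems]] Ck_on_SucE(2)[OF Suc.prems] assms(1)
    by (intro Ck_on_cmult Ck_on_mult)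
  then show ?case
    by (rule Ck_on_SucI[OF assms(1), rotated])
      (auto intro!: derivative_eq_intros Ck_on_SucE(1)[OF Suc.prems] simp: assms(2))
qed (use assms in \<open>auto simp: Ck_on_0 intro!: continuous_intros\<close>)

lemma Ck_on_divide:
  assumes "open S" "\<And>x. x \<in> S \<Longrightarrow> g x \<noteq> 0" "Ck_on k f S" "Ck_on k g S"
  shows "Ck_on k (\<lambda>x. f x / g x) S"
  unfolding divide_inverse by (intro Ck_on_mult Ck_on_inverse assms)

lemma Ck_on_compose:
  assumes "open S" "open T" "\<And>x. x \<in> S \<Longrightarrow> f x \<in> T"
  shows "Ck_on k f S \<Longrightarrow> Ck_on k g T \<Longrightarrow> Ck_on k (\<lambda>x. g (f x)) S"
proof (induction k arbitrary: g)
  case 0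
  have "f ` S \<subseteq> T" using assms(3) by (rule image_subsetI)
  then show ?case using continuous_on_compose2[OF 0(2)[unfolded Ck_on_0] 0(1)[unfolded Ck_on_0]] by (simp add: Ck_on_0)
next
  case (Suc k)
  have "Ck_on k (\<lambda>x. deriv g (f x) * deriv f x) S"
    by (rule Ck_on_mult[OF assms(1) Suc.IH[OF Ck_on_Suc_imp[OF Suc.prems(1)] Ck_on_SucE(2)[OF Suc.prems(2)]]
          Ck_on_SucE(2)[OF Suc.prems(1)]])
  then show ?case
    by (rule Ck_on_SucI[OF assms(1), rotated])
      (rule DERIV_chain2[OF Ck_on_SucE(1)[OF Suc.prems(2) assms(3)] Ck_on_SucE(1)[OF Suc.prems(1)]])
qed

text \<open>
  Bootstrapping: the derivative \<open>1 / f' (h y)\<close> of the inverse is as smooth as \<open>h\<close> itself, one order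
  below \<open>f\<close>.
\<close>

lemma Ck_on_right_inverse:
  assumes "open S" "open T" and h: "continuous_on T h" "\<And>y. y \<in> T \<Longrightarrow> h y \<in> S" "\<And>y. y \<in> T \<Longrightarrow> f (h y) = y"
    and f: "\<And>x. x \<in> S \<Longrightarrow> (f has_real_derivative f' x) (at x)" "\<And>x. x \<in> S \<Longrightarrow> f' x \<noteq> 0"
  shows "y \<in> T \<Longrightarrow> (h has_real_derivative inverse (f' (h y))) (at y)"
    and "Ck_on k f S \<Longrightarrow> Ck_on k h T"
proof -
  show d: "(h has_real_derivative inverse (f' (h y))) (at y)" if y: "y \<in> T" for y
  proof -
    obtain e where e: "e > 0" "ball y e \<subseteq> T" using assms(2) y open_contains_ball by blast
    show ?thesis
    proof (rule DERIV_inverse_function[where f = f and a = "y - e" and b = "y + e"])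
      show "f (h z) = z" if "y - e < z" "z < y + e" for z
        using h(3) e that by (auto simp: subset_iff dist_real_def)
      show "isCont h y" using h(1) assms(2) y continuous_on_eq_continuous_at by blast
    qed (use f h e y in auto)
  qed
  show "Ck_on k f S \<Longrightarrow> Ck_on k h T"
  proof (induction k)
    case 0
    then show ?case using h by (simp add: Ck_on_0)
  next
    case (Suc k)
    have df: "deriv f x = f' x" if "x \<in> S" for x using f(1)[OF that] by (rule DERIV_imp_deriv)
    have "Ck_on k (\<lambda>y. inverse (deriv f (h y))) T"
      by (rule Ck_on_inverse[OF assms(2) _ Ck_on_compose[OF assms(2,1) h(2) Suc.IH[OF Ck_on_Suc_imp[OF Suc.prems]] Ck_on_SucE(2)[OF Suc.prems]]])
       (simp_all add: df f h)
    then show ?case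
      by (rule Ck_on_SucI[OF assms(2), rotated]) (use d df h in force)
  qed
qed

lemma deriv_pos_imp_less:
  fixes g :: "real \<Rightarrow> real"
  assumes "\<And>x. x \<in> {a..b} \<Longrightarrow> (g has_real_derivative g' x) (at x)" "\<And>x. x \<in> {a..b} \<Longrightarrow> g' x > 0" "a < b"
  shows "g a < g b"
  using assms by (intro DERIV_pos_imp_increasing[of a b g]) auto

lemma local_inverse:
  assumes S: "open S" "x \<in> S" and g: "Ck_on (Suc k) g S" "\<And>s. s \<in> S \<Longrightarrow> deriv g s > 0"
  obtains S' T h where "open S'" "x \<in> S'" "S' \<subseteq> S" "open T" "T = g ` S'" "Ck_on (Suc k) h T"
    "\<And>s. s \<in> S' \<Longrightarrow> h (g s) = s" "\<And>t. t \<in> T \<Longrightarrow> h t \<in> S'" "\<And>t. t \<in> T \<Longrightarrow> g (h t) = t"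
    "\<And>t. t \<in> T \<Longrightarrow> deriv h t > 0"
proof -
  obtain e where e: "e > 0" "ball x e \<subseteq> S" using S open_contains_ball by blast
  define S' where "S' = ball x e"
  have S': "open S'" "x \<in> S'" "S' \<subseteq> S" using e by (auto simp: S'_def)
  have g': "(g has_real_derivative deriv g s) (at s)" "deriv g s > 0" if "s \<in> S'" for s
    using that S'(3) g(2) Ck_on_SucE(1)[OF g(1)] by blast+
  have lt: "g a < g b" if "a \<in> S'" "b \<in> S'" "a < b" for a b
  proof -
    have "{a..b} \<subseteq> S'" using that(1,2) unfolding S'_def ball_eq_greaterThanLessThan by auto
    then show ?thesis
      by (intro deriv_pos_imp_less[where g' = "deriv g", OF g'(1) g'(2) that(3)]) (erule (1) subsetD)+
  qed
  have inj: "inj_on g S'"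
    by (rule inj_onI) (metis lt linorder_neq_iff order_less_irrefl)
  have cont: "continuous_on S' g" using Ck_on_imp_continuous_on[OF g(1)] S'(3) continuous_on_subset by blast
  define T where "T = g ` S'"
  define h where "h = inv_into S' g"
  have T: "open T" unfolding T_def by (rule invariance_of_domain[OF cont S'(1) inj])
  have hg: "h (g s) = s" if "s \<in> S'" for s unfolding h_def using inj that by simp
  have hT: "h t \<in> S'" "g (h t) = t" if "t \<in> T" for t using that hg by (auto simp: T_def)
  have ch: "continuous_on T h" unfolding T_def
    by (rule continuous_on_inverse_open[OF S'(1) cont]) (auto simp: hg)
  have ne: "deriv g s \<noteq> 0" if "s \<in> S'" for s using g'(2)[OF that] by simp
  have "Ck_on (Suc k) h T"
    by (rule Ck_on_right_inverse(2)[OF S'(1) T ch _ _ _ _ Ck_on_subset[OF g(1) S'(3)]])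
      (fact hT g'(1) ne)+
  moreover have "deriv h t > 0" if t: "t \<in> T" for t
  proof -
    have "(h has_real_derivative inverse (deriv g (h t))) (at t)"
      by (rule Ck_on_right_inverse(1)[OF S'(1) T ch]) (fact hT g'(1) ne t)+
    then show ?thesis using g'(2)[OF hT(1)[OF t]] by (simp add: DERIV_imp_deriv)
  qed
  ultimately show thesis using that[OF S' T T_def _ hg hT] by blast
qed

lemma has_derivative_max_power:
  "((\<lambda>x::real. max 0 x ^ Suc (Suc n)) has_real_derivative real (Suc (Suc n)) * max 0 x ^ Suc n) (at x)"
proof -
  consider "x > 0" | "x < 0" | "x = 0" by linarith
  then show ?thesis
  proof cases
    case 1
    have "((\<lambda>x::real. x ^ Suc (Suc n)) has_real_derivative real (Suc (Suc n)) * max 0 x ^ Suc n) (at x)"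
      using 1 DERIV_pow[of "Suc (Suc n)" x] by (simp add: max_def)
    then show ?thesis
      by (rule has_field_derivative_transform_within_open[where S = "{0<..}"]) (use 1 in auto)
  next
    case 2
    have "((\<lambda>x::real. 0) has_real_derivative real (Suc (Suc n)) * max 0 x ^ Suc n) (at x)"
      using 2 by (auto intro!: derivative_eq_intros simp: max_def)
    then show ?thesis
      by (rule has_field_derivative_transform_within_open[where S = "{..<0}"]) (use 2 in auto)
  next
    case 3
    show ?thesis unfolding 3
    proof (subst CARAT_DERIV, intro exI conjI allI)
      show "max 0 z ^ Suc (Suc n) - max 0 0 ^ Suc (Suc n) = max 0 z ^ Suc n * (z - 0)" for z :: real
        by (simp add: max_def)
      show "isCont (\<lambda>z::real. max 0 z ^ Suc n) 0" by (intro continuous_intros)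
    qed simp
  qed
qed

text \<open>
  The function vanishes on a half-line and is positive on the other one, with \<open>k\<close> continuous
  derivatives; cutoff functions are built from it.
\<close>

lemma Ck_on_max_power: "Ck_on k (\<lambda>x. max 0 x ^ Suc k) UNIV"
proof (induction k)
  case 0 show ?case unfolding Ck_on_0 by (intro continuous_intros)
next
  case (Suc k)
  show ?case
    by (rule Ck_on_SucI[OF open_UNIV has_derivative_max_power Ck_on_cmult[OF open_UNIV Suc]])
qed

section \<open>Diffeomorphisms of the circle in local coordinates\<close>

lemma atlas_cases: "p \<in> atlas \<longleftrightarrow> p = Fin \<or> p = param_infty"
  by (auto simp: atlas_def)

lemma inj_chart: "p \<in> atlas \<Longrightarrow> inj p"
  by (auto simp: atlas_cases inj_def param_infty_def split: if_splits)

lemma inv_chart [simp]: "p \<in> atlas \<Longrightarrow> inv_into UNIV p (p x) = x"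
  by (simp add: inj_chart)

text \<open>
  The sign in \<open>param_infty\<close> makes the change of coordinates the same map in both directions.
\<close>

lemma chart_transition: "p \<in> atlas \<Longrightarrow> q \<in> atlas \<Longrightarrow> p \<noteq> q \<Longrightarrow> x \<noteq> 0 \<Longrightarrow> p x = q (- 1 / x)"
  by (auto simp: atlas_cases param_infty_def)

lemma chart_transition_nonzero: "p \<in> atlas \<Longrightarrow> q \<in> atlas \<Longrightarrow> p \<noteq> q \<Longrightarrow> p x = q y \<Longrightarrow> x \<noteq> 0"
  by (auto simp: atlas_cases param_infty_def split: if_splits)

lemma charts_cover: obtains p x where "p \<in> atlas" "p x = P"
proof (cases P)
  case (Fin x)
  then show ?thesis using that[of Fin x] by (simp add: atlas_cases)
next
  case Infty
  then show ?thesis using that[of param_infty 0] by (simp add: atlas_cases param_infty_def)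
qed

lemma open_transition_domain:
  assumes "open S" shows "open {x::real. x \<noteq> 0 \<and> - 1 / x \<in> S}"
proof -
  have "open (- {0} \<inter> (\<lambda>x::real. - 1 / x) -` S)"
    by (rule continuous_open_preimage[OF _ _ assms]) (auto intro!: continuous_intros)
  moreover have "{x::real. x \<noteq> 0 \<and> - 1 / x \<in> S} = - {0} \<inter> (\<lambda>x::real. - 1 / x) -` S" by auto
  ultimately show ?thesis by simp
qed

lemma open_chart_image:
  assumes "p \<in> atlas" "open S" shows "open (p ` S)"
  unfolding open_rp1_def
proof
  fix q assume q: "q \<in> atlas"
  show "open (q -` p ` S)"
  proof (cases "q = p")
    case True
    then show ?thesis using assms by (simp add: inj_vimage_image_eq inj_chart)
  next
    case False
    have "q -` p ` S = {x. x \<noteq> 0 \<and> - 1 / x \<in> S}"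
    proof (intro equalityI subsetI)
      fix x assume "x \<in> q -` p ` S"
      then obtain s where s: "s \<in> S" "q x = p s" by auto
      then have "x \<noteq> 0" using chart_transition_nonzero[OF q assms(1) False] by blast
      then have "p s = p (- 1 / x)" using s(2) chart_transition[OF q assms(1) False] by simp
      then have "- 1 / x = s" using inj_chart[OF assms(1)] by (simp add: inj_def)
      then show "x \<in> {x. x \<noteq> 0 \<and> - 1 / x \<in> S}" using s(1) \<open>x \<noteq> 0\<close> by simp
    next
      fix x assume "x \<in> {x. x \<noteq> 0 \<and> - 1 / x \<in> S}"
      then show "x \<in> q -` p ` S" using chart_transition[OF q assms(1) False, of x] by auto
    qed
    then show ?thesis using open_transition_domain[OF assms(2)] by simp
  qed
qed

lemma open_chart_vimage: "p \<in> atlas \<Longrightarrow> open U \<Longrightarrow> open (p -` U)"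
  by (simp add: open_rp1_def)

text \<open>
  The function \<open>g\<close> on \<open>S\<close> is the expression of \<open>f\<close> in the given charts. In contrast to
  \<open>local_rep\<close> the function and its domain can be chosen freely, and the domain can be shrunk.
\<close>

definition C3_rep :: "(rp1 \<Rightarrow> rp1) \<Rightarrow> (real \<Rightarrow> rp1) \<Rightarrow> (real \<Rightarrow> rp1) \<Rightarrow> real set \<Rightarrow> (real \<Rightarrow> real) \<Rightarrow> bool" where
  "C3_rep f p q S g \<longleftrightarrow> open S \<and> Ck_on 3 g S \<and> (\<forall>s\<in>S. deriv g s > 0 \<and> f (p s) = q (g s))"

text \<open>
  Some pair of charts suffices at each point; \<open>C3_germ_charts\<close> shows that any admissible pair can be
  used instead. Being local, this description of orientation preserving \<open>C\<^sup>3\<close>-maps is convenient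
  for maps that are glued from pieces.
\<close>

definition C3_germ :: "(rp1 \<Rightarrow> rp1) \<Rightarrow> rp1 \<Rightarrow> bool" where
  "C3_germ f P \<longleftrightarrow> (\<exists>p\<in>atlas. \<exists>q\<in>atlas. \<exists>S g. P \<in> p ` S \<and> C3_rep f p q S g)"

lemma Ck_on_3_has_deriv: "Ck_on 3 g S \<Longrightarrow> x \<in> S \<Longrightarrow> (g has_real_derivative deriv g x) (at x)"
  by (rule Ck_on_SucE(1)[of 2]) (simp_all add: eval_nat_numeral)

lemma open_vimage_Ck_on: "open S \<Longrightarrow> Ck_on k g S \<Longrightarrow> open T \<Longrightarrow> open {s \<in> S. g s \<in> T}"
  by (drule continuous_open_preimage[OF Ck_on_imp_continuous_on]) (simp_all add: vimage_def Int_def)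

lemma Ck_on_transition: "Ck_on k (\<lambda>x. - 1 / x) (- {0})"
  by (intro Ck_on_divide Ck_on_const Ck_on_ident) auto

lemma deriv_transition: "x \<noteq> 0 \<Longrightarrow> ((\<lambda>x. - 1 / x) has_real_derivative 1 / x\<^sup>2) (at x)"
  by (auto intro!: derivative_eq_intros simp: power2_eq_square)

lemma C3_rep_compose:
  assumes "C3_rep f p q S a" "C3_rep g q r T b"
  shows "C3_rep (g \<circ> f) p r {s \<in> S. a s \<in> T} (\<lambda>s. b (a s))"
proof -
  let ?S = "{s \<in> S. a s \<in> T}"
  have a: "open S" "Ck_on 3 a S" "\<And>s. s \<in> S \<Longrightarrow> deriv a s > 0" "\<And>s. s \<in> S \<Longrightarrow> f (p s) = q (a s)"
    and b: "open T" "Ck_on 3 b T" "\<And>s. s \<in> T \<Longrightarrow> deriv b s > 0" "\<And>s. s \<in> T \<Longrightarrow> g (q s) = r (b s)"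
    using assms by (auto simp: C3_rep_def)
  have o: "open ?S" by (rule open_vimage_Ck_on[OF a(1,2) b(1)])
  have "deriv (\<lambda>s. b (a s)) s = deriv b (a s) * deriv a s" if "s \<in> ?S" for s
    using that by (intro DERIV_imp_deriv DERIV_chain2 Ck_on_3_has_deriv[OF a(2)] Ck_on_3_has_deriv[OF b(2)]) auto
  moreover have "Ck_on 3 (\<lambda>s. b (a s)) ?S"
    by (rule Ck_on_compose[OF o b(1) _ Ck_on_subset[OF a(2)] b(2)]) auto
  ultimately show ?thesis using o a b by (simp add: C3_rep_def)
qed

lemma C3_rep_identity_transition:
  assumes "p \<in> atlas" "q \<in> atlas" "p \<noteq> q" shows "C3_rep id p q (- {0}) (\<lambda>x. - 1 / x)"
  unfolding C3_rep_def
proof (intro conjI ballI)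
  fix s :: real assume s: "s \<in> - {0}"
  then have "deriv (\<lambda>x. - 1 / x) s = 1 / s\<^sup>2" by (intro DERIV_imp_deriv deriv_transition) simp
  then show "deriv (\<lambda>x. - 1 / x) s > 0" using s by simp
  show "id (p s) = q (- 1 / s)" using chart_transition[OF assms] s by simp
next
  show "open (- {0::real})" by (simp add: open_Compl)
  show "Ck_on 3 (\<lambda>x. - 1 / x) (- {0})" by (rule Ck_on_transition)
qed

text \<open>
  The coordinate transition is a local expression of the identity, so a change of charts is a special
  case of composition.
\<close>

lemma C3_germ_charts:
  assumes "C3_germ f P" "p \<in> atlas" "q \<in> atlas" "p x = P" "q y = f P"
  obtains S g where "x \<in> S" "C3_rep f p q S g"
proof -
  obtain p0 q0 S g x0 where 0: "p0 \<in> atlas" "q0 \<in> atlas" "x0 \<in> S" "p0 x0 = P" "C3_rep f p0 q0 S g"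
    using assms(1) unfolding C3_germ_def by (metis imageE)
  have "\<exists>S g. x \<in> S \<and> C3_rep f p q0 S g"
  proof (cases "p = p0")
    case True
    then have "x = x0" using 0 assms(2,4) inj_chart by (metis injD)
    then show ?thesis using 0 True by blast
  next
    case False
    have nz: "x \<noteq> 0" using chart_transition_nonzero[OF assms(2) 0(1) False] assms(4) 0(4) by metis
    then have "p0 (- 1 / x) = p0 x0" using chart_transition[OF assms(2) 0(1) False] assms(4) 0(4) by metis
    then have "- 1 / x = x0" using inj_chart[OF 0(1)] by (meson injD)
    then show ?thesis using C3_rep_compose[OF C3_rep_identity_transition[OF assms(2) 0(1) False] 0(5)] 0(3) nz
      by (intro exI[of _ "{s \<in> - {0}. - 1 / s \<in> S}"] exI) auto
  qed
  then obtain S1 g1 where 1: "x \<in> S1" "C3_rep f p q0 S1 g1" by blast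
  show thesis
  proof (cases "q = q0")
    case True
    then show ?thesis using that 1 by blast
  next
    case False
    have "q0 (g1 x) = q y" using 1 assms(4,5) by (metis C3_rep_def)
    then have "g1 x \<noteq> 0" using chart_transition_nonzero[OF 0(2) assms(3)] False by metis
    then show ?thesis
      using that[OF _ C3_rep_compose[OF 1(2) C3_rep_identity_transition[OF 0(2) assms(3)], simplified]] 1(1) False by simp
  qed
qed

lemma C3_germ_compose:
  assumes "C3_germ f P" "C3_germ g (f P)" shows "C3_germ (g \<circ> f) P"
proof -
  obtain p q S a x where 0: "p \<in> atlas" "q \<in> atlas" "x \<in> S" "p x = P" "C3_rep f p q S a"
    using assms(1) unfolding C3_germ_def by (metis imageE)
  have fP: "q (a x) = f P" using 0 by (auto simp: C3_rep_def)
  obtain r z where r: "r \<in> atlas" "r z = g (f P)" using charts_cover by blast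
  obtain T b where T: "a x \<in> T" "C3_rep g q r T b" using C3_germ_charts[OF assms(2) 0(2) r(1) fP r(2)] by blast
  from C3_rep_compose[OF 0(5) T(2)] show ?thesis unfolding C3_germ_def
    using 0 r T by (intro bexI[of _ p] bexI[of _ r] exI conjI) auto
qed

lemma C3_germ_inverse:
  assumes "inj f" "C3_germ f P" shows "C3_germ (inv_into UNIV f) (f P)"
proof -
  obtain p q S a x where 0: "p \<in> atlas" "q \<in> atlas" "x \<in> S" "p x = P" "C3_rep f p q S a"
    using assms(2) unfolding C3_germ_def by (metis imageE)
  then have a: "open S" "Ck_on 3 a S" "\<And>s. s \<in> S \<Longrightarrow> deriv a s > 0" "\<And>s. s \<in> S \<Longrightarrow> f (p s) = q (a s)"
    by (auto simp: C3_rep_def)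
  obtain S' T h where h: "open S'" "x \<in> S'" "S' \<subseteq> S" "open T" "T = a ` S'" "Ck_on 3 h T"
    "\<And>s. s \<in> S' \<Longrightarrow> h (a s) = s" "\<And>t. t \<in> T \<Longrightarrow> h t \<in> S'" "\<And>t. t \<in> T \<Longrightarrow> a (h t) = t"
    "\<And>t. t \<in> T \<Longrightarrow> deriv h t > 0"
    using local_inverse[OF a(1) 0(3) _ a(3), of 2] a(2) by (auto simp: eval_nat_numeral)
  have "inv_into UNIV f (q t) = p (h t)" if t: "t \<in> T" for t
  proof -
    have "f (p (h t)) = q t" using a(4)[of "h t"] h(3,8,9) t by auto
    then show ?thesis using assms(1) by (metis inv_f_f)
  qed
  then have "C3_rep (inv_into UNIV f) q p T h" using h by (simp add: C3_rep_def)
  moreover have "f P \<in> q ` T" using 0(3,4) a(4) h(2,5) by blast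
  ultimately show ?thesis unfolding C3_germ_def using 0 by blast
qed

lemma C3_rep_local_rep:
  assumes "C3_rep f p q S g" "q \<in> atlas" "s \<in> S"
  shows "local_rep p q f s = g s" "s \<in> local_dom p q f"
  using assms by (auto simp: C3_rep_def local_rep_def local_dom_def)

lemma C3_map_iff_germs:
  "C3_map f \<and> orientation_preserving f \<longleftrightarrow> (\<forall>P. C3_germ f P)"
proof safe
  fix P assume f: "C3_map f" "orientation_preserving f"
  obtain p x where p: "p \<in> atlas" "p x = P" using charts_cover by blast
  obtain q y where q: "q \<in> atlas" "q y = f P" using charts_cover by blast
  have "open (range q)" using open_chart_image[OF q(1)] by simp
  then have "open (f -` range q)"
    using f(1) unfolding C3_map_def by (metis continuous_on_open_vimage open_UNIV Int_UNIV_right)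
  then have "open (p -` (f -` range q))" by (rule open_chart_vimage[OF p(1)])
  then have "open (local_dom p q f)" by (simp add: local_dom_def vimage_def)
  moreover have "q (local_rep p q f s) = f (p s)" if "s \<in> local_dom p q f" for s
    using that by (simp add: local_dom_def local_rep_def f_inv_into_f)
  ultimately have "C3_rep f p q (local_dom p q f) (local_rep p q f)"
    using f p q unfolding C3_rep_def C3_map_def orientation_preserving_def by auto
  moreover have "x \<in> local_dom p q f" using p q by (metis (mono_tags) local_dom_def mem_Collect_eq rangeI)
  ultimately show "C3_germ f P" unfolding C3_germ_def using p q by blast
next
  assume G: "\<forall>P. C3_germ f P"
  have rep: "\<exists>S g. x \<in> S \<and> C3_rep f p q S g" if pq: "p \<in> atlas" "q \<in> atlas" and x: "x \<in> local_dom p q f" for p q x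
  proof -
    obtain y where "q y = f (p x)" using x by (auto simp: local_dom_def)
    then show ?thesis using C3_germ_charts[OF G[rule_format] pq refl] by metis
  qed
  have "open (p -` f -` B)" if B: "open B" and p: "p \<in> atlas" for B p
  proof (rule openI)
    fix x assume x: "x \<in> p -` f -` B"
    obtain q y where q: "q \<in> atlas" "q y = f (p x)" using charts_cover by blast
    then have "x \<in> local_dom p q f" by (metis (mono_tags) local_dom_def mem_Collect_eq rangeI)
    then obtain S g where S: "x \<in> S" "C3_rep f p q S g" using rep p q by blast
    have "open {s \<in> S. g s \<in> q -` B}"
      using S(2) open_chart_vimage[OF q(1) B] by (intro open_vimage_Ck_on[of _ 3]) (auto simp: C3_rep_def)
    moreover have "x \<in> {s \<in> S. g s \<in> q -` B}" "{s \<in> S. g s \<in> q -` B} \<subseteq> p -` f -` B"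
      using S x by (auto simp: C3_rep_def)
    ultimately show "\<exists>e>0. ball x e \<subseteq> p -` f -` B"
      by (meson open_contains_ball order_trans)
  qed
  then have "open (f -` B)" if "open B" for B using that by (simp add: open_rp1_def)
  then have cont: "continuous_on UNIV f" by (simp add: continuous_on_open_vimage)
  have eq: "\<exists>S g. x \<in> S \<and> open S \<and> (\<forall>s\<in>S. local_rep p q f s = g s) \<and> Ck_on 3 g S \<and> deriv g x > 0"
    if pq: "p \<in> atlas" "q \<in> atlas" and x: "x \<in> local_dom p q f" for p q x
  proof -
    obtain S g where S: "x \<in> S" "C3_rep f p q S g" using rep[OF pq x] by blast
    then show ?thesis using C3_rep_local_rep(1)[OF S(2) pq(2)] unfolding C3_rep_def by blast
  qed
  have "Ck_on 3 (local_rep p q f) (local_dom p q f)" if pq: "p \<in> atlas" "q \<in> atlas" for p q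
  proof (rule Ck_on_local)
    fix x assume "x \<in> local_dom p q f"
    then obtain S g where "x \<in> S" "open S" "\<forall>s\<in>S. local_rep p q f s = g s" "Ck_on 3 g S" using eq[OF pq] by blast
    then show "\<exists>T. open T \<and> x \<in> T \<and> Ck_on 3 (local_rep p q f) T"
      using Ck_on_cong[of S "local_rep p q f" g 3] by blast
  qed
  with cont show "C3_map f" by (simp add: C3_map_def)
  have "deriv (local_rep p q f) x > 0" if pq: "p \<in> atlas" "q \<in> atlas" and x: "x \<in> local_dom p q f" for p q x
  proof -
    obtain S g where "x \<in> S" "open S" "\<forall>s\<in>S. local_rep p q f s = g s" "deriv g x > 0" using eq[OF pq x] by blast
    then show ?thesis using deriv_funpow_cong[of S "local_rep p q f" g x 1] by auto
  qed
  then show "orientation_preserving f" by (simp add: orientation_preserving_def)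
qed

text \<open>
  Smoothness of the inverse follows from the inverse function theorem, because the derivative
  is positive everywhere.
\<close>

lemma carrier_Diff3_iff: "f \<in> carrier Diff3 \<longleftrightarrow> bij f \<and> (\<forall>P. C3_germ f P)"
proof
  assume "f \<in> carrier Diff3"
  then show "bij f \<and> (\<forall>P. C3_germ f P)" using C3_map_iff_germs by (auto simp: Diff3_def)
next
  assume f: "bij f \<and> (\<forall>P. C3_germ f P)"
  have "C3_germ (inv_into UNIV f) P" for P
    using C3_germ_inverse[of f "inv_into UNIV f P"] f by (simp add: bij_is_inj bij_is_surj surj_f_inv_f)
  then have "C3_map (inv_into UNIV f)" using C3_map_iff_germs by blast
  then show "f \<in> carrier Diff3" using f C3_map_iff_germs by (auto simp: Diff3_def)
qed

lemma C3_germ_id: "C3_germ id P"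
proof -
  obtain p x where p: "p \<in> atlas" "p x = P" using charts_cover by blast
  have "C3_rep id p p UNIV (\<lambda>x. x)" by (simp add: C3_rep_def Ck_on_ident)
  then show ?thesis unfolding C3_germ_def using p by blast
qed

lemma mult_Diff3 [simp]: "f \<otimes>\<^bsub>Diff3\<^esub> g = f \<circ> g" and one_Diff3 [simp]: "\<one>\<^bsub>Diff3\<^esub> = id"
  by (simp_all add: Diff3_def)

lemma Diff3_inverse_closed: "f \<in> carrier Diff3 \<Longrightarrow> inv_into UNIV f \<in> carrier Diff3"
  unfolding carrier_Diff3_iff using C3_germ_inverse[of f]
  by (metis bij_imp_bij_inv bij_is_inj bij_is_surj surj_f_inv_f)

lemma Diff3_compose_closed: "f \<in> carrier Diff3 \<Longrightarrow> g \<in> carrier Diff3 \<Longrightarrow> f \<circ> g \<in> carrier Diff3"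
  unfolding carrier_Diff3_iff using C3_germ_compose bij_comp by blast

lemma group_Diff3: "group Diff3"
proof (rule groupI)
  fix f assume f: "f \<in> carrier Diff3"
  then show "\<exists>g\<in>carrier Diff3. g \<otimes>\<^bsub>Diff3\<^esub> f = \<one>\<^bsub>Diff3\<^esub>"
    using Diff3_inverse_closed[OF f] by (auto simp: carrier_Diff3_iff bij_is_inj intro!: bexI[of _ "inv_into UNIV f"])
qed (auto simp: Diff3_compose_closed o_assoc carrier_Diff3_iff C3_germ_id C3_germ_compose bij_comp)

lemma inv_Diff3: "f \<in> carrier Diff3 \<Longrightarrow> inv\<^bsub>Diff3\<^esub> f = inv_into UNIV f"
  by (rule group.inv_equality[OF group_Diff3])
    (auto simp: Diff3_inverse_closed, auto simp: carrier_Diff3_iff bij_is_inj)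

lemma Diff3_Ck_on: "f \<in> carrier Diff3 \<Longrightarrow> p \<in> atlas \<Longrightarrow> q \<in> atlas \<Longrightarrow> Ck_on 3 (local_rep p q f) (local_dom p q f)"
  by (auto simp: Diff3_def C3_map_def)

lemma Diff3_orientation: "f \<in> carrier Diff3 \<Longrightarrow> p \<in> atlas \<Longrightarrow> q \<in> atlas \<Longrightarrow> x \<in> local_dom p q f \<Longrightarrow>
    deriv (local_rep p q f) x > 0"
  by (auto simp: Diff3_def orientation_preserving_def)

lemma open_local_dom:
  assumes f: "f \<in> carrier Diff3" and pq: "p \<in> atlas" "q \<in> atlas"
  shows "open (local_dom p q f)"
proof (subst open_subopen, intro ballI)
  fix x assume x: "x \<in> local_dom p q f"
  obtain y where "q y = f (p x)" using x by (auto simp: local_dom_def)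
  then obtain S g where S: "x \<in> S" "C3_rep f p q S g"
    using C3_germ_charts[OF _ pq refl] f unfolding carrier_Diff3_iff by metis
  then show "\<exists>T. open T \<and> x \<in> T \<and> T \<subseteq> local_dom p q f"
    using C3_rep_local_rep(2)[OF S(2) pq(2)] unfolding C3_rep_def by blast
qed

lemma chart_local_rep: "x \<in> local_dom p q f \<Longrightarrow> q (local_rep p q f x) = f (p x)"
  by (simp add: local_dom_def local_rep_def f_inv_into_f)

text \<open>
  Convergence of all chart expressions and their derivatives, uniformly on compact sets. The basic
  neighbourhoods of the topology are not centred at the limit \<open>f\<close>; since all functions are
  continuous and \<open>L\<close> is compact, a neighbourhood of \<open>h\<close> that contains \<open>f\<close> leaves a positive margin
  around \<open>f\<close>.
\<close>

lemma limitin_C3_topology: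
  assumes f: "f \<in> carrier Diff3" and F: "\<And>n::nat. F n \<in> carrier Diff3"
    and dom: "\<And>p q L. p \<in> atlas \<Longrightarrow> q \<in> atlas \<Longrightarrow> compact L \<Longrightarrow> L \<subseteq> local_dom p q f \<Longrightarrow>
      \<forall>\<^sub>F n in sequentially. L \<subseteq> local_dom p q (F n)"
    and lim: "\<And>p q L i. p \<in> atlas \<Longrightarrow> q \<in> atlas \<Longrightarrow> compact L \<Longrightarrow> L \<subseteq> local_dom p q f \<Longrightarrow> i \<le> 3 \<Longrightarrow>
      uniform_limit L (\<lambda>n. (deriv ^^ i) (local_rep p q (F n))) ((deriv ^^ i) (local_rep p q f)) sequentially"
  shows "limitin C3_topology F f sequentially"
proof -
  define B where "B = {C3_nbhd p q L e f | p q L e f.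
        p \<in> atlas \<and> q \<in> atlas \<and> compact L \<and> e > 0 \<and> f \<in> carrier Diff3 \<and> L \<subseteq> local_dom p q f}"
  have T: "C3_topology = topology_generated_by B" by (simp add: C3_topology_def B_def)
  have "f \<in> C3_nbhd Fin Fin {} 1 f" using f by (simp add: C3_nbhd_def)
  moreover have "C3_nbhd Fin Fin {} 1 f \<in> B" unfolding B_def mem_Collect_eq
    by (rule exI[of _ Fin], rule exI[of _ Fin], rule exI[of _ "{}"], rule exI[of _ 1], rule exI[of _ f]) (simp add: atlas_cases f)
  ultimately have top: "f \<in> topspace C3_topology" unfolding T topology_generated_by_topspace by blast
  have "f \<in> U \<longrightarrow> (\<forall>\<^sub>F n in sequentially. F n \<in> U)" if "generate_topology_on B U" for U
    using that
  proof induction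
    case (Int a b)
    then show ?case by (auto intro: eventually_conj)
  next
    case (UN K)
    show ?case
    proof
      assume "f \<in> \<Union> K"
      then obtain k where k: "k \<in> K" "f \<in> k" by blast
      then have "\<forall>\<^sub>F n in sequentially. F n \<in> k" using UN by blast
      then show "\<forall>\<^sub>F n in sequentially. F n \<in> \<Union> K" by eventually_elim (use k in blast)
    qed
  next
    case (Basis s)
    then obtain p q L e h where s: "s = C3_nbhd p q L e h" and A: "p \<in> atlas" "q \<in> atlas" "compact L"
      "e > 0" "h \<in> carrier Diff3" "L \<subseteq> local_dom p q h" unfolding B_def by blast
    show ?case
    proof
      assume "f \<in> s"
      then have Lf: "L \<subseteq> local_dom p q f"
        and lt: "\<And>i x. i \<le> 3 \<Longrightarrow> x \<in> L \<Longrightarrow> \<bar>(deriv ^^ i) (local_rep p q f) x - (deriv ^^ i) (local_rep p q h) x\<bar> < e"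
        by (auto simp: s C3_nbhd_def)
      have "\<forall>\<^sub>F n in sequentially. \<forall>x\<in>L. \<bar>(deriv ^^ i) (local_rep p q (F n)) x - (deriv ^^ i) (local_rep p q h) x\<bar> < e"
        if i: "i \<in> {..3}" for i
      proof (cases "L = {}")
        case False
        let ?d = "\<lambda>x. \<bar>(deriv ^^ i) (local_rep p q f) x - (deriv ^^ i) (local_rep p q h) x\<bar>"
        have c: "continuous_on L ((deriv ^^ i) (local_rep p q g))" if "g \<in> carrier Diff3" "L \<subseteq> local_dom p q g" for g
          using Diff3_Ck_on[OF that(1) A(1,2)] that(2) i unfolding Ck_on_def by (metis atMost_iff continuous_on_subset)
        have "continuous_on L ?d" by (intro continuous_intros c f Lf A)
        then obtain x0 where x0: "x0 \<in> L" "\<And>x. x \<in> L \<Longrightarrow> ?d x \<le> ?d x0"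
          using continuous_attains_sup[OF A(3) False] by blast
        have "e - ?d x0 > 0" using lt[OF _ x0(1)] i by simp
        with lim[OF A(1-3) Lf, of i] i
        have "\<forall>\<^sub>F n in sequentially. \<forall>x\<in>L. dist ((deriv ^^ i) (local_rep p q (F n)) x) ((deriv ^^ i) (local_rep p q f) x) < e - ?d x0"
          unfolding uniform_limit_iff by simp
        then show ?thesis
        proof eventually_elim
          case (elim n)
          show ?case
          proof
            fix x assume x: "x \<in> L"
            have "dist ((deriv ^^ i) (local_rep p q (F n)) x) ((deriv ^^ i) (local_rep p q f) x) < e - ?d x0" using elim x by blast
            with x0(2)[OF x] show "\<bar>(deriv ^^ i) (local_rep p q (F n)) x - (deriv ^^ i) (local_rep p q h) x\<bar> < e"
              unfolding dist_real_def by linarith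
          qed
        qed
      qed simp
      then have "\<forall>\<^sub>F n in sequentially. \<forall>i\<in>{..3}. \<forall>x\<in>L. \<bar>(deriv ^^ i) (local_rep p q (F n)) x - (deriv ^^ i) (local_rep p q h) x\<bar> < e"
        by (intro eventually_ball_finite) auto
      with dom[OF A(1-3) Lf] show "\<forall>\<^sub>F n in sequentially. F n \<in> s"
        by eventually_elim (auto simp: s C3_nbhd_def F)
    qed
  qed simp
  then show ?thesis unfolding limitin_def using top by (auto simp: T openin_topology_generated_by_iff)
qed

section \<open>Linear fractional transformations\<close>

text \<open>
  The point with homogeneous coordinates \<open>x\<close>, \<open>y\<close>. In these coordinates the action is linear, so no
  case distinctions are needed for composition.
\<close>

definition hpoint :: "real \<Rightarrow> real \<Rightarrow> rp1" where
  "hpoint x y = (if y = 0 then Infty else Fin (x / y))"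

definition lft :: "real \<Rightarrow> real \<Rightarrow> real \<Rightarrow> real \<Rightarrow> rp1 \<Rightarrow> rp1" where
  "lft a b c d P = (case P of Fin x \<Rightarrow> hpoint (a * x + b) (c * x + d) | Infty \<Rightarrow> hpoint a c)"

lemma hpoint_cases: obtains x y where "P = hpoint x y" "x \<noteq> 0 \<or> y \<noteq> 0"
proof (cases P)
  case (Fin x)
  then show ?thesis using that[of x 1] by (simp add: hpoint_def)
next
  case Infty
  then show ?thesis using that[of 1 0] by (simp add: hpoint_def)
qed

lemma hpoint_scale: "k \<noteq> 0 \<Longrightarrow> hpoint (k * x) (k * y) = hpoint x y"
  by (simp add: hpoint_def)

lemma lft_hpoint:
  assumes "x \<noteq> 0 \<or> y \<noteq> 0"
  shows "lft a b c d (hpoint x y) = hpoint (a * x + b * y) (c * x + d * y)"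
proof (cases "y = 0")
  case True
  then show ?thesis using assms hpoint_scale[of x a c] by (simp add: hpoint_def lft_def mult.commute)
next
  case False
  then have "lft a b c d (hpoint x y) = hpoint (a * (x / y) + b) (c * (x / y) + d)"
    by (simp add: hpoint_def lft_def)
  also have "... = hpoint (y * (a * (x / y) + b)) (y * (c * (x / y) + d))" using hpoint_scale False by metis
  finally show ?thesis using False by (simp add: algebra_simps)
qed

lemma lft_compose:
  assumes "a' * d' - b' * c' = 1"
  shows "lft a b c d \<circ> lft a' b' c' d' =
    lft (a * a' + b * c') (a * b' + b * d') (c * a' + d * c') (c * b' + d * d')"
proof
  fix P
  obtain x y where P: "P = hpoint x y" "x \<noteq> 0 \<or> y \<noteq> 0" by (rule hpoint_cases)
  have "a' * x + b' * y \<noteq> 0 \<or> c' * x + d' * y \<noteq> 0"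
  proof (rule ccontr)
    assume "\<not> ?thesis"
    then have z: "a' * x + b' * y = 0" "c' * x + d' * y = 0" by auto
    have "x = (a' * d' - b' * c') * x" using assms by simp
    also have "... = d' * (a' * x + b' * y) - b' * (c' * x + d' * y)" by (simp add: algebra_simps)
    finally have "x = 0" using z by simp
    have "y = (a' * d' - b' * c') * y" using assms by simp
    also have "... = a' * (c' * x + d' * y) - c' * (a' * x + b' * y)" by (simp add: algebra_simps)
    finally have "y = 0" using z by simp
    then show False using P \<open>x = 0\<close> by blast
  qed
  then show "(lft a b c d \<circ> lft a' b' c' d') P =
      lft (a * a' + b * c') (a * b' + b * d') (c * a' + d * c') (c * b' + d * d') P"
    by (simp only: o_apply P(1) lft_hpoint[OF P(2)] lft_hpoint) (simp add: algebra_simps)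
qed

lemma lft_id: "lft 1 0 0 1 = id"
  by (rule ext) (auto simp: lft_def hpoint_def split: rp1.splits)

lemma PSL2_eq: "PSL2 = {lft a b c d | a b c d. a * d - b * c = 1}"
proof -
  have m: "mobius A = lft (A$1$1) (A$1$2) (A$2$1) (A$2$2)" for A
  proof
    fix P show "mobius A P = lft (A$1$1) (A$1$2) (A$2$1) (A$2$2) P"
      by (cases P) (auto simp: lft_def hpoint_def)
  qed
  show ?thesis
  proof (intro equalityI subsetI)
    fix f assume "f \<in> PSL2"
    then obtain A where "f = mobius A" "det A = 1" by (auto simp: PSL2_def SL2_def)
    then show "f \<in> {lft a b c d | a b c d. a * d - b * c = 1}"
      unfolding m by (auto simp: det_2 intro!: exI)
  next
    fix f assume "f \<in> {lft a b c d | a b c d. a * d - b * c = 1}"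
    then obtain a b c d where f: "f = lft a b c d" "a * d - b * c = 1" by blast
    define A :: "real^2^2" where "A = vector [vector [a, b], vector [c, d]]"
    have "A \<in> SL2" "f = mobius A" using f by (simp_all add: A_def SL2_def m det_2)
    then show "f \<in> PSL2" by (auto simp: PSL2_def)
  qed
qed

lemma lft_in_PSL2: "a * d - b * c = 1 \<Longrightarrow> lft a b c d \<in> PSL2"
  unfolding PSL2_eq by blast

lemma linear_fraction_deriv:
  assumes "a * d - b * c = 1" "c * x + d \<noteq> 0"
  shows "((\<lambda>x. (a * x + b) / (c * x + d)) has_real_derivative 1 / (c * x + d)\<^sup>2) (at x)"
proof -
  have "a * (c * x + d) - (a * x + b) * c = 1" using assms(1) by (simp add: algebra_simps)
  then show ?thesis using assms(2)
    by (auto intro!: derivative_eq_intros simp: power2_eq_square)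
qed

lemma open_denominator: "open {x::real. c * x + d \<noteq> 0}"
  by (intro open_Collect_neq continuous_intros)

lemma C3_rep_linear_fraction:
  assumes det: "a * d - b * c = 1" and eq: "\<And>x. c * x + d \<noteq> 0 \<Longrightarrow> f (p x) = q ((a * x + b) / (c * x + d))"
  shows "C3_rep f p q {x. c * x + d \<noteq> 0} (\<lambda>x. (a * x + b) / (c * x + d))"
  unfolding C3_rep_def
proof (intro conjI ballI)
  show "open {x. c * x + d \<noteq> 0}" by (rule open_denominator)
  show "Ck_on 3 (\<lambda>x. (a * x + b) / (c * x + d)) {x. c * x + d \<noteq> 0}"
    by (intro Ck_on_divide Ck_on_add Ck_on_cmult Ck_on_ident Ck_on_const open_denominator) simp
  fix s assume s: "s \<in> {x. c * x + d \<noteq> 0}"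
  then show "deriv (\<lambda>x. (a * x + b) / (c * x + d)) s > 0"
    using DERIV_imp_deriv[OF linear_fraction_deriv[OF det, of s]] by simp
  show "f (p s) = q ((a * s + b) / (c * s + d))" using s eq by blast
qed

lemma C3_germI: "p \<in> atlas \<Longrightarrow> q \<in> atlas \<Longrightarrow> x \<in> S \<Longrightarrow> C3_rep f p q S g \<Longrightarrow> C3_germ f (p x)"
  unfolding C3_germ_def by blast

lemma C3_germ_lft_Fin:
  assumes det: "a * d - b * c = 1"
  shows "C3_germ (lft a b c d) (Fin x)"
proof (cases "c * x + d = 0")
  case False
  have "C3_rep (lft a b c d) Fin Fin {x. c * x + d \<noteq> 0} (\<lambda>x. (a * x + b) / (c * x + d))"
    by (rule C3_rep_linear_fraction[OF det]) (simp add: lft_def hpoint_def)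
  then show ?thesis by (rule C3_germI[rotated 3]) (use False in \<open>auto simp: atlas_cases\<close>)
next
  case True
  have "a * x + b \<noteq> 0"
  proof
    assume "a * x + b = 0"
    then have "a * (c * x + d) - c * (a * x + b) = 0" using True by simp
    then show False using det by (simp add: algebra_simps)
  qed
  moreover have "C3_rep (lft a b c d) Fin param_infty {x. a * x + b \<noteq> 0} (\<lambda>x. (- c * x + - d) / (a * x + b))"
  proof (rule C3_rep_linear_fraction)
    show "- c * b - - d * a = 1" using det by (simp add: algebra_simps)
    fix x assume x: "a * x + b \<noteq> 0"
    have "- c * x + - d = - (c * x + d)" by simp
    then show "lft a b c d (Fin x) = param_infty ((- c * x + - d) / (a * x + b))"
      using x unfolding \<open>- c * x + - d = - (c * x + d)\<close>
      by (simp add: lft_def hpoint_def param_infty_def del: minus_add_distrib)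
  qed
  ultimately show ?thesis by (intro C3_germI[of Fin param_infty]) (auto simp: atlas_cases)
qed

text \<open>
  At infinity, factor out the rotation \<open>x \<mapsto> - 1 / x\<close>: it moves infinity to the origin, and it is the
  identity in the charts \<open>param_infty\<close> and \<open>Fin\<close>.
\<close>

lemma C3_germ_lft:
  assumes det: "a * d - b * c = 1"
  shows "C3_germ (lft a b c d) P"
proof (cases P)
  case Infty
  have "C3_rep (lft 0 (-1) 1 0) param_infty Fin UNIV (\<lambda>x. x)"
    by (auto simp: C3_rep_def Ck_on_ident lft_def hpoint_def param_infty_def)
  then have "C3_germ (lft 0 (-1) 1 0) (param_infty 0)"
    by (rule C3_germI[OF _ _ UNIV_I, rotated 2]) (simp_all add: atlas_cases)
  then have "C3_germ (lft 0 (-1) 1 0) Infty" by (simp add: param_infty_def)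
  moreover have "lft 0 (-1) 1 0 Infty = Fin 0" by (simp add: lft_def hpoint_def)
  moreover have "C3_germ (lft (-b) a (-d) c) (Fin 0)" by (rule C3_germ_lft_Fin) (use det in \<open>simp add: algebra_simps\<close>)
  ultimately have "C3_germ (lft (-b) a (-d) c \<circ> lft 0 (-1) 1 0) Infty" using C3_germ_compose by metis
  then show ?thesis by (simp add: lft_compose Infty)
qed (simp add: C3_germ_lft_Fin det)

lemma lft_inverse:
  assumes "a * d - b * c = 1"
  shows "lft d (-b) (-c) a \<circ> lft a b c d = id" "lft a b c d \<circ> lft d (-b) (-c) a = id"
  using assms by (simp_all add: lft_compose lft_id[symmetric] algebra_simps)

lemma lft_in_Diff3:
  assumes "a * d - b * c = 1" shows "lft a b c d \<in> carrier Diff3"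
  unfolding carrier_Diff3_iff using o_bij[OF lft_inverse[OF assms]] C3_germ_lft[OF assms] by blast

lemma PSL2_subset: "PSL2 \<subseteq> carrier Diff3"
  using lft_in_Diff3 by (auto simp: PSL2_eq)

lemma PSL2_compose: "f \<in> PSL2 \<Longrightarrow> g \<in> PSL2 \<Longrightarrow> f \<circ> g \<in> PSL2"
proof -
  assume "f \<in> PSL2" "g \<in> PSL2"
  then obtain a b c d a' b' c' d' where f: "f = lft a b c d" "a * d - b * c = 1"
    and g: "g = lft a' b' c' d'" "a' * d' - b' * c' = 1" unfolding PSL2_eq by blast
  have "(a * a' + b * c') * (c * b' + d * d') - (a * b' + b * d') * (c * a' + d * c')
      = (a * d - b * c) * (a' * d' - b' * c')" by (simp add: algebra_simps)
  then have "... = 1" using f g by simp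
  then show "f \<circ> g \<in> PSL2" unfolding f(1) g(1) lft_compose[OF g(2)]
    by (intro lft_in_PSL2) (simp add: algebra_simps)
qed

lemma PSL2_inverse: "f \<in> PSL2 \<Longrightarrow> inv_into UNIV f \<in> PSL2"
proof -
  assume "f \<in> PSL2"
  then obtain a b c d where f: "f = lft a b c d" "a * d - b * c = 1" unfolding PSL2_eq by blast
  have "inv_into UNIV f = lft d (-b) (-c) a"
    using lft_inverse[OF f(2)] unfolding f(1) by (metis inv_unique_comp)
  then show ?thesis using f(2) by (auto intro!: lft_in_PSL2 simp: algebra_simps)
qed

lemma subgroup_PSL2: "subgroup PSL2 Diff3"
proof (rule subgroup.intro)
  show "PSL2 \<subseteq> carrier Diff3" by (rule PSL2_subset)
  show "\<one>\<^bsub>Diff3\<^esub> \<in> PSL2" using lft_in_PSL2[of 1 1 0 0] by (simp add: lft_id)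
qed (use PSL2_subset in \<open>auto simp: PSL2_compose PSL2_inverse inv_Diff3\<close>)

section \<open>Continuity of the group of translations\<close>

text \<open>
  The derivatives of \<open>(a x + b) / (c x + d)\<close> for determinant \<open>1\<close>, correct up to the third. They are
  polynomials in \<open>x\<close>, the coefficients and the reciprocal of the denominator, so uniform convergence
  reduces to that of the denominators.
\<close>

fun linear_fraction_nth_deriv :: "real \<Rightarrow> real \<Rightarrow> real \<Rightarrow> real \<Rightarrow> nat \<Rightarrow> real \<Rightarrow> real" where
  "linear_fraction_nth_deriv a b c d 0 x = (a * x + b) * inverse (c * x + d)"
| "linear_fraction_nth_deriv a b c d (Suc n) x =
     (if n = 0 then 1 else if n = 1 then - 2 * c else 6 * (c * c)) * inverse (c * x + d) ^ (n + 2)"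

lemma deriv_funpow_linear_fraction:
  assumes det: "a * d - b * c = 1" and "i \<le> 3" "c * x + d \<noteq> 0"
  shows "(deriv ^^ i) (\<lambda>x. (a * x + b) / (c * x + d)) x = linear_fraction_nth_deriv a b c d i x"
  using assms(2,3)
proof (induction i arbitrary: x)
  case 0
  then show ?case by (simp add: divide_inverse)
next
  case (Suc i)
  have "\<forall>\<^sub>F y in nhds x. y \<in> {x. c * x + d \<noteq> 0}"
    using Suc.prems by (intro eventually_nhds_in_open open_denominator) auto
  then have ev: "\<forall>\<^sub>F y in nhds x. (deriv ^^ i) (\<lambda>x. (a * x + b) / (c * x + d)) y = linear_fraction_nth_deriv a b c d i y"
    by eventually_elim (use Suc in auto)
  have "(linear_fraction_nth_deriv a b c d i has_real_derivative linear_fraction_nth_deriv a b c d (Suc i) x) (at x)"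
  proof -
    let ?I = "\<lambda>x. inverse (c * x + d)"
    have I: "(?I has_real_derivative - (?I x * c * ?I x)) (at x)"
      using Suc.prems by (auto intro!: derivative_eq_intros)
    have i: "i = 0 \<or> i = 1 \<or> i = 2" using Suc.prems by linarith
    have pw: "((\<lambda>x. k * ?I x ^ m) has_real_derivative - (real m * k * c * ?I x ^ Suc m)) (at x)" for k m
      by (rule derivative_eq_intros I refl)+ (cases m; simp add: algebra_simps)
    show ?thesis
    proof (cases "i = 0")
      case True
      have "((\<lambda>x. (a * x + b) / (c * x + d)) has_real_derivative 1 / (c * x + d)\<^sup>2) (at x)"
        by (rule linear_fraction_deriv[OF det]) (use Suc.prems in auto)
      moreover have "linear_fraction_nth_deriv a b c d i = (\<lambda>x. (a * x + b) / (c * x + d))"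
        by (rule ext) (simp add: True divide_inverse)
      ultimately show ?thesis using True by (simp add: divide_inverse power_inverse numeral_2_eq_2)
    next
      case False
      then consider "i = 1" | "i = 2" using i by blast
      then show ?thesis
      proof cases
        case 1
        have f: "linear_fraction_nth_deriv a b c d i = (\<lambda>x. 1 * ?I x ^ 2)" by (rule ext) (simp add: 1 power2_eq_square)
        show ?thesis unfolding f using pw[of 1 2] by (simp add: 1 eval_nat_numeral)
      next
        case 2
        have f: "linear_fraction_nth_deriv a b c d i = (\<lambda>x. (- 2 * c) * ?I x ^ 3)" by (rule ext) (simp add: 2 eval_nat_numeral)
        show ?thesis unfolding f using pw[of "-2 * c" 3] by (simp add: 2 eval_nat_numeral algebra_simps)
      qed
    qed
  qed
  then show ?case using deriv_cong_ev[OF ev refl] by (simp add: DERIV_imp_deriv del: linear_fraction_nth_deriv.simps)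
qed

lemma uniform_limit_power:
  fixes f :: "nat \<Rightarrow> real \<Rightarrow> real"
  assumes "uniform_limit L f l F" "bounded (l ` L)"
  shows "uniform_limit L (\<lambda>n x. f n x ^ m) (\<lambda>x. l x ^ m) F"
proof (induction m)
  case (Suc m)
  obtain B where B: "\<And>x. x \<in> L \<Longrightarrow> norm (l x) \<le> B" using assms(2) unfolding bounded_iff by auto
  have "bounded ((\<lambda>x. l x ^ m) ` L)"
    unfolding bounded_iff using B by (intro exI[of _ "B ^ m"]) (auto simp: norm_power intro!: power_mono simp flip: real_norm_def)
  then show ?case using uniform_lim_mult[OF assms(1) Suc assms(2)] by simp
qed (auto intro: uniform_limit_const)

lemma linear_fractions_uniform_limit:
  fixes b c :: "nat \<Rightarrow> real"
  assumes lim: "a \<longlonglongrightarrow> a'" "b \<longlonglongrightarrow> b'" "c \<longlonglongrightarrow> c'" "d \<longlonglongrightarrow> d'"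
    and L: "compact L" "\<And>x. x \<in> L \<Longrightarrow> c' * x + d' \<noteq> 0"
  shows "\<forall>\<^sub>F n in sequentially. \<forall>x\<in>L. c n * x + d n \<noteq> 0"
    "uniform_limit L (\<lambda>n. linear_fraction_nth_deriv (a n) (b n) (c n) (d n) i) (linear_fraction_nth_deriv a' b' c' d' i) sequentially"
proof -
  have bL: "bounded ((\<lambda>x. x) ` L)" using compact_imp_bounded[OF L(1)] by simp
  have const: "uniform_limit L (\<lambda>n x. f n) (\<lambda>x. l) sequentially" if "f \<longlonglongrightarrow> l" for f and l :: real
    using tendstoD[OF that] by (auto simp: uniform_limit_iff elim!: eventually_mono)
  have bc: "bounded ((\<lambda>x. k) ` L)" for k :: real by (rule bounded_subset[of "{k}"]) auto
  have aff: "uniform_limit L (\<lambda>n x. f n * x + g n) (\<lambda>x. l * x + m) sequentially"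
    if "f \<longlonglongrightarrow> l" "g \<longlonglongrightarrow> m" for f g and l m :: real
    by (intro uniform_limit_add uniform_lim_mult const that uniform_limit_const bL bc)
  have bf: "bounded (f ` L)" if "continuous_on L f" for f :: "real \<Rightarrow> real"
    using compact_imp_bounded[OF compact_continuous_image[OF that L(1)]] .
  obtain e where e: "e > 0" "\<And>x. x \<in> L \<Longrightarrow> e \<le> norm (c' * x + d')"
  proof (cases "L = {}")
    case True then show ?thesis using that[of 1] by auto
  next
    case False
    have "continuous_on L (\<lambda>x. norm (c' * x + d'))" by (intro continuous_intros)
    then obtain x0 where "x0 \<in> L" "\<And>x. x \<in> L \<Longrightarrow> norm (c' * x0 + d') \<le> norm (c' * x + d')"
      using continuous_attains_inf[OF L(1) False] by blast
    then show ?thesis using that[of "norm (c' * x0 + d')"] L(2) by auto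
  qed
  have D: "uniform_limit L (\<lambda>n x. c n * x + d n) (\<lambda>x. c' * x + d') sequentially" by (rule aff[OF lim(3,4)])
  then have "\<forall>\<^sub>F n in sequentially. \<forall>x\<in>L. dist (c n * x + d n) (c' * x + d') < e"
    using e(1) unfolding uniform_limit_iff by blast
  then show "\<forall>\<^sub>F n in sequentially. \<forall>x\<in>L. c n * x + d n \<noteq> 0"
    by eventually_elim (use e in \<open>force simp: dist_real_def\<close>)
  have I: "uniform_limit L (\<lambda>n x. inverse (c n * x + d n)) (\<lambda>x. inverse (c' * x + d')) sequentially"
    using uniform_lim_inverse[OF D e(2,1)] by (simp add: o_def)
  have bI: "bounded ((\<lambda>x. inverse (c' * x + d')) ` L)" "bounded ((\<lambda>x. inverse (c' * x + d') ^ m) ` L)" for m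
    by (intro bf continuous_intros; use L(2) in auto)+
  show "uniform_limit L (\<lambda>n. linear_fraction_nth_deriv (a n) (b n) (c n) (d n) i) (linear_fraction_nth_deriv a' b' c' d' i) sequentially"
  proof (cases i)
    case 0
    have "uniform_limit L (\<lambda>n x. (a n * x + b n) * inverse (c n * x + d n)) (\<lambda>x. (a' * x + b') * inverse (c' * x + d')) sequentially"
      by (intro uniform_lim_mult aff lim I bI bf continuous_intros)
    moreover have "linear_fraction_nth_deriv a b c d 0 = (\<lambda>x. (a * x + b) * inverse (c * x + d))" for a b c d
      by (rule ext) simp
    ultimately show ?thesis using 0 by simp
  next
    case (Suc n)
    let ?k = "\<lambda>c::real. if n = 0 then 1 else if n = 1 then - 2 * c else 6 * (c * c)"
    have "(\<lambda>n. ?k (c n)) \<longlonglongrightarrow> ?k c'" using lim(3) by (auto intro!: tendsto_intros)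
    then have "uniform_limit L (\<lambda>j x. ?k (c j) * inverse (c j * x + d j) ^ (n + 2)) (\<lambda>x. ?k c' * inverse (c' * x + d') ^ (n + 2)) sequentially"
      by (intro uniform_lim_mult const uniform_limit_power I bI bc)
    moreover have "linear_fraction_nth_deriv a b c d (Suc n) = (\<lambda>x. ?k c * inverse (c * x + d) ^ (n + 2))" for a b c d
      by (rule ext) simp
    ultimately show ?thesis using Suc by simp
  qed
qed

lemma local_rep_linear_fraction:
  assumes det: "a * d - b * c = 1" and q: "q \<in> atlas"
    and eq: "\<And>x. c * x + d \<noteq> 0 \<Longrightarrow> f (p x) = q ((a * x + b) / (c * x + d))"
    and x: "c * x + d \<noteq> 0" and i: "i \<le> 3"
  shows "x \<in> local_dom p q f" "(deriv ^^ i) (local_rep p q f) x = linear_fraction_nth_deriv a b c d i x"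
proof -
  have R: "C3_rep f p q {x. c * x + d \<noteq> 0} (\<lambda>x. (a * x + b) / (c * x + d))"
    by (rule C3_rep_linear_fraction[OF det]) (rule eq)
  show "x \<in> local_dom p q f" using C3_rep_local_rep(2)[OF R q] x by simp
  have "(deriv ^^ i) (local_rep p q f) x = (deriv ^^ i) (\<lambda>x. (a * x + b) / (c * x + d)) x"
    by (rule deriv_funpow_cong[OF open_denominator[of c d]]) (use C3_rep_local_rep(1)[OF R q] x in auto)
  then show "(deriv ^^ i) (local_rep p q f) x = linear_fraction_nth_deriv a b c d i x"
    using deriv_funpow_linear_fraction[OF det i x] by simp
qed

text \<open>
  In each of the four pairs of charts a translation is a linear fraction, whose coefficients depend
  continuously on the translation length.
\<close>

lemma translations_tendsto_id:
  fixes t :: "nat \<Rightarrow> real"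
  assumes t: "t \<longlonglongrightarrow> 0"
  shows "limitin C3_topology (\<lambda>n. lft 1 (t n) 0 1) id sequentially"
proof (rule limitin_C3_topology)
  show "id \<in> carrier Diff3" using lft_in_Diff3[of 1 1 0 0] by (simp add: lft_id)
  show "lft 1 (t n) 0 1 \<in> carrier Diff3" for n by (rule lft_in_Diff3) simp
  define Q where "Q p q a b c d \<longleftrightarrow> (\<forall>s. a s * d s - b s * c s = 1) \<and>
      isCont a 0 \<and> isCont b 0 \<and> isCont c 0 \<and> isCont d 0 \<and>
      (\<forall>s x. c s * x + d s \<noteq> 0 \<longrightarrow> lft 1 s 0 1 (p x) = q ((a s * x + b s) / (c s * x + d s))) \<and>
      (\<forall>x\<in>local_dom p q id. c 0 * x + d 0 \<noteq> 0)"
    for p q :: "real \<Rightarrow> rp1" and a b c d :: "real \<Rightarrow> real"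
  have coeffs: "\<exists>a b c d. Q p q a b c d" if pq: "p \<in> atlas" "q \<in> atlas" for p q
  proof -
    consider "p = Fin" "q = Fin" | "p = Fin" "q = param_infty" | "p = param_infty" "q = Fin" | "p = param_infty" "q = param_infty"
      using pq by (auto simp: atlas_cases)
    then show ?thesis
    proof cases
      case 1
      then have "Q p q (\<lambda>_. 1) (\<lambda>s. s) (\<lambda>_. 0) (\<lambda>_. 1)"
        by (auto simp: Q_def lft_def hpoint_def)
      then show ?thesis by blast
    next
      case 2
      then have "Q p q (\<lambda>_. 0) (\<lambda>_. -1) (\<lambda>_. 1) (\<lambda>s. s)"
        by (auto simp: Q_def lft_def hpoint_def local_dom_def param_infty_def split: if_splits)
      then show ?thesis by blast
    next
      case 3
      then have "Q p q (\<lambda>s. s) (\<lambda>_. -1) (\<lambda>_. 1) (\<lambda>_. 0)"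
        by (auto simp: Q_def lft_def hpoint_def local_dom_def param_infty_def field_simps split: if_splits)
      then show ?thesis by blast
    next
      case 4
      then have "Q p q (\<lambda>_. 1) (\<lambda>_. 0) (\<lambda>s. - s) (\<lambda>_. 1)"
        by (auto simp: Q_def lft_def hpoint_def local_dom_def param_infty_def divide_simps split: if_splits)
      then show ?thesis by blast
    qed
  qed
  fix p q and L :: "real set" assume p: "p \<in> atlas" and q: "q \<in> atlas" and L: "compact L" "L \<subseteq> local_dom p q id"
  obtain a b c d where det: "\<And>s. a s * d s - b s * c s = 1" and ct: "isCont a 0" "isCont b 0" "isCont c 0" "isCont d 0"
    and eq: "\<And>s x. c s * x + d s \<noteq> 0 \<Longrightarrow> lft 1 s 0 1 (p x) = q ((a s * x + b s) / (c s * x + d s))"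
    and nz: "\<And>x. x \<in> local_dom p q id \<Longrightarrow> c 0 * x + d 0 \<noteq> 0"
    using coeffs[OF p q] unfolding Q_def by blast
  have nzL: "c 0 * x + d 0 \<noteq> 0" if "x \<in> L" for x using nz L(2) that by blast
  note U0 = linear_fractions_uniform_limit[OF isCont_tendsto_compose[OF ct(1) t] isCont_tendsto_compose[OF ct(2) t]
      isCont_tendsto_compose[OF ct(3) t] isCont_tendsto_compose[OF ct(4) t] L(1)]
  have U1: "\<forall>\<^sub>F n in sequentially. \<forall>x\<in>L. c (t n) * x + d (t n) \<noteq> 0"
    by (rule U0(1)) (rule nzL)
  have U2: "uniform_limit L (\<lambda>n. linear_fraction_nth_deriv (a (t n)) (b (t n)) (c (t n)) (d (t n)) i)
      (linear_fraction_nth_deriv (a 0) (b 0) (c 0) (d 0) i) sequentially" for i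
    by (rule U0(2)) (rule nzL)
  have rep: "x \<in> local_dom p q (lft 1 s 0 1)"
    "(deriv ^^ i) (local_rep p q (lft 1 s 0 1)) x = linear_fraction_nth_deriv (a s) (b s) (c s) (d s) i x"
    if "c s * x + d s \<noteq> 0" "i \<le> 3" for s x i
    by (rule local_rep_linear_fraction[where a = "a s" and b = "b s" and c = "c s" and d = "d s", OF det q _ that];
        rule eq; assumption)+
  show "\<forall>\<^sub>F n in sequentially. L \<subseteq> local_dom p q (lft 1 (t n) 0 1)"
    using U1 by eventually_elim (use rep(1)[of _ _ 0] in auto)
  fix i :: nat assume i: "i \<le> 3"
  have id0: "(deriv ^^ i) (local_rep p q id) x = linear_fraction_nth_deriv (a 0) (b 0) (c 0) (d 0) i x" if "x \<in> L" for x
    using rep(2)[OF nzL i] that by (simp add: lft_id)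
  have "\<forall>\<^sub>F n in sequentially. \<forall>x\<in>L. linear_fraction_nth_deriv (a (t n)) (b (t n)) (c (t n)) (d (t n)) i x = (deriv ^^ i) (local_rep p q (lft 1 (t n) 0 1)) x"
    using U1 by eventually_elim (use rep(2) i in auto)
  then have "uniform_limit L (\<lambda>n. linear_fraction_nth_deriv (a (t n)) (b (t n)) (c (t n)) (d (t n)) i)
      (linear_fraction_nth_deriv (a 0) (b 0) (c 0) (d 0) i) sequentially \<longleftrightarrow>
    uniform_limit L (\<lambda>n. (deriv ^^ i) (local_rep p q (lft 1 (t n) 0 1))) ((deriv ^^ i) (local_rep p q id)) sequentially"
    by (rule uniform_limit_cong) (simp add: id0)
  then show "uniform_limit L (\<lambda>n. (deriv ^^ i) (local_rep p q (lft 1 (t n) 0 1))) ((deriv ^^ i) (local_rep p q id)) sequentially"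
    using U2 by blast
qed

section \<open>Vectors fixed by a translation\<close>

lemma unitary_rep_tendsto:
  assumes "unitary_rep G T \<rho>" "limitin T F f sequentially"
  shows "(\<lambda>n. \<rho> (F n) v) \<longlonglongrightarrow> \<rho> f v"
proof (rule topological_tendstoI)
  fix S assume S: "open S" "\<rho> f v \<in> S"
  have "openin T {g \<in> topspace T. \<rho> g v \<in> S}"
    using unitary_repD(3)[OF assms(1), of v] S(1) by (simp add: continuous_map_def)
  moreover have "f \<in> {g \<in> topspace T. \<rho> g v \<in> S}" using S(2) limitin_topspace[OF assms(2)] by simp
  ultimately have "\<forall>\<^sub>F n in sequentially. F n \<in> {g \<in> topspace T. \<rho> g v \<in> S}"
    using limitinD[OF assms(2)] by blast
  then show "\<forall>\<^sub>F n in sequentially. \<rho> (F n) v \<in> S" by eventually_elim simp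
qed

text \<open>
  The Mautner phenomenon. Let \<open>u t\<close> and \<open>l s\<close> be the upper and lower unipotent matrices and \<open>A n\<close>
  the diagonal matrix with entries \<open>2\<^sup>n\<close> and \<open>2\<^sup>-\<^sup>n\<close>. A vector fixed by \<open>u 1\<close> is fixed by all \<open>u n\<close>
  with integral \<open>n\<close>. The product \<open>u (2 j) \<circ> l (1 / (2 j)) \<circ> u (- j)\<close> equals \<open>A 1 \<circ> l (1 / j)\<close>; as
  \<open>j\<close> grows, the lower factors on both sides tend to the identity, so the vector is fixed by
  \<open>A 1\<close>. Conjugation by powers of \<open>A 1\<close> contracts every \<open>u t\<close> and, in the other direction, every
  \<open>l s\<close> to the identity, so the vector is fixed by these as well, and they generate the group.
\<close>

lemma fixed_by_translation_imp_fixed_by_PSL2: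
  fixes \<rho> :: "(rp1 \<Rightarrow> rp1) \<Rightarrow> 'h::complex_hilbert_space \<Rightarrow> 'h"
  assumes rep: "unitary_rep Diff3 C3_topology \<rho>" and v: "\<rho> (lft 1 1 0 1) v = v"
  shows "v \<in> invariant_vectors PSL2 \<rho>"
proof -
  note R = unitary_repD[OF rep]
  note U = unitary_groupD[OF R(1)]
  have comp: "\<rho> (f \<circ> g) x = \<rho> f (\<rho> g x)" if "f \<in> PSL2" "g \<in> PSL2" for f g x
    using R(2)[of f g x] that PSL2_subset by (auto simp: subset_iff)
  have one: "\<rho> id x = x" for x using unitary_rep_one[OF group_Diff3 rep] by simp
  define u where "u t = lft 1 t 0 1" for t
  define l where "l s = lft 1 0 s 1" for s
  have uP: "u t \<in> PSL2" and lP: "l t \<in> PSL2" for t by (auto simp: u_def l_def intro!: lft_in_PSL2)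
  have nrm: "norm (\<rho> k x - \<rho> k y) = norm (x - y)" if "k \<in> PSL2" for k x y
    using U(4,5)[of k] that PSL2_subset by (metis subsetD)
  have u0: "(\<lambda>n. \<rho> (u (t n)) x) \<longlonglongrightarrow> x" if "t \<longlonglongrightarrow> 0" for t x
    using unitary_rep_tendsto[OF rep translations_tendsto_id[OF that], of x] by (simp add: u_def one)
  have l0: "(\<lambda>n. \<rho> (l (t n)) x) \<longlonglongrightarrow> x" if "t \<longlonglongrightarrow> 0" for t x
  proof -
    \<comment> \<open>A lower unipotent matrix is conjugate to an upper one by the rotation.\<close>
    let ?w = "lft 0 (-1) 1 0" and ?w' = "lft 0 1 (-1) 0"
    have w: "?w \<in> PSL2" "?w' \<in> PSL2" by (auto intro!: lft_in_PSL2)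
    have l: "l s = ?w \<circ> (u (- s) \<circ> ?w')" for s by (simp add: l_def u_def lft_compose)
    have "(\<lambda>n. \<rho> (u (- t n)) (\<rho> ?w' x)) \<longlonglongrightarrow> \<rho> ?w' x" by (rule u0) (use tendsto_minus[OF that] in simp)
    then have "(\<lambda>n. \<rho> ?w (\<rho> (u (- t n)) (\<rho> ?w' x))) \<longlonglongrightarrow> \<rho> ?w (\<rho> ?w' x)"
      using w PSL2_subset by (intro bounded_linear.tendsto[OF U(6)]) auto
    moreover have "\<rho> ?w (\<rho> ?w' x) = x" using comp[OF w, of x] one by (simp add: lft_compose lft_id)
    ultimately show ?thesis by (simp add: l comp w PSL2_compose uP)
  qed
  have fix_comp: "\<rho> (f \<circ> g) v = v" if "f \<in> PSL2" "g \<in> PSL2" "\<rho> f v = v" "\<rho> g v = v" for f g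
    using comp[OF that(1,2)] that(3,4) by simp
  have inv_fix: "\<rho> g v = v" if "f \<in> PSL2" "g \<in> PSL2" "g \<circ> f = id" "\<rho> f v = v" for f g
    using comp[OF that(2,1), of v] that(3,4) one by simp
  have u1: "\<rho> (u 1) v = v" by (simp only: u_def v)
  have un: "\<rho> (u (real n)) v = v" for n
  proof (induction n)
    case 0 show ?case by (simp only: u_def lft_id of_nat_0 one)
  next
    case (Suc n)
    have "u (real (Suc n)) = u 1 \<circ> u (real n)" by (simp add: u_def lft_compose add.commute)
    then show ?case using fix_comp[OF uP uP _ Suc, of 1] u1 by (simp only:)
  qed
  have um: "\<rho> (u (- real n)) v = v" for n
    by (rule inv_fix[OF uP uP _ un[of n]]) (simp add: u_def lft_compose lft_id)
  define A where "A n = lft (2 ^ n) 0 0 (1 / 2 ^ n)" for n :: nat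
  define A' where "A' n = lft (1 / 2 ^ n) 0 0 (2 ^ n)" for n :: nat
  have AP: "A n \<in> PSL2" "A' n \<in> PSL2" for n by (auto simp: A_def A'_def intro!: lft_in_PSL2)
  have A1: "\<rho> (A 1) v = v"
  proof -
    have lim1: "(\<lambda>j. 1 / real (Suc j)) \<longlonglongrightarrow> 0" by (rule LIMSEQ_Suc[OF lim_const_over_n])
    have lim2: "(\<lambda>j. 1 / (2 * real (Suc j))) \<longlonglongrightarrow> 0"
      using tendsto_mult_right[OF lim1, of "1/2"] by (simp add: field_simps)
    have eq: "A 1 \<circ> l (1 / real (Suc j)) = u (real (2 * Suc j)) \<circ> (l (1 / (2 * real (Suc j))) \<circ> u (- real (Suc j)))" for j
    proof -
      define r where "r = real (Suc j)"
      have r: "r \<noteq> 0" "real (2 * Suc j) = 2 * r" by (auto simp: r_def)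
      show ?thesis unfolding r_def[symmetric] r(2) using r(1)
        by (simp add: A_def l_def u_def lft_compose field_simps)
    qed
    have "(\<lambda>j. \<rho> (A 1) (\<rho> (l (1 / real (Suc j))) v)) \<longlonglongrightarrow> \<rho> (A 1) v"
      using AP PSL2_subset by (intro bounded_linear.tendsto[OF U(6)] l0 lim1) auto
    moreover have "(\<lambda>j. \<rho> (A 1) (\<rho> (l (1 / real (Suc j))) v)) \<longlonglongrightarrow> v"
    proof -
      have "\<rho> (A 1) (\<rho> (l (1 / real (Suc j))) v) = \<rho> (u (real (2 * Suc j))) (\<rho> (l (1 / (2 * real (Suc j)))) v)" for j
        using comp[OF AP(1) lP, of 1 "1 / real (Suc j)" v] um[of "Suc j"] unfolding eq
        by (simp add: comp uP lP PSL2_compose del: of_nat_Suc of_nat_mult)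
      moreover have "norm (\<rho> (u (real (2 * Suc j))) x - v) = norm (x - v)" for x j
        using nrm[OF uP, of "real (2 * Suc j)" x v] by (simp only: un)
      moreover have "(\<lambda>j. norm (\<rho> (l (1 / (2 * real (Suc j)))) v - v)) \<longlonglongrightarrow> 0"
        using l0[OF lim2, of v] by (simp add: LIM_zero_iff tendsto_norm_zero_iff)
      ultimately show ?thesis by (subst LIM_zero_iff[symmetric], subst tendsto_norm_zero_iff[symmetric]) simp
    qed
    ultimately show ?thesis by (rule LIMSEQ_unique)
  qed
  have An: "\<rho> (A n) v = v" for n
  proof (induction n)
    case 0 show ?case using one by (simp only: A_def lft_id power_0 div_by_1)
  next
    case (Suc n)
    have "A (Suc n) = A 1 \<circ> A n" by (simp add: A_def lft_compose)
    then show ?case using fix_comp[OF AP(1) AP(1) A1 Suc] by (simp only:)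
  qed
  have A'n: "\<rho> (A' n) v = v" for n
    by (rule inv_fix[OF AP(1) AP(2) _ An[of n]]) (simp add: A_def A'_def lft_compose lft_id)
  \<comment> \<open>If \<open>f n\<close> and \<open>h n\<close> fix \<open>v\<close>, then \<open>k\<close> moves \<open>v\<close> by as much as \<open>g n\<close> does, for every \<open>n\<close>.\<close>
  have contract: "\<rho> k v = v"
    if k: "\<And>n. k = f n \<circ> (g n \<circ> h n)" and P: "\<And>n. f n \<in> PSL2" "\<And>n. g n \<in> PSL2" "\<And>n. h n \<in> PSL2"
      and fx: "\<And>n. \<rho> (f n) v = v" "\<And>n. \<rho> (h n) v = v" and lim: "(\<lambda>n. \<rho> (g n) v) \<longlonglongrightarrow> v" for k and f g h :: "nat \<Rightarrow> _"
  proof -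
    have "norm (\<rho> k v - v) = norm (\<rho> (g n) v - v)" for n
    proof -
      have "\<rho> k v = \<rho> (f n) (\<rho> (g n) v)" using k[of n] comp P PSL2_compose fx by simp
      then show ?thesis using nrm[OF P(1), of n "\<rho> (g n) v" v] fx by simp
    qed
    moreover have "(\<lambda>n. norm (\<rho> (g n) v - v)) \<longlonglongrightarrow> 0" using lim by (simp add: LIM_zero_iff tendsto_norm_zero_iff)
    ultimately have "(\<lambda>n::nat. norm (\<rho> k v - v)) \<longlonglongrightarrow> 0" by simp
    then show ?thesis by (simp add: LIMSEQ_const_iff)
  qed
  have lim4: "(\<lambda>n. t / 4 ^ n) \<longlonglongrightarrow> (0::real)" for t :: real
    using tendsto_mult_right[OF LIMSEQ_realpow_zero[of "1/4"], of t] by (simp add: power_divide)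
  have four: "(4::real) ^ n = 2 ^ n * 2 ^ n" for n by (simp flip: power_mult_distrib)
  have ut: "\<rho> (u t) v = v" for t
    by (rule contract[where f = A and g = "\<lambda>n. u (t / 4 ^ n)" and h = A'])
      (auto simp: AP uP An A'n intro!: u0 lim4, auto simp: A_def A'_def u_def lft_compose four)
  have lt: "\<rho> (l t) v = v" for t
    by (rule contract[where f = A' and g = "\<lambda>n. l (t / 4 ^ n)" and h = A])
      (auto simp: AP lP An A'n intro!: l0 lim4, auto simp: A_def A'_def l_def lft_compose four)
  have gen: "\<rho> (lft a b c d) v = v" if det: "a * d - b * c = 1" and c: "c \<noteq> 0" for a b c d
  proof -
    define \<alpha> \<beta> where "\<alpha> = (a - 1) / c" and "\<beta> = (d - 1) / c"
    have "a = 1 + \<alpha> * c" "d = 1 + c * \<beta>" using c by (simp_all add: \<alpha>_def \<beta>_def)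
    moreover have "b = \<beta> + \<alpha> * (c * \<beta> + 1)"
      using det c by (simp add: \<alpha>_def \<beta>_def field_simps)
    ultimately have "lft a b c d = u \<alpha> \<circ> (l c \<circ> u \<beta>)"
      by (simp add: u_def l_def lft_compose add.commute)
    then show ?thesis by (simp add: fix_comp PSL2_compose uP lP ut lt)
  qed
  have "\<rho> k v = v" if k: "k \<in> PSL2" for k
  proof -
    obtain a b c d where abcd: "k = lft a b c d" "a * d - b * c = 1" using k unfolding PSL2_eq by blast
    show ?thesis
    proof (cases "c = 0")
      case True
      \<comment> \<open>Multiplication by \<open>l 1\<close> on the right makes the lower left entry nonzero.\<close>
      then have ad: "a * d = 1" "d \<noteq> 0" using abcd by auto
      have "\<rho> (lft (a + b) b d d) v = v" by (rule gen) (use ad in \<open>auto simp: algebra_simps\<close>)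
      moreover have "k = lft (a + b) b d d \<circ> l (-1)" using True abcd by (simp add: l_def lft_compose)
      moreover have "lft (a + b) b d d \<in> PSL2" by (rule lft_in_PSL2) (use ad in \<open>auto simp: algebra_simps\<close>)
      ultimately show ?thesis using fix_comp lP lt by simp
    qed (use gen abcd in auto)
  qed
  then show ?thesis by (simp add: invariant_vectors_def)
qed

section \<open>A zero of the Schwarzian derivative\<close>

lemma deriv_funpow_3:
  assumes "open S" "\<And>x. x \<in> S \<Longrightarrow> (f has_real_derivative f1 x) (at x)"
    "\<And>x. x \<in> S \<Longrightarrow> (f1 has_real_derivative f2 x) (at x)"
    "\<And>x. x \<in> S \<Longrightarrow> (f2 has_real_derivative f3 x) (at x)" "x \<in> S"
  shows "(deriv ^^ 1) f x = f1 x" "(deriv ^^ 2) f x = f2 x" "(deriv ^^ 3) f x = f3 x"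
proof -
  have d: "deriv f x = f1 x" "deriv f1 x = f2 x" "deriv f2 x = f3 x" if "x \<in> S" for x
    using assms(2-4)[OF that] by (simp_all add: DERIV_imp_deriv)
  have 2: "deriv (deriv f) x = f2 x" if "x \<in> S" for x
    using deriv_funpow_cong[OF assms(1) d(1) that, where i = 1] d(2)[OF that] by simp
  have 3: "deriv (deriv (deriv f)) x = f3 x" if "x \<in> S" for x
    using deriv_funpow_cong[OF assms(1) 2 that, where i = 1] d(3)[OF that] by simp
  show "(deriv ^^ 1) f x = f1 x" "(deriv ^^ 2) f x = f2 x" "(deriv ^^ 3) f x = f3 x"
    using d(1) 2 3 assms(5) by (simp_all add: eval_nat_numeral)
qed

lemma Ck_on_has_deriv_funpow:
  "Ck_on k f S \<Longrightarrow> i < k \<Longrightarrow> x \<in> S \<Longrightarrow> ((deriv ^^ i) f has_real_derivative (deriv ^^ Suc i) f x) (at x)"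
  by (simp add: Ck_on_def DERIV_deriv_iff_real_differentiable)

lemma Ck_on_3D:
  assumes "Ck_on 3 f S" "x \<in> S"
  shows "(f has_real_derivative deriv f x) (at x)" "(deriv f has_real_derivative (deriv ^^ 2) f x) (at x)"
    "((deriv ^^ 2) f has_real_derivative (deriv ^^ 3) f x) (at x)"
  using Ck_on_has_deriv_funpow[OF assms(1) _ assms(2), of 0] Ck_on_has_deriv_funpow[OF assms(1) _ assms(2), of 1]
    Ck_on_has_deriv_funpow[OF assms(1) _ assms(2), of 2] by (simp_all add: eval_nat_numeral)

lemma Ck_on_3_continuous_deriv: "Ck_on 3 f S \<Longrightarrow> continuous_on S (deriv f)"
  by (auto simp: Ck_on_def dest: spec[of _ 1])

text \<open>
  A strictly convex function lies above a nonconstant tangent line, so it is unbounded on the whole line.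
\<close>

lemma convex_bounded_contradiction:
  fixes y :: "real \<Rightarrow> real"
  assumes d: "\<And>x. (y has_real_derivative y1 x) (at x)" "\<And>x. (y1 has_real_derivative y2 x) (at x)"
    and pos: "\<And>x. y2 x > 0" and bdd: "\<And>x. \<bar>y x\<bar> \<le> M"
  shows False
proof -
  have inc: "y1 a < y1 b" if "a < b" for a b
    using deriv_pos_imp_less[of a b y1 y2] d(2) pos that by blast
  have mvt: "\<exists>z. a < z \<and> z < b \<and> y b - y a = (b - a) * y1 z" if "a < b" for a b
    using MVT2[OF that, of y y1] d(1) by blast
  obtain t where t: "y1 t \<noteq> 0" using inc[of 0 1] by (metis less_irrefl zero_less_one)
  define s where "s = (2 * M + 1) / \<bar>y1 t\<bar>"
  have M: "M \<ge> 0" using bdd[of 0] by linarith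
  have s: "s > 0" "s * \<bar>y1 t\<bar> = 2 * M + 1" using t M by (simp_all add: s_def)
  show False
  proof (cases "y1 t > 0")
    case True
    obtain z where z: "t < z" "y (t + s) - y t = s * y1 z" using mvt[of t "t + s"] s by auto
    have "s * y1 t < s * y1 z" using inc[OF z(1)] s by simp
    moreover have "s * y1 t = 2 * M + 1" using s(2) True by simp
    ultimately show False using z(2) bdd[of t] bdd[of "t + s"] by linarith
  next
    case False
    obtain z where z: "z < t" "y t - y (t - s) = s * y1 z" using mvt[of "t - s" t] s by auto
    have "s * y1 z < s * y1 t" using inc[OF z(1)] s by simp
    moreover have "s * y1 t = - (2 * M + 1)" using s(2) False by simp
    ultimately show False using z(2) bdd[of t] bdd[of "t - s"] by linarith
  qed
qed

text \<open>
  A continuous second derivative without zeros has constant sign, so \<open>y\<close> or \<open>- y\<close> would be strictly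
  convex.
\<close>

lemma bounded_imp_second_derivative_zero:
  fixes y :: "real \<Rightarrow> real"
  assumes d: "\<And>x. (y has_real_derivative y1 x) (at x)" "\<And>x. (y1 has_real_derivative y2 x) (at x)"
    and cont: "continuous_on UNIV y2" and bdd: "\<And>x. \<bar>y x\<bar> \<le> M"
  obtains x where "y2 x = 0"
proof (rule ccontr)
  assume "\<not> thesis"
  then have nz: "y2 x \<noteq> 0" for x using that by blast
  have sgn: "y2 a > 0 \<longleftrightarrow> y2 b > 0" for a b
  proof (rule ccontr)
    assume "\<not> ?thesis"
    then obtain u v where uv: "y2 u > 0" "y2 v < 0" using nz by (metis linorder_neqE_linordered_idom)
    have "connected (range y2)" using cont by (simp add: connected_continuous_image)
    then have "0 \<in> range y2" using uv connectedD_interval[of "range y2" "y2 v" "y2 u" 0] by auto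
    then show False using nz by auto
  qed
  show False
  proof (cases "y2 0 > 0")
    case True
    then show False using convex_bounded_contradiction[OF d _ bdd] sgn by blast
  next
    case False
    have "- y2 x > 0" for x using sgn[of 0 x] nz[of x] False by linarith
    then show False
      using convex_bounded_contradiction[of "\<lambda>x. - y x" "\<lambda>x. - y1 x" "\<lambda>x. - y2 x" M] d bdd
      by (auto intro!: DERIV_minus)
  qed
qed

text \<open>
  The equation says that the Schwarzian derivative \<open>F''' / F' - 3/2 (F'' / F')\<^sup>2\<close> vanishes at \<open>x\<close>.
  Up to a positive factor and a sign it is the second derivative of the bounded function
  \<open>F' powr (-1/2)\<close>.
\<close>

lemma schwarzian_zero_of_bounded:
  fixes F :: "real \<Rightarrow> real"
  assumes F: "Ck_on 3 F UNIV" "\<And>x. deriv F x > 0" and bdd: "\<And>x. 1 / deriv F x \<le> M"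
  obtains x where "2 * deriv F x * (deriv ^^ 3) F x = 3 * ((deriv ^^ 2) F x)\<^sup>2"
proof -
  note D = Ck_on_3D[OF F(1) UNIV_I]
  define F1 F2 F3 where "F1 = deriv F" and "F2 = (deriv ^^ 2) F" and "F3 = (deriv ^^ 3) F"
  have d: "(F1 has_real_derivative F2 x) (at x)" "(F2 has_real_derivative F3 x) (at x)" and pos: "F1 x > 0" for x
    using D F(2) by (auto simp: F1_def F2_def F3_def)
  have pw: "((\<lambda>x. F1 x powr r) has_real_derivative (r * F1 x powr (r - 1)) * F2 x) (at x)" for r x
    by (rule DERIV_chain2[OF has_real_derivative_powr[OF pos] d(1)])
  define y1 where "y1 x = (-1/2 * F1 x powr (-1/2 - 1)) * F2 x" for x
  define y2 where "y2 x = -1/2 * (((-3/2) * F1 x powr (-3/2 - 1)) * F2 x * F2 x + F1 x powr (-3/2) * F3 x)" for x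
  have y1: "((\<lambda>x. F1 x powr (-1/2)) has_real_derivative y1 x) (at x)" for x
    using pw[of "-1/2" x] by (simp add: y1_def)
  have y2: "(y1 has_real_derivative y2 x) (at x)" for x
  proof -
    have "((\<lambda>x. -1/2 * (F1 x powr (-3/2) * F2 x)) has_real_derivative y2 x) (at x)"
      unfolding y2_def by (rule DERIV_cmult[OF DERIV_cong[OF DERIV_mult[OF pw d(2)]]]) (simp add: mult_ac)
    moreover have "y1 = (\<lambda>x. -1/2 * (F1 x powr (-3/2) * F2 x))" by (rule ext) (simp add: y1_def)
    ultimately show ?thesis by simp
  qed
  have c1: "continuous_on UNIV F1" "continuous_on UNIV F2"
    using d by (meson DERIV_isCont continuous_at_imp_continuous_on)+
  have c3: "continuous_on UNIV F3" using F(1) by (simp add: Ck_on_def F3_def)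
  have "continuous_on UNIV y2" unfolding y2_def using pos
    by (intro continuous_intros c1 c3) (simp_all add: less_imp_neq[symmetric])
  moreover have "\<bar>F1 x powr (-1/2)\<bar> \<le> sqrt M" for x
  proof -
    have "F1 x powr (-1/2) = 1 / F1 x powr (1/2)" using powr_minus_divide[of "F1 x" "1/2"] by simp
    also have "\<dots> = sqrt (1 / F1 x)" using pos[of x] by (simp add: powr_half_sqrt real_sqrt_divide)
    finally have "F1 x powr (-1/2) = sqrt (1 / F1 x)" .
    then show ?thesis using bdd[of x] pos[of x] by (simp add: F1_def)
  qed
  ultimately obtain x where x: "y2 x = 0" using bounded_imp_second_derivative_zero[OF y1 y2] by blast
  have "F1 x powr (-3/2) = F1 x powr (-5/2) * F1 x"
    using powr_add[of "F1 x" "-5/2" 1] pos[of x] by simp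
  then have "0 = F1 x powr (-5/2) * (-1/2 * ((-3/2) * F2 x * F2 x + F1 x * F3 x))"
    using x by (auto simp add: y2_def algebra_simps)
  then have "(-3/2) * F2 x * F2 x + F1 x * F3 x = 0" using pos[of x] by auto
  then show thesis using that[of x] by (simp add: F1_def F2_def F3_def power2_eq_square)
qed

text \<open>
  Let \<open>\<Phi>\<close> be the expression of \<open>g\<close> at infinity, so that \<open>F x = - 1 / \<Phi> (- 1 / x)\<close> and
  \<open>1 / F' x = (x \<Phi> (- 1 / x))\<^sup>2 / \<Phi>' (- 1 / x)\<close> for large \<open>x\<close>. Since \<open>\<Phi>\<close> vanishes at the origin
  and has a positive derivative there, this stays bounded.
\<close>

lemma Diff3_fixing_infinity_has_bounded_inverse_derivative:
  assumes g: "g \<in> carrier Diff3" and inf: "g Infty = Infty"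
  defines "F \<equiv> local_rep Fin Fin g"
  shows "local_dom Fin Fin g = UNIV" "Ck_on 3 F UNIV" "\<And>x. deriv F x > 0" "\<And>x. g (Fin x) = Fin (F x)"
    "\<exists>M. \<forall>x. 1 / deriv F x \<le> M"
proof -
  have FA: "Fin \<in> atlas" "param_infty \<in> atlas" by (auto simp: atlas_cases)
  have inj: "inj g" and germ: "C3_germ g P" for P using g by (auto simp: carrier_Diff3_iff bij_is_inj)
  have "g (Fin x) \<noteq> Infty" for x using inj inf by (metis injD rp1.distinct(1))
  then have "g (Fin x) \<in> range Fin" for x by (metis rangeI rp1.exhaust)
  then show dom: "local_dom Fin Fin g = UNIV" by (auto simp: local_dom_def)
  show CF: "Ck_on 3 F UNIV" using Diff3_Ck_on[OF g FA(1) FA(1)] by (simp add: dom F_def)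
  show pos: "deriv F x > 0" for x using Diff3_orientation[OF g FA(1) FA(1)] by (simp add: dom F_def)
  show gF: "g (Fin x) = Fin (F x)" for x using chart_local_rep[of x Fin Fin g] by (simp add: dom F_def)
  obtain S \<Phi> where S: "0 \<in> S" "C3_rep g param_infty param_infty S \<Phi>"
    using C3_germ_charts[OF germ[of Infty] FA(2) FA(2), of 0 0] inf by (auto simp: param_infty_def)
  then have \<Phi>: "open S" "Ck_on 3 \<Phi> S" "\<And>s. s \<in> S \<Longrightarrow> deriv \<Phi> s > 0" "\<And>s. s \<in> S \<Longrightarrow> g (param_infty s) = param_infty (\<Phi> s)"
    by (auto simp: C3_rep_def)
  have \<Phi>0: "\<Phi> 0 = 0" using \<Phi>(4)[OF S(1)] inf by (auto simp: param_infty_def split: if_splits)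
  define \<beta> where "\<beta> = deriv \<Phi> 0"
  have \<beta>: "\<beta> > 0" using \<Phi>(3) S(1) by (simp add: \<beta>_def)
  have "continuous_on S (deriv \<Phi>)" by (rule Ck_on_3_continuous_deriv[OF \<Phi>(2)])
  then have "isCont (deriv \<Phi>) 0" using S(1) \<Phi>(1) continuous_on_eq_continuous_at by blast
  then obtain \<delta>1 where \<delta>1: "\<delta>1 > 0" "\<And>y. \<bar>y\<bar> < \<delta>1 \<Longrightarrow> \<bar>deriv \<Phi> y - \<beta>\<bar> < \<beta> / 2"
    unfolding continuous_at_eps_delta \<beta>_def[symmetric] using \<beta> by (metis diff_zero half_gt_zero dist_real_def)
  obtain \<delta>2 where \<delta>2: "\<delta>2 > 0" "ball 0 \<delta>2 \<subseteq> S" using S(1) \<Phi>(1) open_contains_ball by blast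
  define \<delta> where "\<delta> = min \<delta>1 \<delta>2 / 2"
  have \<delta>: "\<delta> > 0" using \<delta>1 \<delta>2 by (simp add: \<delta>_def)
  have near: "y \<in> S" "deriv \<Phi> y \<le> 2 * \<beta>" "deriv \<Phi> y \<ge> \<beta> / 2" if "\<bar>y\<bar> \<le> \<delta>" for y
  proof -
    have y: "\<bar>y\<bar> < \<delta>1" "\<bar>y\<bar> < \<delta>2" using that \<delta> by (auto simp: \<delta>_def)
    show "y \<in> S" using \<delta>2(2) y by (auto simp: subset_iff)
    show "deriv \<Phi> y \<le> 2 * \<beta>" "deriv \<Phi> y \<ge> \<beta> / 2" using \<delta>1(2)[OF y(1)] \<beta> by linarith+
  qed
  have \<Phi>le: "\<bar>\<Phi> y\<bar> \<le> 2 * \<beta> * \<bar>y\<bar>" if y: "\<bar>y\<bar> \<le> \<delta>" for y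
  proof -
    have c: "z \<in> cball 0 \<delta> \<Longrightarrow> norm (deriv \<Phi> z) \<le> 2 * \<beta> \<and> z \<in> S" for z
      using near[of z] \<beta> by auto
    have "norm (\<Phi> y - \<Phi> 0) \<le> 2 * \<beta> * norm (y - 0)"
      by (rule field_differentiable_bound[of "cball 0 \<delta>" \<Phi> "deriv \<Phi>"])
        (use c y \<delta> in \<open>auto intro!: has_field_derivative_at_within Ck_on_3_has_deriv[OF \<Phi>(2)]\<close>)
    then show ?thesis by (simp add: \<Phi>0)
  qed
  have far: "1 / deriv F x \<le> 8 * \<beta>" if x: "\<bar>x\<bar> > 1 / \<delta>" for x
  proof -
    have x0: "x \<noteq> 0" using x \<delta> by auto
    define U where "U = {z. \<bar>z\<bar> > 1 / \<delta>}"
    have oU: "open U" unfolding U_def by (intro open_Collect_less continuous_intros)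
    have U: "z \<noteq> 0 \<and> \<bar>- 1 / z\<bar> \<le> \<delta>" if "z \<in> U" for z
    proof -
      have "\<bar>z\<bar> > 1 / \<delta>" using that by (simp add: U_def)
      moreover have "1 / \<delta> > 0" using \<delta> by simp
      ultimately have "\<bar>z\<bar> > 0" "\<bar>z\<bar> * \<delta> > 1" using \<delta> by (auto simp: field_simps)
      then show ?thesis by (auto simp: field_simps)
    qed
    have FU: "\<Phi> (- 1 / z) \<noteq> 0 \<and> F z = - 1 / \<Phi> (- 1 / z)" if "z \<in> U" for z
    proof -
      have z: "z \<noteq> 0" "- 1 / z \<in> S" using U[OF that] near(1) by auto
      have "Fin (F z) = param_infty (\<Phi> (- 1 / z))"
        using \<Phi>(4)[OF z(2)] z(1) gF[of z] by (simp add: param_infty_def)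
      then show ?thesis by (auto simp: param_infty_def split: if_splits)
    qed
    have xU: "x \<in> U" using x by (simp add: U_def)
    let ?p = "\<Phi> (- 1 / x)"
    have d1: "((\<lambda>z. \<Phi> (- 1 / z)) has_real_derivative deriv \<Phi> (- 1 / x) * (1 / x\<^sup>2)) (at x)"
      using U[OF xU] near(1) by (intro DERIV_chain2[OF Ck_on_3_has_deriv[OF \<Phi>(2)] deriv_transition]) auto
    have d2: "((\<lambda>z. - 1 / \<Phi> (- 1 / z)) has_real_derivative (1 / ?p\<^sup>2) * (deriv \<Phi> (- 1 / x) * (1 / x\<^sup>2))) (at x)"
      using FU[OF xU] by (intro DERIV_chain2[OF deriv_transition d1]) auto
    have "(F has_real_derivative (1 / ?p\<^sup>2) * (deriv \<Phi> (- 1 / x) * (1 / x\<^sup>2))) (at x)"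
      by (rule has_field_derivative_transform_within_open[OF d2 oU xU]) (use FU in auto)
    then have "deriv F x = (1 / ?p\<^sup>2) * (deriv \<Phi> (- 1 / x) * (1 / x\<^sup>2))" by (rule DERIV_imp_deriv)
    then have "1 / deriv F x = (x * ?p)\<^sup>2 / deriv \<Phi> (- 1 / x)"
      using x0 FU[OF xU] by (simp add: power_mult_distrib)
    also have "\<dots> \<le> (2 * \<beta>)\<^sup>2 / (\<beta> / 2)"
    proof (rule frac_le)
      have "\<bar>?p\<bar> \<le> 2 * \<beta> * \<bar>- 1 / x\<bar>" using \<Phi>le U[OF xU] by blast
      then have "\<bar>x\<bar> * \<bar>?p\<bar> \<le> \<bar>x\<bar> * (2 * \<beta> * \<bar>- 1 / x\<bar>)" by (rule mult_left_mono) simp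
      then have "\<bar>x * ?p\<bar> \<le> 2 * \<beta>" using x0 by (simp add: abs_mult)
      from power_mono[OF this abs_ge_zero, of 2] show "(x * ?p)\<^sup>2 \<le> (2 * \<beta>)\<^sup>2" by simp
      show "\<beta> / 2 \<le> deriv \<Phi> (- 1 / x)" using near(3) U[OF xU] by blast
    qed (use \<beta> in auto)
    also have "\<dots> = 8 * \<beta>" using \<beta> by (simp add: field_simps power2_eq_square)
    finally show ?thesis .
  qed
  have "continuous_on {- (1 / \<delta>)..1 / \<delta>} (\<lambda>x. 1 / deriv F x)"
  proof -
    have "continuous_on {- (1 / \<delta>)..1 / \<delta>} (deriv F)"
      by (rule continuous_on_subset[OF Ck_on_3_continuous_deriv[OF CF]]) simp
    moreover have "deriv F x \<noteq> 0" for x using pos[of x] by simp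
    ultimately show ?thesis by (intro continuous_on_divide continuous_on_const) auto
  qed
  then have "compact ((\<lambda>x. 1 / deriv F x) ` {- (1 / \<delta>)..1 / \<delta>})" by (rule compact_continuous_image) simp
  then have "bounded ((\<lambda>x. 1 / deriv F x) ` {- (1 / \<delta>)..1 / \<delta>})" by (rule compact_imp_bounded)
  then obtain B where "\<forall>y\<in>(\<lambda>x. 1 / deriv F x) ` {- (1 / \<delta>)..1 / \<delta>}. norm y \<le> B" unfolding bounded_iff by blast
  then have B: "1 / deriv F x \<le> B" if "\<bar>x\<bar> \<le> 1 / \<delta>" for x
    using that by (force simp: abs_le_iff)
  have "1 / deriv F x \<le> max B (8 * \<beta>)" for x
    using B[of x] far[of x] by (cases "\<bar>x\<bar> \<le> 1 / \<delta>") auto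
  then show "\<exists>M. \<forall>x. 1 / deriv F x \<le> M" by blast
qed

text \<open>
  First move \<open>f Infty\<close> back to infinity, then find a zero \<open>x0\<close> of the Schwarzian. A translation moves
  \<open>x0\<close> to the origin, and the linear fraction that inverts the second order expansion of \<open>F\<close> at \<open>x0\<close>
  removes the first two derivatives. The vanishing of the Schwarzian is what makes the third
  derivative disappear, too.
\<close>

lemma exists_projective_normalization:
  assumes f: "f \<in> carrier Diff3"
  obtains k k' where "k \<in> PSL2" "k' \<in> PSL2" "(k \<circ> f \<circ> k') (Fin 0) = Fin 0"
    "(deriv ^^ 1) (local_rep Fin Fin (k \<circ> f \<circ> k')) 0 = 1"
    "(deriv ^^ 2) (local_rep Fin Fin (k \<circ> f \<circ> k')) 0 = 0"
    "(deriv ^^ 3) (local_rep Fin Fin (k \<circ> f \<circ> k')) 0 = 0"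
proof -
  have "\<exists>k\<in>PSL2. k (f Infty) = Infty"
  proof (cases "f Infty")
    case (Fin x)
    have "lft 0 (-1) 1 (- x) \<in> PSL2" "lft 0 (-1) 1 (- x) (Fin x) = Infty"
      by (auto intro!: lft_in_PSL2 simp: lft_def hpoint_def)
    then show ?thesis using Fin by metis
  next
    case Infty
    have "lft 1 0 0 1 \<in> PSL2" by (rule lft_in_PSL2) simp
    then show ?thesis using Infty by (metis id_apply lft_id)
  qed
  then obtain k1 where k1: "k1 \<in> PSL2" "k1 (f Infty) = Infty" by blast
  define g where "g = k1 \<circ> f"
  have g: "g \<in> carrier Diff3" "g Infty = Infty" using k1 f PSL2_subset by (auto simp: g_def intro: Diff3_compose_closed)
  define F where "F = local_rep Fin Fin g"
  note B = Diff3_fixing_infinity_has_bounded_inverse_derivative[OF g, folded F_def]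
  obtain M where "\<And>x. 1 / deriv F x \<le> M" using B(5) by blast
  then obtain x0 where x0: "2 * deriv F x0 * (deriv ^^ 3) F x0 = 3 * ((deriv ^^ 2) F x0)\<^sup>2"
    using schwarzian_zero_of_bounded[OF B(2,3)] by blast
  define a b c d where "a = F x0" and "b = deriv F x0" and "c = (deriv ^^ 2) F x0" and "d = (deriv ^^ 3) F x0"
  have b: "b > 0" using B(3) by (simp add: b_def)
  have bcd: "2 * b * d = 3 * c\<^sup>2" using x0 by (simp add: b_def c_def d_def)
  \<comment> \<open>The transformation \<open>z \<mapsto> (z - a) / (b + e (z - a))\<close> sends \<open>a + b x + (c / 2) x\<^sup>2\<close> to
    \<open>x + O(x\<^sup>3)\<close> for this value of \<open>e\<close>. Its determinant is \<open>b\<close>, whence the factor \<open>1 / s\<close> below.\<close>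
  define e where "e = c / (2 * b)"
  define s where "s = sqrt b"
  have s: "s \<noteq> 0" "s * s = b" using b by (auto simp: s_def)
  define m where "m = lft (1/s) (- a/s) (e/s) ((b - e * a)/s)"
  have "(1/s) * ((b - e * a)/s) - (- a/s) * (e/s) = b / (s * s)" using s(1) by (simp add: field_simps)
  then have m: "m \<in> PSL2" unfolding m_def using s b by (intro lft_in_PSL2) simp
  define t where "t = lft 1 x0 0 1"
  have t: "t \<in> PSL2" "\<And>x. t (Fin x) = Fin (x + x0)" by (auto simp: t_def lft_def hpoint_def intro!: lft_in_PSL2)
  define D where "D x = b + e * (F (x + x0) - a)" for x
  have h: "((m \<circ> k1) \<circ> f \<circ> t) (Fin x) = Fin ((F (x + x0) - a) / D x)" if "D x \<noteq> 0" for x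
  proof -
    have "((m \<circ> k1) \<circ> f \<circ> t) (Fin x) = m (Fin (F (x + x0)))" using B(4) by (simp add: t g_def[symmetric]) (simp add: g_def)
    also have "\<dots> = hpoint ((1/s) * (F (x + x0) - a)) ((1/s) * D x)"
      by (simp add: m_def lft_def D_def) (simp add: algebra_simps diff_divide_distrib add_divide_distrib)
    also have "\<dots> = Fin ((F (x + x0) - a) / D x)" using s(1) that by (subst hpoint_scale) (auto simp: hpoint_def)
    finally show ?thesis .
  qed
  have F1: "((\<lambda>x. F (x + x0)) has_real_derivative deriv F (x + x0)) (at x)"
    "((\<lambda>x. deriv F (x + x0)) has_real_derivative (deriv ^^ 2) F (x + x0)) (at x)"
    "((\<lambda>x. (deriv ^^ 2) F (x + x0)) has_real_derivative (deriv ^^ 3) F (x + x0)) (at x)" for x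
    using Ck_on_3D[OF B(2) UNIV_I, of "x + x0"] by (simp_all add: DERIV_shift)
  define S where "S = {x. D x \<noteq> 0}"
  have cD: "continuous_on UNIV D" unfolding D_def
    using DERIV_isCont[OF F1(1)] by (intro continuous_intros continuous_at_imp_continuous_on) auto
  have S: "open S" "0 \<in> S" using b unfolding S_def
    by (auto intro!: open_Collect_neq cD continuous_intros) (simp add: D_def a_def)
  let ?I = "\<lambda>x. inverse (D x)"
  have dI: "(?I has_real_derivative - (e * deriv F (x + x0) * ?I x * ?I x)) (at x)" if "x \<in> S" for x
    unfolding D_def by (rule derivative_eq_intros F1 refl | use that in \<open>simp add: S_def D_def\<close>)+
  let ?G = "\<lambda>x. (F (x + x0) - a) * ?I x"
  let ?G1 = "\<lambda>x. b * (deriv F (x + x0) * (?I x * ?I x))"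
  let ?G2 = "\<lambda>x. b * ((deriv ^^ 2) F (x + x0) * (?I x * ?I x) - 2 * e * (deriv F (x + x0) * deriv F (x + x0)) * (?I x * ?I x * ?I x))"
  let ?G3 = "\<lambda>x. b * ((deriv ^^ 3) F (x + x0) * (?I x * ?I x) - 6 * e * (deriv F (x + x0) * (deriv ^^ 2) F (x + x0)) * (?I x * ?I x * ?I x)
      + 6 * e * e * (deriv F (x + x0) * deriv F (x + x0) * deriv F (x + x0)) * (?I x * ?I x * ?I x * ?I x))"
  have e1: "(?G has_real_derivative ?G1 x) (at x)" if x: "x \<in> S" for x
  proof -
    have "(?G has_real_derivative (deriv F (x + x0) * ?I x + (F (x + x0) - a) * - (e * deriv F (x + x0) * ?I x * ?I x))) (at x)"
      by (rule derivative_eq_intros F1 dI x refl)+ simp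
    moreover have "deriv F (x + x0) * ?I x = deriv F (x + x0) * D x * (?I x * ?I x)" using x by (simp add: S_def)
    ultimately show ?thesis by (simp add: D_def algebra_simps)
  qed
  have e2: "(?G1 has_real_derivative ?G2 x) (at x)" if x: "x \<in> S" for x
    by (rule derivative_eq_intros F1 dI x refl)+ (simp add: algebra_simps)
  have e3: "(?G2 has_real_derivative ?G3 x) (at x)" if x: "x \<in> S" for x
    by (rule derivative_eq_intros F1 dI x refl)+ (simp add: algebra_simps)
  have lr: "local_rep Fin Fin (m \<circ> k1 \<circ> f \<circ> t) x = ?G x" if "x \<in> S" for x
    using h[of x] that by (simp add: local_rep_def S_def atlas_cases divide_inverse del: o_apply)
  have dl: "(deriv ^^ i) (local_rep Fin Fin (m \<circ> k1 \<circ> f \<circ> t)) 0 = (deriv ^^ i) ?G 0" for i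
    by (rule deriv_funpow_cong[OF S(1) lr S(2)])
  have D0: "D 0 = b" by (simp add: D_def a_def)
  have G: "(deriv ^^ 1) ?G 0 = ?G1 0" "(deriv ^^ 2) ?G 0 = ?G2 0" "(deriv ^^ 3) ?G 0 = ?G3 0"
    by (rule deriv_funpow_3[OF S(1) _ _ _ S(2), where ?f1.0 = ?G1 and ?f2.0 = ?G2 and ?f3.0 = ?G3];
        (rule e1 e2 e3; assumption))+
  show thesis
  proof (rule that[of "m \<circ> k1" t])
    show "(m \<circ> k1 \<circ> f \<circ> t) (Fin 0) = Fin 0" using h[of 0] b by (simp add: D0 a_def)
    show "(deriv ^^ 1) (local_rep Fin Fin (m \<circ> k1 \<circ> f \<circ> t)) 0 = 1"
      unfolding dl G using b by (simp add: D0 b_def[symmetric] field_simps)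
    show "(deriv ^^ 2) (local_rep Fin Fin (m \<circ> k1 \<circ> f \<circ> t)) 0 = 0"
      unfolding dl G using b by (simp add: D0 b_def[symmetric] c_def[symmetric] e_def field_simps)
    have "d = 3 * c\<^sup>2 / (2 * b)" using bcd b by (simp add: field_simps)
    then show "(deriv ^^ 3) (local_rep Fin Fin (m \<circ> k1 \<circ> f \<circ> t)) 0 = 0"
      unfolding dl G using b by (simp add: D0 b_def[symmetric] c_def[symmetric] d_def[symmetric] e_def field_simps power2_eq_square)
  qed (use m k1 t PSL2_compose in auto)
qed

section \<open>Cutting off a flat function\<close>

text \<open>
  The value is \<open>1\<close> for \<open>\<bar>x\<bar> \<le> 1/2\<close> and \<open>0\<close> for \<open>\<bar>x\<bar> \<ge> 1\<close>. The exponent \<open>4\<close> provides three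
  continuous derivatives.
\<close>

definition bump :: "real \<Rightarrow> real" where
  "bump x = max 0 (1 - x\<^sup>2) ^ 4 / (max 0 (x\<^sup>2 - 1/4) ^ 4 + max 0 (1 - x\<^sup>2) ^ 4)"

lemma bump_denominator_pos: "max 0 (x\<^sup>2 - 1/4) ^ 4 + max 0 (1 - x\<^sup>2) ^ 4 > (0::real)"
proof (cases "x\<^sup>2 > 1/4")
  case True
  then show ?thesis by (intro add_pos_nonneg) auto
next
  case False
  then show ?thesis by (intro add_nonneg_pos) auto
qed

lemma bump_eq_1: "\<bar>x\<bar> \<le> 1/2 \<Longrightarrow> bump x = 1"
proof -
  assume "\<bar>x\<bar> \<le> 1/2"
  then have "\<bar>x\<bar>\<^sup>2 \<le> (1/2)\<^sup>2" by (rule power_mono) simp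
  then have "max 0 (x\<^sup>2 - 1/4) = 0" by (simp add: power2_eq_square)
  then show ?thesis using bump_denominator_pos[of x] by (simp add: bump_def)
qed

lemma bump_eq_0: "\<bar>x\<bar> \<ge> 1 \<Longrightarrow> bump x = 0"
proof -
  assume "\<bar>x\<bar> \<ge> 1"
  then have "1\<^sup>2 \<le> \<bar>x\<bar>\<^sup>2" by (rule power_mono) simp
  then have "max 0 (1 - x\<^sup>2) = 0" by simp
  then show ?thesis by (simp add: bump_def)
qed

lemma Ck_on_bump: "Ck_on 3 bump UNIV"
proof -
  have m: "Ck_on 3 (\<lambda>x. max 0 (h x) ^ 4) UNIV" if "Ck_on 3 h UNIV" for h :: "real \<Rightarrow> real"
    using Ck_on_compose[OF open_UNIV open_UNIV _ that Ck_on_max_power[of 3]] by simp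
  have "Ck_on 3 (\<lambda>x. max 0 (1 - x\<^sup>2) ^ 4 / (max 0 (x\<^sup>2 - 1/4) ^ 4 + max 0 (1 - x\<^sup>2) ^ 4)) UNIV"
    by (intro Ck_on_divide Ck_on_add m Ck_on_diff Ck_on_power Ck_on_ident Ck_on_const open_UNIV)
      (use bump_denominator_pos in \<open>auto simp: less_imp_neq[symmetric]\<close>)
  then show ?thesis by (subst bump_def[abs_def])
qed

lemma deriv_zero_growth:
  fixes f :: "real \<Rightarrow> real"
  assumes "\<And>x. \<bar>x\<bar> < \<delta> \<Longrightarrow> (f has_real_derivative f' x) (at x)" "f 0 = 0"
    and "\<And>x. \<bar>x\<bar> < \<delta> \<Longrightarrow> \<bar>f' x\<bar> \<le> K * \<bar>x\<bar> ^ j" and x: "\<bar>x\<bar> < \<delta>"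
  shows "\<bar>f x\<bar> \<le> K * \<bar>x\<bar> ^ Suc j"
proof (cases "x = 0")
  case False
  have "\<bar>f' x\<bar> \<le> K * \<bar>x\<bar> ^ j" by (rule assms(3)[OF x])
  then have "0 \<le> K * \<bar>x\<bar> ^ j" by linarith
  then have "0 * \<bar>x\<bar> ^ j \<le> K * \<bar>x\<bar> ^ j" by simp
  then have K: "K \<ge> 0" by (rule mult_right_le_imp_le) (use False in simp)
  have bd: "norm (f' z) \<le> K * \<bar>x\<bar> ^ j" if "z \<in> cball 0 \<bar>x\<bar>" for z
  proof -
    have "\<bar>z\<bar> \<le> \<bar>x\<bar>" using that by simp
    then have "\<bar>z\<bar> ^ j \<le> \<bar>x\<bar> ^ j" by (rule power_mono) simp
    then show ?thesis using assms(3)[of z] \<open>\<bar>z\<bar> \<le> \<bar>x\<bar>\<close> x K mult_left_mono[of "\<bar>z\<bar> ^ j" "\<bar>x\<bar> ^ j" K] by fastforce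
  qed
  have "norm (f x - f 0) \<le> K * \<bar>x\<bar> ^ j * norm (x - 0)"
    by (rule field_differentiable_bound[of "cball 0 \<bar>x\<bar>" f f'])
      (use bd x in \<open>auto intro!: has_field_derivative_at_within assms(1)\<close>)
  then show ?thesis using assms(2) by (simp add: mult_ac)
qed (simp add: assms(2))

text \<open>
  The product of \<open>r\<close> with a cutoff to the interval of radius \<open>1 / m\<close>, where \<open>m = n + 1\<close>, is small in
  \<open>C\<^sup>3\<close>. Each derivative that falls on the cutoff costs a factor \<open>m\<close>, but one derivative fewer then
  falls on \<open>r\<close>, which gains a factor \<open>\<bar>x\<bar> \<le> 1 / m\<close>: if the third derivative of \<open>r\<close> is at most
  \<open>\<theta>\<close>, its derivative of order \<open>3 - j\<close> is at most \<open>\<theta> \<bar>x\<bar>\<^sup>j\<close>.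
\<close>

lemma flat_cutoff:
  fixes r :: "real \<Rightarrow> real"
  assumes S: "open S" "0 \<in> S" and r: "Ck_on 3 r S"
    and z: "r 0 = 0" "deriv r 0 = 0" "(deriv ^^ 2) r 0 = 0" "(deriv ^^ 3) r 0 = 0"
  defines "q \<equiv> \<lambda>n x. r x * bump (real (Suc n) * x)"
  shows "Ck_on 3 (q n) S"
    and "\<eta> > 0 \<Longrightarrow> \<forall>\<^sub>F n in sequentially. \<forall>x\<in>S. \<forall>i\<le>3. \<bar>(deriv ^^ i) (q n) x\<bar> \<le> \<eta>"
proof -
  have bm: "Ck_on 3 (\<lambda>x. bump (real (Suc n) * x)) S" for n
    by (rule Ck_on_compose[OF S(1) open_UNIV UNIV_I Ck_on_cmult[OF S(1) Ck_on_ident[OF S(1)]] Ck_on_bump])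
  show qC: "Ck_on 3 (q n) S" for n unfolding q_def by (intro Ck_on_mult S r bm)
  assume \<eta>: "\<eta> > 0"
  define B where "B i = (deriv ^^ i) bump" for i
  have ex: "\<exists>C. \<forall>x. \<bar>x\<bar> \<le> 1 \<longrightarrow> \<bar>B i x\<bar> \<le> C" if "i \<le> 3" for i
  proof -
    have "continuous_on UNIV (B i)" using Ck_on_bump that by (auto simp: Ck_on_def B_def)
    then have "continuous_on {-1..1} (B i)" by (rule continuous_on_subset) simp
    then have "compact (B i ` {-1..1})" by (rule compact_continuous_image) simp
    then have "bounded (B i ` {-1..1})" by (rule compact_imp_bounded)
    then obtain C where "\<forall>y\<in>B i ` {-1..1}. norm y \<le> C" unfolding bounded_iff by blast
    then have "\<bar>B i x\<bar> \<le> C" if "\<bar>x\<bar> \<le> 1" for x using that by (force simp: abs_le_iff)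
    then show ?thesis by blast
  qed
  obtain C0 where C0: "\<And>x. \<bar>x\<bar> \<le> 1 \<Longrightarrow> \<bar>B 0 x\<bar> \<le> C0" using ex[of 0] by auto
  obtain C1 where C1: "\<And>x. \<bar>x\<bar> \<le> 1 \<Longrightarrow> \<bar>B 1 x\<bar> \<le> C1" using ex[of 1] by auto
  obtain C2 where C2: "\<And>x. \<bar>x\<bar> \<le> 1 \<Longrightarrow> \<bar>B 2 x\<bar> \<le> C2" using ex[of 2] by auto
  obtain C3 where C3: "\<And>x. \<bar>x\<bar> \<le> 1 \<Longrightarrow> \<bar>B 3 x\<bar> \<le> C3" using ex[of 3] by auto
  define C where "C = max (max C0 C1) (max C2 C3)"
  have C: "\<bar>B 0 x\<bar> \<le> C" "\<bar>B 1 x\<bar> \<le> C" "\<bar>B 2 x\<bar> \<le> C" "\<bar>B 3 x\<bar> \<le> C" if "\<bar>x\<bar> \<le> 1" for x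
    using C0[OF that] C1[OF that] C2[OF that] C3[OF that] by (auto simp: C_def)
  have C_nonneg: "C \<ge> 0" using C(1)[of 0] by simp
  \<comment> \<open>The Leibniz formula for the third derivative has coefficients \<open>1, 3, 3, 1\<close> with sum \<open>8\<close>.\<close>
  define \<theta> where "\<theta> = \<eta> / (8 * (C + 1))"
  have \<theta>: "\<theta> > 0" "8 * C * \<theta> \<le> \<eta>" using \<eta> C_nonneg by (auto simp: \<theta>_def field_simps)
  have B: "(B 0 has_real_derivative B 1 x) (at x)" "(B 1 has_real_derivative B 2 x) (at x)" "(B 2 has_real_derivative B 3 x) (at x)" for x
    using Ck_on_3D[OF Ck_on_bump UNIV_I, of x] by (simp_all add: B_def)
  define r1 r2 r3 where "r1 = deriv r" and "r2 = (deriv ^^ 2) r" and "r3 = (deriv ^^ 3) r"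
  have R: "(r has_real_derivative r1 x) (at x)" "(r1 has_real_derivative r2 x) (at x)" "(r2 has_real_derivative r3 x) (at x)" if "x \<in> S" for x
    using Ck_on_3D[OF r that] by (simp_all add: r1_def r2_def r3_def)
  have "continuous_on S r3" using r by (simp add: Ck_on_def r3_def)
  then have "isCont r3 0" using S continuous_on_eq_continuous_at by blast
  then obtain \<delta>1 where \<delta>1: "\<delta>1 > 0" "\<And>y. \<bar>y\<bar> < \<delta>1 \<Longrightarrow> \<bar>r3 y\<bar> < \<theta>"
    unfolding continuous_at_eps_delta using \<theta>(1) z(4) by (metis diff_zero dist_real_def r3_def)
  obtain \<delta>2 where \<delta>2: "\<delta>2 > 0" "ball 0 \<delta>2 \<subseteq> S" using S open_contains_ball by blast
  define \<delta> where "\<delta> = min \<delta>1 \<delta>2"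
  have \<delta>: "\<delta> > 0" and inS: "x \<in> S" if "\<bar>x\<bar> < \<delta>" for x using \<delta>1 \<delta>2 that by (auto simp: \<delta>_def subset_iff)
  have \<delta>0: "\<delta> > 0" using \<delta>1 \<delta>2 by (auto simp: \<delta>_def)
  have b3: "\<bar>r3 x\<bar> \<le> \<theta> * \<bar>x\<bar> ^ 0" if "\<bar>x\<bar> < \<delta>" for x using \<delta>1(2)[of x] that by (simp add: \<delta>_def)
  have b2: "\<bar>r2 x\<bar> \<le> \<theta> * \<bar>x\<bar> ^ 1" if "\<bar>x\<bar> < \<delta>" for x
    using deriv_zero_growth[of \<delta> r2 r3 \<theta> 0 x] R(3) inS b3 z(3) that by (simp add: r2_def)
  have b1: "\<bar>r1 x\<bar> \<le> \<theta> * \<bar>x\<bar> ^ 2" if "\<bar>x\<bar> < \<delta>" for x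
    using deriv_zero_growth[of \<delta> r1 r2 \<theta> 1 x] R(2) inS b2 z(2) that by (simp add: r1_def numeral_2_eq_2)
  have b0: "\<bar>r x\<bar> \<le> \<theta> * \<bar>x\<bar> ^ 3" if "\<bar>x\<bar> < \<delta>" for x
    using deriv_zero_growth[of \<delta> r r1 \<theta> 2 x] R(1) inS b1 z(1) that by (simp add: numeral_3_eq_3 numeral_2_eq_2)
  obtain N where N: "1 / \<delta> < real N" using reals_Archimedean2 by blast
  show "\<forall>\<^sub>F n in sequentially. \<forall>x\<in>S. \<forall>i\<le>3. \<bar>(deriv ^^ i) (q n) x\<bar> \<le> \<eta>"
  proof (rule eventually_sequentiallyI[of N], intro ballI allI impI)
    fix n x and i :: nat assume n: "n \<ge> N" and x: "x \<in> S" and i: "i \<le> 3"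
    define m where "m = real (Suc n)"
    have m: "m \<ge> 1" "1 / \<delta> < m" using N n by (auto simp: m_def)
    show "\<bar>(deriv ^^ i) (q n) x\<bar> \<le> \<eta>"
    proof (cases "m * \<bar>x\<bar> > 1")
      case True
      have "open {x. m * \<bar>x\<bar> > 1}" by (intro open_Collect_less continuous_intros)
      then have "(deriv ^^ i) (q n) x = (deriv ^^ i) (\<lambda>x. 0) x"
      proof (rule deriv_funpow_cong)
        fix y assume "y \<in> {x. m * \<bar>x\<bar> > 1}"
        then have "\<bar>m * y\<bar> \<ge> 1" using m by (simp add: abs_mult)
        then show "q n y = 0" using bump_eq_0 by (simp add: q_def m_def)
      qed (use True in simp)
      also have "(deriv ^^ i) (\<lambda>x. 0 :: real) = (\<lambda>x. 0)" by (induction i) auto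
      finally show ?thesis using \<eta> by simp
    next
      case False
      then have mx: "\<bar>m * x\<bar> \<le> 1" "m * \<bar>x\<bar> \<le> 1" using m by (auto simp: abs_mult)
      have "1 < m * \<delta>" using m(2) \<delta>0 by (simp add: field_simps)
      then have "m * \<bar>x\<bar> < m * \<delta>" using mx by linarith
      then have xd: "\<bar>x\<bar> < \<delta>" using m by simp
      define t where "t = \<bar>x\<bar>"
      have t: "0 \<le> t" "t \<le> 1" using mx m mult_right_mono[OF m(1), of "\<bar>x\<bar>"] by (auto simp: t_def)
      define w where "w = m * t"
      have w: "0 \<le> w" "w \<le> 1" using mx m t by (auto simp: w_def t_def)
      have d: "((\<lambda>x. B j (m * x)) has_real_derivative B (Suc j) (m * x) * m) (at x)" if "j < 3" for j x
      proof -
        have "(B j has_real_derivative B (Suc j) y) (at y)" for y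
          using Ck_on_has_deriv_funpow[OF Ck_on_bump that, of y] by (simp add: B_def)
        then show ?thesis by (rule DERIV_chain2) (auto intro!: derivative_eq_intros)
      qed
      have d0: "((\<lambda>x. B 0 (m * x)) has_real_derivative B 1 (m * x) * m) (at x)"
        and d1: "((\<lambda>x. B 1 (m * x)) has_real_derivative B 2 (m * x) * m) (at x)"
        and d2: "((\<lambda>x. B 2 (m * x)) has_real_derivative B 3 (m * x) * m) (at x)" for x
        using d[of 0 x] d[of 1 x] d[of 2 x] by (simp_all add: numeral_3_eq_3 numeral_2_eq_2)
      let ?q0 = "\<lambda>x. r x * B 0 (m * x)"
      let ?q1 = "\<lambda>x. r1 x * B 0 (m * x) + m * (r x * B 1 (m * x))"
      let ?q2 = "\<lambda>x. r2 x * B 0 (m * x) + 2 * (m * (r1 x * B 1 (m * x))) + m * m * (r x * B 2 (m * x))"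
      let ?q3 = "\<lambda>x. r3 x * B 0 (m * x) + 3 * (m * (r2 x * B 1 (m * x))) + 3 * (m * m * (r1 x * B 2 (m * x))) + m * m * m * (r x * B 3 (m * x))"
      have e0: "q n = ?q0" by (simp add: q_def B_def m_def)
      have e1: "(?q0 has_real_derivative ?q1 x) (at x)" if "x \<in> S" for x
        by (rule derivative_eq_intros R d0 that refl)+ (simp add: algebra_simps)
      have e2: "(?q1 has_real_derivative ?q2 x) (at x)" if "x \<in> S" for x
        by (rule derivative_eq_intros R d0 d1 that refl)+ (simp add: algebra_simps)
      have e3: "(?q2 has_real_derivative ?q3 x) (at x)" if "x \<in> S" for x
        by (rule derivative_eq_intros R d0 d1 d2 that refl)+ (simp add: algebra_simps)
      have G: "(deriv ^^ 1) ?q0 x = ?q1 x" "(deriv ^^ 2) ?q0 x = ?q2 x" "(deriv ^^ 3) ?q0 x = ?q3 x"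
        by (rule deriv_funpow_3[OF S(1) _ _ _ x, where ?f1.0 = ?q1 and ?f2.0 = ?q2 and ?f3.0 = ?q3];
          (rule e1 e2 e3; assumption))+
      have term_le: "\<bar>m ^ k * (a * b)\<bar> \<le> \<theta> * C" if "\<bar>a\<bar> \<le> \<theta> * t ^ l" "\<bar>b\<bar> \<le> C" "k \<le> l" for a b k l
      proof -
        have "m ^ k * t ^ l = w ^ k * t ^ (l - k)" using that(3)
          by (simp add: w_def power_mult_distrib power_add[symmetric])
        also have "\<dots> \<le> 1 * 1" using w t by (intro mult_mono power_le_one) auto
        finally have 1: "m ^ k * t ^ l \<le> 1" by simp
        have "\<bar>m ^ k * (a * b)\<bar> = m ^ k * (\<bar>a\<bar> * \<bar>b\<bar>)" using m by (simp add: abs_mult)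
        also have "\<dots> \<le> m ^ k * ((\<theta> * t ^ l) * C)"
          using that m t \<theta> by (intro mult_left_mono mult_mono) auto
        also have "\<dots> = (m ^ k * t ^ l) * (\<theta> * C)" by (simp add: mult_ac)
        also have "\<dots> \<le> 1 * (\<theta> * C)" using 1 \<theta> C_nonneg by (intro mult_right_mono) auto
        finally show ?thesis by simp
      qed
      note bs = b0[OF xd, folded t_def] b1[OF xd, folded t_def] b2[OF xd, folded t_def] b3[OF xd, folded t_def]
      note Cx = C[OF mx(1)]
      have T0: "\<bar>r x * B 0 (m * x)\<bar> \<le> \<theta> * C" using term_le[OF bs(1) Cx(1), of 0] by (simp add: eval_nat_numeral mult.assoc)
      have T1: "\<bar>r1 x * B 0 (m * x)\<bar> \<le> \<theta> * C" using term_le[OF bs(2) Cx(1), of 0] by (simp add: eval_nat_numeral mult.assoc)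
      have T2: "\<bar>m * (r x * B 1 (m * x))\<bar> \<le> \<theta> * C" using term_le[OF bs(1) Cx(2), of 1] by (simp add: eval_nat_numeral mult.assoc)
      have T3: "\<bar>r2 x * B 0 (m * x)\<bar> \<le> \<theta> * C" using term_le[OF bs(3) Cx(1), of 0] by (simp add: eval_nat_numeral mult.assoc)
      have T4: "\<bar>m * (r1 x * B 1 (m * x))\<bar> \<le> \<theta> * C" using term_le[OF bs(2) Cx(2), of 1] by (simp add: eval_nat_numeral mult.assoc)
      have T5: "\<bar>m * m * (r x * B 2 (m * x))\<bar> \<le> \<theta> * C" using term_le[OF bs(1) Cx(3), of 2] by (simp add: eval_nat_numeral mult.assoc)
      have T6: "\<bar>r3 x * B 0 (m * x)\<bar> \<le> \<theta> * C" using term_le[OF bs(4) Cx(1), of 0] by (simp add: eval_nat_numeral mult.assoc)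
      have T7: "\<bar>m * (r2 x * B 1 (m * x))\<bar> \<le> \<theta> * C" using term_le[OF bs(3) Cx(2), of 1] by (simp add: eval_nat_numeral mult.assoc)
      have T8: "\<bar>m * m * (r1 x * B 2 (m * x))\<bar> \<le> \<theta> * C" using term_le[OF bs(2) Cx(3), of 2] by (simp add: eval_nat_numeral mult.assoc)
      have T9: "\<bar>m * m * m * (r x * B 3 (m * x))\<bar> \<le> \<theta> * C" using term_le[OF bs(1) Cx(4), of 3] by (simp add: eval_nat_numeral mult.assoc)
      note T = T0 T1 T2 T3 T4 T5 T6 T7 T8 T9
      have \<theta>C: "0 \<le> \<theta> * C" "8 * (\<theta> * C) \<le> \<eta>" using \<theta> C_nonneg by (auto simp: mult_ac)
      have "i = 0 \<or> i = 1 \<or> i = 2 \<or> i = 3" using i by linarith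
      then show ?thesis
      proof (elim disjE)
        assume "i = 0" then show ?thesis using T(1) \<theta>C by (simp add: e0)
      next
        assume i: "i = 1" show ?thesis unfolding e0 i G(1) using T(2,3) \<theta>C by linarith
      next
        assume i: "i = 2" show ?thesis unfolding e0 i G(2) using T(4-6) \<theta>C by linarith
      next
        assume i: "i = 3" show ?thesis unfolding e0 i G(3) using T(7-10) \<theta>C by linarith
      qed
    qed
  qed
qed

section \<open>Approximation by diffeomorphisms that are trivial on an arc\<close>

lemma local_rep_agree:
  assumes "open U" "\<And>P. P \<in> U \<Longrightarrow> f P = g P" "p \<in> atlas" "p x \<in> U"
  shows "x \<in> local_dom p q f \<longleftrightarrow> x \<in> local_dom p q g"
    "(deriv ^^ i) (local_rep p q f) x = (deriv ^^ i) (local_rep p q g) x"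
proof -
  show "x \<in> local_dom p q f \<longleftrightarrow> x \<in> local_dom p q g" using assms(2)[OF assms(4)] by (simp add: local_dom_def)
  show "(deriv ^^ i) (local_rep p q f) x = (deriv ^^ i) (local_rep p q g) x"
    by (rule deriv_funpow_cong[OF open_chart_vimage[OF assms(3,1)]]) (use assms(2,4) in \<open>auto simp: local_rep_def\<close>)
qed

lemma open_compl_arc:
  assumes "e > 0" shows "open (- Fin ` {-e..e})"
  unfolding open_rp1_def
proof
  fix p assume "p \<in> atlas"
  then consider "p = Fin" | "p = param_infty" by (auto simp: atlas_cases)
  then show "open (p -` (- Fin ` {-e..e}))"
  proof cases
    case 1
    have "Fin -` (- Fin ` {-e..e}) = - {-e..e}" by auto
    then show ?thesis unfolding 1 by (simp add: open_Compl)
  next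
    case 2
    have "y \<in> param_infty -` (- Fin ` {-e..e}) \<longleftrightarrow> e * \<bar>y\<bar> < 1" for y
    proof (cases "y = 0")
      case True
      then show ?thesis by (auto simp: param_infty_def)
    next
      case False
      have "param_infty y \<in> Fin ` {-e..e} \<longleftrightarrow> \<bar>- 1 / y\<bar> \<le> e"
      proof -
        have "param_infty y = Fin (- 1 / y)" using False by (simp add: param_infty_def)
        moreover have "Fin z \<in> Fin ` A \<longleftrightarrow> z \<in> A" for z A by auto
        ultimately show ?thesis by (simp only: atLeastAtMost_iff abs_le_iff) linarith
      qed
      also have "\<dots> \<longleftrightarrow> 1 \<le> e * \<bar>y\<bar>" using False by (simp add: field_simps)
      finally show ?thesis by auto
    qed
    then have "param_infty -` (- Fin ` {-e..e}) = {y. e * \<bar>y\<bar> < 1}" by blast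
    moreover have "open {y. e * \<bar>y\<bar> < (1::real)}" by (intro open_Collect_less continuous_intros)
    ultimately show ?thesis unfolding 2 by simp
  qed
qed

lemma increasing_image_interval:
  fixes h :: "real \<Rightarrow> real"
  assumes "a \<le> b" "\<And>x. x \<in> {a..b} \<Longrightarrow> (h has_real_derivative h' x) (at x)" "\<And>x. x \<in> {a..b} \<Longrightarrow> h' x > 0"
  shows "inj_on h {a..b}" "h ` {a..b} = {h a..h b}"
proof -
  have lt: "h x < h y" if "x \<in> {a..b}" "y \<in> {a..b}" "x < y" for x y
    by (rule deriv_pos_imp_less[of x y h h']) (use that assms(2,3) in auto)
  show "inj_on h {a..b}"
  proof (rule inj_onI)
    fix x y assume "x \<in> {a..b}" "y \<in> {a..b}" "h x = h y"
    then show "x = y" using lt[of x y] lt[of y x] by (cases x y rule: linorder_cases) auto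
  qed
  have cont: "continuous_on {a..b} h" using assms(2) by (meson DERIV_isCont continuous_at_imp_continuous_on)
  show "h ` {a..b} = {h a..h b}"
  proof (intro equalityI subsetI)
    fix y assume "y \<in> h ` {a..b}"
    then obtain x where x: "x \<in> {a..b}" "y = h x" by blast
    then show "y \<in> {h a..h b}" using lt[of a x] lt[of x b] assms(1) by (cases "x = a"; cases "x = b") auto
  next
    fix y assume "y \<in> {h a..h b}"
    then show "y \<in> h ` {a..b}" using IVT'[of h a y b] assms(1) cont by auto
  qed
qed

lemma Ck_on_deriv_funpow_diff:
  assumes "open S" "Ck_on k f S" "Ck_on k g S"
  shows "i \<le> k \<Longrightarrow> x \<in> S \<Longrightarrow> (deriv ^^ i) (\<lambda>x. f x - g x) x = (deriv ^^ i) f x - (deriv ^^ i) g x"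
proof (induction i arbitrary: x)
  case (Suc i)
  have "\<forall>\<^sub>F y in nhds x. (deriv ^^ i) (\<lambda>x. f x - g x) y = (deriv ^^ i) f y - (deriv ^^ i) g y"
    using eventually_nhds_in_open[OF assms(1) Suc.prems(2)] by eventually_elim (use Suc in auto)
  then have "(deriv ^^ Suc i) (\<lambda>x. f x - g x) x = deriv (\<lambda>y. (deriv ^^ i) f y - (deriv ^^ i) g y) x"
    by (simp add: deriv_cong_ev)
  also have "\<dots> = (deriv ^^ Suc i) f x - (deriv ^^ Suc i) g x"
    using Suc.prems by (intro DERIV_imp_deriv DERIV_diff Ck_on_has_deriv_funpow[OF assms(2)] Ck_on_has_deriv_funpow[OF assms(3)]) auto
  finally show ?case .
qed simp

text \<open>
  Near the origin \<open>g x = x + r x\<close> with \<open>r\<close> flat of order three. Removing \<open>r\<close> by means of the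
  cutoff function leaves the identity on a small arc. The result is still increasing because the change is small in
  \<open>C\<^sup>1\<close>, it is bijective because the endpoints of the modified interval keep their images, and it
  converges to \<open>g\<close> because the change is small in \<open>C\<^sup>3\<close>.
\<close>

lemma approximation_by_locally_trivial:
  assumes g: "g \<in> carrier Diff3" and g0: "g (Fin 0) = Fin 0"
    and jet: "(deriv ^^ 1) (local_rep Fin Fin g) 0 = 1" "(deriv ^^ 2) (local_rep Fin Fin g) 0 = 0"
      "(deriv ^^ 3) (local_rep Fin Fin g) 0 = 0"
  obtains F where "\<And>n. F n \<in> carrier Diff3" "\<And>n. \<exists>\<delta>>0. \<forall>x. \<bar>x\<bar> < \<delta> \<longrightarrow> F n (Fin x) = Fin x"
    "limitin C3_topology F g sequentially"
proof -
  have FA: "Fin \<in> atlas" "param_infty \<in> atlas" by (auto simp: atlas_cases)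
  define S where "S = local_dom Fin Fin g"
  define G where "G = local_rep Fin Fin g"
  have S: "open S" "0 \<in> S" using open_local_dom[OF g FA(1) FA(1)] g0 by (auto simp: S_def local_dom_def)
  have GC: "Ck_on 3 G S" using Diff3_Ck_on[OF g FA(1) FA(1)] by (simp add: S_def G_def)
  have gG: "g (Fin x) = Fin (G x)" if "x \<in> S" for x
    using chart_local_rep[of x Fin Fin g] that by (simp add: S_def G_def)
  have G0: "G 0 = 0" using gG[OF S(2)] g0 by simp
  define r where "r x = G x - x" for x
  have rC: "Ck_on 3 r S" unfolding r_def by (intro Ck_on_diff GC Ck_on_ident S)
  have Gd: "(G has_real_derivative deriv G x) (at x)" "(deriv G has_real_derivative (deriv ^^ 2) G x) (at x)"
    "((deriv ^^ 2) G has_real_derivative (deriv ^^ 3) G x) (at x)" if "x \<in> S" for x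
    using Ck_on_3D[OF GC that] .
  have rd: "(deriv ^^ 1) r 0 = deriv G 0 - 1" "(deriv ^^ 2) r 0 = (deriv ^^ 2) G 0" "(deriv ^^ 3) r 0 = (deriv ^^ 3) G 0"
  proof -
    have e1: "(r has_real_derivative (deriv G x - 1)) (at x)" if "x \<in> S" for x
      unfolding r_def by (rule derivative_eq_intros Gd that refl)+
    have e2: "((\<lambda>x. deriv G x - 1) has_real_derivative (deriv ^^ 2) G x) (at x)" if "x \<in> S" for x
      by (rule derivative_eq_intros Gd that refl)+ simp
    show "(deriv ^^ 1) r 0 = deriv G 0 - 1" "(deriv ^^ 2) r 0 = (deriv ^^ 2) G 0" "(deriv ^^ 3) r 0 = (deriv ^^ 3) G 0"
      by (rule deriv_funpow_3[OF S(1) _ _ _ S(2), where ?f1.0 = "\<lambda>x. deriv G x - 1" and ?f2.0 = "(deriv ^^ 2) G" and ?f3.0 = "(deriv ^^ 3) G"];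
          (rule e1 e2 Gd(3); assumption))+
  qed
  have r0: "r 0 = 0" "deriv r 0 = 0" "(deriv ^^ 2) r 0 = 0" "(deriv ^^ 3) r 0 = 0"
    using rd jet G0 by (simp_all add: r_def G_def)
  define q where "q n x = r x * bump (real (Suc n) * x)" for n x
  have qC: "Ck_on 3 (q n) S" for n
    using flat_cutoff(1)[OF S rC r0, of n] by (simp add: q_def[abs_def])
  have qsmall: "\<forall>\<^sub>F n in sequentially. \<forall>x\<in>S. \<forall>i\<le>3. \<bar>(deriv ^^ i) (q n) x\<bar> \<le> \<eta>" if "\<eta> > 0" for \<eta>
    using flat_cutoff(2)[OF S rC r0 that] by (simp add: q_def[abs_def])
  define e where "e n = 1 / real (Suc n)" for n
  have e: "e n > 0" for n by (simp add: e_def)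
  have elim: "\<forall>\<^sub>F n in sequentially. e n < d" if "d > 0" for d
    using order_tendstoD(2)[OF LIMSEQ_Suc[OF lim_const_over_n[of 1]] that] by (simp add: e_def)
  have q0: "q n x = 0" if "\<bar>x\<bar> \<ge> e n" for n x
  proof -
    have "\<bar>real (Suc n) * x\<bar> = real (Suc n) * \<bar>x\<bar>" by (simp add: abs_mult)
    also have "\<dots> \<ge> real (Suc n) * e n" using that by (intro mult_left_mono) auto
    finally have "\<bar>real (Suc n) * x\<bar> \<ge> 1" by (simp add: e_def)
    then show ?thesis unfolding q_def by (simp only: bump_eq_0 mult_zero_right)
  qed
  define f where "f n P = (case P of Fin x \<Rightarrow> if \<bar>x\<bar> \<le> e n then Fin (G x - q n x) else g P | Infty \<Rightarrow> g P)" for n P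
  have fS: "f n (Fin x) = Fin (G x - q n x)" if "x \<in> S" for n x
    using that gG q0[of n x] by (simp add: f_def)
  have fout: "f n P = g P" if "P \<in> - Fin ` {- e n..e n}" for n P
    using that by (cases P) (auto simp: f_def abs_le_iff)
  have "continuous_on S (deriv G)" by (rule Ck_on_3_continuous_deriv[OF GC])
  then have "isCont (deriv G) 0" using S continuous_on_eq_continuous_at by blast
  moreover have "deriv G 0 = 1" using jet(1) by (simp add: G_def)
  ultimately obtain \<delta>1 where \<delta>1: "\<delta>1 > 0" "\<And>y. \<bar>y\<bar> < \<delta>1 \<Longrightarrow> \<bar>deriv G y - 1\<bar> < 1/2"
    unfolding continuous_at_eps_delta by (metis diff_zero half_gt_zero dist_real_def zero_less_one)
  obtain \<delta>2 where \<delta>2: "\<delta>2 > 0" "ball 0 \<delta>2 \<subseteq> S" using S open_contains_ball by blast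
  define \<delta> where "\<delta> = min \<delta>1 \<delta>2"
  have \<delta>: "\<delta> > 0" using \<delta>1 \<delta>2 by (simp add: \<delta>_def)
  have bS: "x \<in> S" and bG: "deriv G x > 1/2" if "x \<in> ball 0 \<delta>" for x
  proof -
    have x: "\<bar>x\<bar> < \<delta>1" "\<bar>x\<bar> < \<delta>2" using that by (auto simp: \<delta>_def)
    show "x \<in> S" using \<delta>2(2) x by (auto simp: subset_iff)
    show "deriv G x > 1/2" using \<delta>1(2)[OF x(1)] by linarith
  qed
  have "\<forall>\<^sub>F n in sequentially. e n < \<delta> \<and> (\<forall>x\<in>S. \<forall>i\<le>3. \<bar>(deriv ^^ i) (q n) x\<bar> \<le> 1/4)"
    by (intro eventually_conj elim \<delta> qsmall) simp
  then obtain N where N: "\<And>n. n \<ge> N \<Longrightarrow> e n < \<delta>" "\<And>n x i. n \<ge> N \<Longrightarrow> x \<in> S \<Longrightarrow> i \<le> 3 \<Longrightarrow> \<bar>(deriv ^^ i) (q n) x\<bar> \<le> 1/4"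
    unfolding eventually_sequentially by blast
  have fD: "f n \<in> carrier Diff3" if n: "n \<ge> N" for n
  proof -
    define h where "h x = G x - q n x" for x
    have hC: "Ck_on 3 h S" unfolding h_def by (rule Ck_on_diff[OF S(1) GC qC])
    have hd: "(h has_real_derivative (deriv G x - deriv (q n) x)) (at x)" "deriv G x - deriv (q n) x > 0"
      if x: "x \<in> ball 0 \<delta>" for x
    proof -
      show "(h has_real_derivative (deriv G x - deriv (q n) x)) (at x)"
        unfolding h_def by (intro DERIV_diff Ck_on_3_has_deriv[OF GC] Ck_on_3_has_deriv[OF qC] bS x)
      have "\<bar>(deriv ^^ 1) (q n) x\<bar> \<le> 1/4" by (rule N(2)[OF n bS[OF x]]) simp
      then have "\<bar>deriv (q n) x\<bar> \<le> 1/4" by simp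
      then show "deriv G x - deriv (q n) x > 0" using bG[OF x] by linarith
    qed
    have "C3_germ (f n) P" for P
    proof (cases "P \<in> Fin ` ball 0 \<delta>")
      case True
      have "C3_rep (f n) Fin Fin (ball 0 \<delta>) h"
        unfolding C3_rep_def
      proof (intro conjI ballI)
        show "Ck_on 3 h (ball 0 \<delta>)" by (rule Ck_on_subset[OF hC]) (use bS in blast)
        fix s :: real assume s: "s \<in> ball 0 \<delta>"
        show "deriv h s > 0" using hd[OF s] by (simp add: DERIV_imp_deriv)
        show "f n (Fin s) = Fin (h s)" using fS[OF bS[OF s]] by (simp add: h_def)
      qed simp
      then show ?thesis using True C3_germI[OF FA(1) FA(1)] by blast
    next
      case False
      have oA: "open (- Fin ` {- e n..e n})" by (rule open_compl_arc[OF e])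
      have PA: "P \<in> - Fin ` {- e n..e n}" using False N(1)[OF n] by (auto simp: image_iff abs_less_iff)
      obtain p p' T a x where rep: "p \<in> atlas" "p' \<in> atlas" "x \<in> T" "p x = P" "C3_rep g p p' T a"
        using g unfolding carrier_Diff3_iff C3_germ_def by (metis imageE)
      let ?T = "T \<inter> p -` (- Fin ` {- e n..e n})"
      have "C3_rep (f n) p p' ?T a"
        using rep(5) open_chart_vimage[OF rep(1) oA] fout Ck_on_subset[of 3 a T ?T] unfolding C3_rep_def by auto
      then show ?thesis using C3_germI[OF rep(1,2), of x ?T "f n" a] rep PA by auto
    qed
    moreover have "bij (f n)"
    proof -
      let ?E = "{- e n..e n}"
      have Eb: "x \<in> ball 0 \<delta>" if "x \<in> ?E" for x using that N(1)[OF n] by (auto simp: abs_less_iff)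
      have Eh: "inj_on h ?E" "h ` ?E = {h (- e n)..h (e n)}"
        by (rule increasing_image_interval[where h' = "\<lambda>x. deriv G x - deriv (q n) x"]; use Eb hd e[of n] in auto)+
      have EG: "inj_on G ?E" "G ` ?E = {G (- e n)..G (e n)}"
      proof -
        have "(G has_real_derivative deriv G x) (at x)" "deriv G x > 0" if "x \<in> ?E" for x
          using Gd(1) bS Eb bG[OF Eb[OF that]] that by auto
        then show "inj_on G ?E" "G ` ?E = {G (- e n)..G (e n)}"
          using increasing_image_interval[of "- e n" "e n" G "deriv G"] e[of n] by auto
      qed
      have "h ` ?E = G ` ?E" unfolding Eh EG using q0[of n "e n"] q0[of n "- e n"] e[of n] by (simp add: h_def)
      have fE: "f n (Fin x) = Fin (h x)" "g (Fin x) = Fin (G x)" if "x \<in> ?E" for x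
        using fS gG bS[OF Eb[OF that]] by (auto simp: h_def)
      have "f n ` Fin ` ?E = Fin ` h ` ?E" "g ` Fin ` ?E = Fin ` G ` ?E"
        unfolding image_image using fE by (auto intro!: image_cong)
      then have im: "f n ` Fin ` ?E = g ` Fin ` ?E" using \<open>h ` ?E = G ` ?E\<close> by simp
      have "inj_on (f n) (Fin ` ?E)"
      proof (rule inj_onI)
        fix P Q assume PQ: "P \<in> Fin ` ?E" "Q \<in> Fin ` ?E" "f n P = f n Q"
        then obtain x y where xy: "x \<in> ?E" "y \<in> ?E" "P = Fin x" "Q = Fin y" by blast
        then have "h x = h y" using PQ(3) fE(1) by (metis rp1.inject)
        then show "P = Q" using inj_onD[OF Eh(1) _ xy(1,2)] xy by simp
      qed
      then have b1: "bij_betw (f n) (Fin ` ?E) (g ` Fin ` ?E)" by (simp add: bij_betw_def im)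
      have bg: "bij g" using g by (simp add: carrier_Diff3_iff)
      have "bij_betw g (- Fin ` ?E) (- g ` Fin ` ?E)"
        using bg by (metis bij_betw_def bij_image_Compl_eq inj_on_subset subset_UNIV)
      then have b2: "bij_betw (f n) (- Fin ` ?E) (- g ` Fin ` ?E)"
        using bij_betw_cong[of "- Fin ` ?E" "f n" g] fout[of _ n] by blast
      have "bij_betw (f n) (Fin ` ?E \<union> - Fin ` ?E) (g ` Fin ` ?E \<union> - g ` Fin ` ?E)"
        by (rule bij_betw_combine[OF b1 b2]) simp
      then show ?thesis by simp
    qed
    ultimately show ?thesis by (simp add: carrier_Diff3_iff)
  qed
  have ftriv: "f n (Fin x) = Fin x" if x: "\<bar>x\<bar> < e n / 2" for n x
  proof -
    have "\<bar>real (Suc n) * x\<bar> = real (Suc n) * \<bar>x\<bar>" by (simp add: abs_mult)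
    also have "\<dots> \<le> real (Suc n) * (e n / 2)" using x by (intro mult_left_mono) auto
    also have "\<dots> = 1/2" unfolding e_def by (simp del: of_nat_Suc)
    finally have "\<bar>real (Suc n) * x\<bar> \<le> 1/2" .
    then have "q n x = r x" unfolding q_def by (simp only: bump_eq_1 mult_1_right)
    then show ?thesis using x e[of n] by (simp add: f_def r_def)
  qed
  \<comment> \<open>Only in the chart \<open>Fin\<close> on both sides can a compact set of parameters meet the modified arc for
    large \<open>n\<close>: in the other cases it stays away from the origin of \<open>Fin\<close>, either because the origin
    is fixed by \<open>g\<close>, or because a compact set in the chart at infinity is bounded.\<close>
  have close: "\<forall>\<^sub>F n in sequentially. \<forall>x\<in>L. x \<in> local_dom p p' (f n) \<and>
      (\<forall>i\<le>3. \<bar>(deriv ^^ i) (local_rep p p' (f n)) x - (deriv ^^ i) (local_rep p p' g) x\<bar> \<le> \<eta>)"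
    if p: "p \<in> atlas" "p' \<in> atlas" and L: "compact L" "L \<subseteq> local_dom p p' g" and \<eta>: "\<eta> > 0" for p p' L \<eta>
  proof (cases "p = Fin \<and> p' = Fin")
    case True
    then have pp: "p = Fin" "p' = Fin" and LS: "L \<subseteq> S" using L by (auto simp: S_def)
    show ?thesis unfolding pp using qsmall[OF \<eta>]
    proof eventually_elim
      case (elim n)
      show ?case
      proof (intro ballI conjI allI impI)
        fix x assume "x \<in> L"
        then have x: "x \<in> S" using LS by blast
        show "x \<in> local_dom Fin Fin (f n)" using fS[OF x] by (simp add: local_dom_def)
        fix i :: nat assume i: "i \<le> 3"
        have "(deriv ^^ i) (local_rep Fin Fin (f n)) x = (deriv ^^ i) (\<lambda>x. G x - q n x) x"
          by (rule deriv_funpow_cong[OF S(1) _ x]) (simp add: local_rep_def fS FA)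
        also have "\<dots> = (deriv ^^ i) G x - (deriv ^^ i) (q n) x"
          by (rule Ck_on_deriv_funpow_diff[OF S(1) GC qC i x])
        finally show "\<bar>(deriv ^^ i) (local_rep Fin Fin (f n)) x - (deriv ^^ i) (local_rep Fin Fin g) x\<bar> \<le> \<eta>"
          using elim x i by (simp add: G_def)
      qed
    qed
  next
    case False
    have "\<exists>d>0. \<forall>x\<in>L. \<forall>y. p x = Fin y \<longrightarrow> \<bar>y\<bar> \<ge> d"
    proof (cases "p = Fin")
      case True
      then have "p' = param_infty" using False p by (auto simp: atlas_cases)
      then have "0 \<notin> L" using L(2) g0 True by (auto simp: local_dom_def param_infty_def split: if_splits)
      then have "open (- L)" "0 \<in> - L" using L(1) compact_imp_closed by auto
      then obtain d where "d > 0" "ball 0 d \<subseteq> - L" using open_contains_ball by blast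
      then show ?thesis using True by (intro exI[of _ d]) (auto simp: subset_iff not_less[symmetric])
    next
      case notFin: False
      then have pi: "p = param_infty" using p by (auto simp: atlas_cases)
      obtain B where B: "B > 0" "\<And>x. x \<in> L \<Longrightarrow> \<bar>x\<bar> \<le> B" using compact_imp_bounded[OF L(1)] unfolding bounded_pos by auto
      have "\<bar>y\<bar> \<ge> 1 / B" if "x \<in> L" "p x = Fin y" for x y
      proof -
        have "x \<noteq> 0" "y = - 1 / x" using that(2) by (auto simp: pi param_infty_def split: if_splits)
        then show ?thesis using B(2)[OF that(1)] B(1) by (simp add: frac_le)
      qed
      then show ?thesis using B(1) by (intro exI[of _ "1 / B"]) auto
    qed
    then obtain d where d: "d > 0" "\<And>x y. x \<in> L \<Longrightarrow> p x = Fin y \<Longrightarrow> \<bar>y\<bar> \<ge> d" by blast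
    show ?thesis using elim[OF d(1)]
    proof eventually_elim
      case (elim n)
      show ?case
      proof (intro ballI conjI allI impI)
        fix x assume x: "x \<in> L"
        have U: "p x \<in> - Fin ` {- e n..e n}" using d(2)[OF x] elim by fastforce
        have "x \<in> local_dom p p' (f n) \<longleftrightarrow> x \<in> local_dom p p' g"
          by (rule local_rep_agree(1)[OF open_compl_arc[OF e] _ p(1) U]) (rule fout)
        then show "x \<in> local_dom p p' (f n)" using L(2) x by blast
        have agree: "(deriv ^^ i) (local_rep p p' (f n)) x = (deriv ^^ i) (local_rep p p' g) x" for i
          by (rule local_rep_agree(2)[OF open_compl_arc[OF e] _ p(1) U]) (rule fout)
        show "\<bar>(deriv ^^ i) (local_rep p p' (f n)) x - (deriv ^^ i) (local_rep p p' g) x\<bar> \<le> \<eta>" for i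
          using \<eta> by (simp add: agree)
      qed
    qed
  qed
  show thesis
  proof (rule that[of "\<lambda>n. f (n + N)"])
    show "f (n + N) \<in> carrier Diff3" for n by (rule fD) simp
    show "\<exists>\<delta>>0. \<forall>x. \<bar>x\<bar> < \<delta> \<longrightarrow> f (n + N) (Fin x) = Fin x" for n
      using ftriv[of _ "n + N"] e[of "n + N"] by (intro exI[of _ "e (n + N) / 2"]) auto
    show "limitin C3_topology (\<lambda>n. f (n + N)) g sequentially"
    proof (rule limitin_C3_topology[OF g])
      show "f (n + N) \<in> carrier Diff3" for n by (rule fD) simp
      fix p p' and L :: "real set" assume A: "p \<in> atlas" "p' \<in> atlas" "compact L" "L \<subseteq> local_dom p p' g"
      have cl: "\<forall>\<^sub>F n in sequentially. \<forall>x\<in>L. x \<in> local_dom p p' (f (n + N)) \<and>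
          (\<forall>i\<le>3. \<bar>(deriv ^^ i) (local_rep p p' (f (n + N))) x - (deriv ^^ i) (local_rep p p' g) x\<bar> \<le> \<eta>)" if "\<eta> > 0" for \<eta>
        using close[OF A that] by (subst eventually_sequentially_seg)
      show "\<forall>\<^sub>F n in sequentially. L \<subseteq> local_dom p p' (f (n + N))"
        using cl[OF zero_less_one] by eventually_elim blast
      fix i :: nat assume i: "i \<le> 3"
      show "uniform_limit L (\<lambda>n. (deriv ^^ i) (local_rep p p' (f (n + N)))) ((deriv ^^ i) (local_rep p p' g)) sequentially"
      proof (rule uniform_limitI)
        fix \<eta> :: real assume "\<eta> > 0"
        then have h: "\<eta> / 2 > 0" "\<eta> / 2 < \<eta>" by auto
        show "\<forall>\<^sub>F n in sequentially. \<forall>x\<in>L. dist ((deriv ^^ i) (local_rep p p' (f (n + N))) x) ((deriv ^^ i) (local_rep p p' g) x) < \<eta>"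
          using cl[OF h(1)]
        proof eventually_elim
          case (elim n)
          then have "\<forall>x\<in>L. dist ((deriv ^^ i) (local_rep p p' (f (n + N))) x) ((deriv ^^ i) (local_rep p p' g) x) \<le> \<eta> / 2"
            using i unfolding dist_real_def by blast
          then show ?case using h(2) by (meson order_le_less_trans)
        qed
      qed
    qed
  qed
qed

section \<open>Commutation of the compressions\<close>

text \<open>
  The support is a compact subset of the affine line, so \<open>d\<close> is the identity near infinity.
\<close>

definition compactly_supported :: "(rp1 \<Rightarrow> rp1) \<Rightarrow> bool" where
  "compactly_supported d \<longleftrightarrow> d \<in> carrier Diff3 \<and> (\<exists>R. \<forall>P. P \<notin> Fin ` {-R..R} \<longrightarrow> d P = P)"

lemma image_support_subset:
  assumes "inj d" "\<And>P. P \<notin> A \<Longrightarrow> d P = P" "P \<in> A"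
  shows "d P \<in> A"
  using assms by (metis injD)

text \<open>
  An injective map that fixes every point outside a set maps this set into itself, so each of the two
  maps acts trivially wherever the other one moves points.
\<close>

lemma disjoint_supports_commute:
  assumes "inj d" "inj e" "\<And>P. P \<notin> A \<Longrightarrow> d P = P" "\<And>P. P \<notin> B \<Longrightarrow> e P = P" "A \<inter> B = {}"
  shows "d \<circ> e = e \<circ> d"
proof
  fix P
  consider "P \<in> A" | "P \<in> B" | "P \<notin> A" "P \<notin> B" by blast
  then show "(d \<circ> e) P = (e \<circ> d) P"
  proof cases
    case 1
    then have "d P \<in> A" using image_support_subset[OF assms(1,3)] by blast
    then have "e (d P) = d P" "e P = P" using 1 assms(4,5) by blast+
    then show ?thesis by simp
  next
    case 2
    then have "e P \<in> B" using image_support_subset[OF assms(2,4)] by blast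
    then have "d (e P) = e P" "d P = P" using 2 assms(3,5) by blast+
    then show ?thesis by simp
  next
    case 3
    then show ?thesis using assms(3,4) by simp
  qed
qed

definition translation :: "real \<Rightarrow> rp1 \<Rightarrow> rp1" where
  "translation t = lft 1 t 0 1"

lemma translation_simps [simp]: "translation t (Fin x) = Fin (x + t)" "translation t Infty = Infty"
  by (simp_all add: translation_def lft_def hpoint_def)

lemma translation_PSL2: "translation t \<in> PSL2"
  unfolding translation_def by (rule lft_in_PSL2) simp

lemma translation_add: "translation s \<circ> translation t = translation (s + t)"
  by (simp add: translation_def lft_compose add.commute)

lemma translation_0: "translation 0 = id"
  by (simp add: translation_def lft_id)

text \<open>
  A translation by more than the sum of the radii of the two supports makes them disjoint.
\<close>

lemma translated_commute:
  assumes d: "compactly_supported d" and e: "compactly_supported e"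
  obtains n0 :: nat where "\<And>t. \<bar>t\<bar> \<ge> real n0 \<Longrightarrow>
    d \<circ> (translation t \<circ> (e \<circ> translation (- t))) = (translation t \<circ> (e \<circ> translation (- t))) \<circ> d"
proof -
  obtain R where R: "d \<in> carrier Diff3" "\<And>P. P \<notin> Fin ` {-R..R} \<Longrightarrow> d P = P" using d unfolding compactly_supported_def by blast
  obtain R' where R': "e \<in> carrier Diff3" "\<And>P. P \<notin> Fin ` {-R'..R'} \<Longrightarrow> e P = P" using e unfolding compactly_supported_def by blast
  obtain n0 :: nat where n0: "\<bar>R\<bar> + \<bar>R'\<bar> < real n0" using reals_Archimedean2 by blast
  show thesis
  proof (rule that[of n0])
    fix t assume t: "\<bar>t\<bar> \<ge> real n0"
    have inj: "inj d" "inj e" using R R' by (auto simp: carrier_Diff3_iff bij_is_inj)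
    have injt: "inj (translation s)" for s
      using subsetD[OF PSL2_subset translation_PSL2, of s] by (simp add: carrier_Diff3_iff bij_is_inj)
    show "d \<circ> (translation t \<circ> (e \<circ> translation (- t))) = (translation t \<circ> (e \<circ> translation (- t))) \<circ> d"
    proof (rule disjoint_supports_commute[OF inj(1) _ R(2), where B = "Fin ` {t - R'..t + R'}"])
      show "inj (translation t \<circ> (e \<circ> translation (- t)))" by (intro inj_compose injt inj)
      show "(translation t \<circ> (e \<circ> translation (- t))) P = P" if "P \<notin> Fin ` {t - R'..t + R'}" for P
      proof -
        have "translation (- t) P \<notin> Fin ` {-R'..R'}"
        proof
          assume "translation (- t) P \<in> Fin ` {-R'..R'}"
          then obtain y where y: "y \<in> {-R'..R'}" "translation (- t) P = Fin y" by blast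
          then have "P = Fin (y + t)" by (cases P) auto
          then show False using that y(1) by auto
        qed
        then have "e (translation (- t) P) = translation (- t) P" by (rule R'(2))
        then show ?thesis by (cases P) auto
      qed
      show "Fin ` {-R..R} \<inter> Fin ` {t - R'..t + R'} = {}" using t n0 by (auto simp: abs_if split: if_splits)
    qed
  qed
qed

text \<open>
  The rotation \<open>x \<mapsto> - 1 / x\<close> exchanges the origin with infinity.
\<close>

lemma conjugate_compactly_supported:
  assumes d: "d \<in> carrier Diff3" and \<delta>: "\<delta> > 0" "\<And>x. \<bar>x\<bar> < \<delta> \<Longrightarrow> d (Fin x) = Fin x"
  shows "compactly_supported (lft 0 (-1) 1 0 \<circ> (d \<circ> lft 0 1 (-1) 0))"
  unfolding compactly_supported_def
proof
  have w: "lft 0 (-1) 1 0 \<in> carrier Diff3" "lft 0 1 (-1) 0 \<in> carrier Diff3" by (auto intro!: lft_in_Diff3)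
  then show "lft 0 (-1) 1 0 \<circ> (d \<circ> lft 0 1 (-1) 0) \<in> carrier Diff3" using d by (intro Diff3_compose_closed)
  have inf: "(lft 0 (-1) 1 0 \<circ> (d \<circ> lft 0 1 (-1) 0)) Infty = Infty"
    using \<delta>(2)[of 0] \<delta>(1) by (simp add: lft_def hpoint_def)
  have fin: "(lft 0 (-1) 1 0 \<circ> (d \<circ> lft 0 1 (-1) 0)) (Fin x) = Fin x" if "\<bar>x\<bar> > 1 / \<delta>" for x
  proof -
    have "1 / \<delta> > 0" using \<delta> by simp
    then have x: "x \<noteq> 0" using that by auto
    have "1 < \<delta> * \<bar>x\<bar>" using that \<delta> by (simp add: field_simps)
    then have "\<bar>- 1 / x\<bar> < \<delta>" using x by (simp add: field_simps)
    from \<delta>(2)[OF this] show ?thesis using x by (simp add: lft_def hpoint_def)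
  qed
  have "(lft 0 (-1) 1 0 \<circ> (d \<circ> lft 0 1 (-1) 0)) P = P" if "P \<notin> Fin ` {- (1 / \<delta>)..1 / \<delta>}" for P
  proof (cases P)
    case (Fin x)
    then have "\<bar>x\<bar> > 1 / \<delta>" using that by (auto simp: image_iff abs_le_iff not_le[symmetric])
    then show ?thesis using fin Fin by simp
  qed (use inf in simp)
  then show "\<exists>R. \<forall>P. P \<notin> Fin ` {-R..R} \<longrightarrow> (lft 0 (-1) 1 0 \<circ> (d \<circ> lft 0 1 (-1) 0)) P = P" by blast
qed

text \<open>
  The approximants are trivial on arcs around the origin, where the normalization took place; the
  rotation carries these arcs to neighbourhoods of infinity.
\<close>

lemma double_coset_approximation:
  assumes f: "f \<in> carrier Diff3"
  obtains k k' F where "k \<in> PSL2" "k' \<in> PSL2" "\<And>n. F n \<in> carrier Diff3" "limitin C3_topology F (k \<circ> (f \<circ> k')) sequentially"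
    "\<And>n. compactly_supported (lft 0 (-1) 1 0 \<circ> (F n \<circ> lft 0 1 (-1) 0))"
proof -
  obtain k k' where k: "k \<in> PSL2" "k' \<in> PSL2" and jet: "(k \<circ> f \<circ> k') (Fin 0) = Fin 0"
    "(deriv ^^ 1) (local_rep Fin Fin (k \<circ> f \<circ> k')) 0 = 1"
    "(deriv ^^ 2) (local_rep Fin Fin (k \<circ> f \<circ> k')) 0 = 0"
    "(deriv ^^ 3) (local_rep Fin Fin (k \<circ> f \<circ> k')) 0 = 0"
    using exists_projective_normalization[OF f] by blast
  have "k \<circ> f \<circ> k' \<in> carrier Diff3" using k f PSL2_subset by (intro Diff3_compose_closed) auto
  then obtain F where F: "\<And>n. F n \<in> carrier Diff3" "\<And>n. \<exists>\<delta>>0. \<forall>x. \<bar>x\<bar> < \<delta> \<longrightarrow> F n (Fin x) = Fin x"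
    "limitin C3_topology F (k \<circ> f \<circ> k') sequentially"
    using approximation_by_locally_trivial[OF _ jet] by blast
  show thesis
  proof (rule that[OF k F(1)])
    show "limitin C3_topology F (k \<circ> (f \<circ> k')) sequentially" using F(3) by (simp add: comp_assoc)
    show "compactly_supported (lft 0 (-1) 1 0 \<circ> (F n \<circ> lft 0 1 (-1) 0))" for n
      using conjugate_compactly_supported[OF F(1)] F(2) by blast
  qed
qed

lemma Diff3_rep_compose:
  assumes "unitary_rep Diff3 C3_topology \<rho>" "f \<in> carrier Diff3" "g \<in> carrier Diff3"
  shows "\<rho> (f \<circ> g) x = \<rho> f (\<rho> g x)"
  using unitary_repD(2)[OF assms] by simp

lemma fixed_by_translation:
  fixes \<rho> :: "(rp1 \<Rightarrow> rp1) \<Rightarrow> 'h::complex_hilbert_space \<Rightarrow> 'h"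
  assumes rep: "unitary_rep Diff3 C3_topology \<rho>" and s: "s = 1 \<or> s = -1" and v: "\<rho> (translation s) v = v"
  shows "v \<in> invariant_vectors PSL2 \<rho>"
proof (rule fixed_by_translation_imp_fixed_by_PSL2[OF rep])
  have "\<rho> (translation 1) v = v"
  proof (cases "s = 1")
    case False
    then have "\<rho> (translation 1) v = \<rho> (translation 1) (\<rho> (translation (-1)) v)" using s v by simp
    also have "\<dots> = \<rho> (translation 1 \<circ> translation (-1)) v"
      using translation_PSL2 PSL2_subset by (subst Diff3_rep_compose[OF rep]) auto
    also have "\<dots> = v" using unitary_rep_one[OF group_Diff3 rep] by (simp add: translation_add translation_0)
    finally show ?thesis .
  qed (use v in simp)
  then show "\<rho> (lft 1 1 0 1) v = v" by (simp add: translation_def)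
qed

text \<open>
  The vectors fixed by the translation are the \<open>K\<close>-invariant ones, by the Mautner phenomenon, so the
  mean ergodic theorem identifies the limit. The shift by \<open>n0\<close> serves to discard the finitely many
  translations that do not yet separate the supports; it leaves the projection onto the fixed vectors
  unchanged.
\<close>

lemma translation_averages:
  fixes \<rho> :: "(rp1 \<Rightarrow> rp1) \<Rightarrow> 'h::complex_hilbert_space \<Rightarrow> 'h"
  assumes rep: "unitary_rep Diff3 C3_topology \<rho>" and s: "s = 1 \<or> s = -1"
    and P: "P z \<in> invariant_vectors PSL2 \<rho>" "\<And>y. y \<in> invariant_vectors PSL2 \<rho> \<Longrightarrow> cinner (z - P z) y = 0"
  shows "(\<lambda>N. (1 / real N) *\<^sub>R (\<Sum>n<N. \<rho> (translation (s * real (n + n0))) z)) \<longlonglongrightarrow> P z"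
proof -
  have tD: "translation t \<in> carrier Diff3" for t using translation_PSL2 PSL2_subset by blast
  note R = unitary_repD[OF rep]
  let ?U = "\<rho> (translation s)"
  define z' where "z' = \<rho> (translation (s * real n0)) z"
  have pow: "(?U ^^ n) z' = \<rho> (translation (s * real (n + n0))) z" for n
  proof (induction n)
    case (Suc n)
    have "(?U ^^ Suc n) z' = \<rho> (translation s \<circ> translation (s * real (n + n0))) z"
      using Suc by (simp add: Diff3_rep_compose[OF rep tD tD])
    then show ?case by (simp add: translation_add algebra_simps)
  qed (simp add: z'_def)
  have "(\<lambda>N. (1 / real N) *\<^sub>R (\<Sum>n<N. (?U ^^ n) z')) \<longlonglongrightarrow> P z"
  proof (rule mean_ergodic)
    show "?U \<in> carrier unitary_group" by (rule R(1)[OF tD])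
    have inv: "\<rho> (translation t) y = y" if "y \<in> invariant_vectors PSL2 \<rho>" for t y
      using that translation_PSL2 by (auto simp: invariant_vectors_def)
    show "?U (P z) = P z" by (rule inv[OF P(1)])
    fix y assume "?U y = y"
    then have y: "y \<in> invariant_vectors PSL2 \<rho>" by (rule fixed_by_translation[OF rep s])
    have "cinner z' y = cinner (\<rho> (translation (s * real n0)) z) (\<rho> (translation (s * real n0)) y)"
      by (simp add: z'_def inv[OF y])
    also have "\<dots> = cinner z y" by (rule unitary_groupD(3)[OF R(1)[OF tD]])
    finally show "cinner (z' - P z) y = 0" using P(2)[OF y] by (simp add: cinner_diff_left)
  qed
  then show ?thesis by (simp only: pow)
qed

text \<open>
  Both sides are limits of averages of the same numbers: the term for \<open>n\<close> on the left, with \<open>e\<close>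
  conjugated by the translation by \<open>n + n0\<close>, equals the term on the right, with the inverse
  translation, because the conjugate of \<open>e\<close> commutes with \<open>d\<close> and the vectors \<open>x\<close>, \<open>y\<close> absorb the
  outer translations.
\<close>

lemma compactly_supported_compressions_commute:
  fixes \<rho> :: "(rp1 \<Rightarrow> rp1) \<Rightarrow> 'h::complex_hilbert_space \<Rightarrow> 'h"
  assumes rep: "unitary_rep Diff3 C3_topology \<rho>"
    and P: "\<And>x. P x \<in> invariant_vectors PSL2 \<rho>" "\<And>x y. y \<in> invariant_vectors PSL2 \<rho> \<Longrightarrow> cinner (x - P x) y = 0"
    and d: "compactly_supported d" and e: "compactly_supported e"
    and x: "x \<in> invariant_vectors PSL2 \<rho>" and y: "y \<in> invariant_vectors PSL2 \<rho>"
  shows "cinner (\<rho> d (P (\<rho> e x))) y = cinner (\<rho> e (P (\<rho> d x))) y"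
proof -
  have tD: "translation t \<in> carrier Diff3" for t using translation_PSL2 PSL2_subset by blast
  have dD: "d \<in> carrier Diff3" "e \<in> carrier Diff3" using d e by (auto simp: compactly_supported_def)
  note R = unitary_repD[OF rep]
  note comp = Diff3_rep_compose[OF rep]
  have inv: "\<rho> (translation t) y = y" if "y \<in> invariant_vectors PSL2 \<rho>" for t y
    using that translation_PSL2 by (auto simp: invariant_vectors_def)
  have lim: "(\<lambda>N. (1 / real N) *\<^sub>R (\<Sum>n<N. cinner (\<rho> f (\<rho> (translation (s * real (n + n0))) (\<rho> g x))) y))
      \<longlonglongrightarrow> cinner (\<rho> f (P (\<rho> g x))) y" if s: "s = 1 \<or> s = -1" and f: "f \<in> carrier Diff3" for s f g n0
  proof -
    have bl: "bounded_linear (\<lambda>z. cinner (\<rho> f z) y)"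
      using bounded_linear_compose[OF bounded_bilinear.bounded_linear_left[OF bounded_bilinear_cinner] unitary_groupD(6)[OF R(1)[OF f]]] .
    have "(\<lambda>N. cinner (\<rho> f ((1 / real N) *\<^sub>R (\<Sum>n<N. \<rho> (translation (s * real (n + n0))) (\<rho> g x)))) y)
        \<longlonglongrightarrow> cinner (\<rho> f (P (\<rho> g x))) y"
      by (rule bounded_linear.tendsto[OF bl translation_averages[OF rep s P(1) P(2)]])
    then show ?thesis
      by (simp only: linear_cmul[OF bounded_linear.linear[OF bl]] linear_sum[OF bounded_linear.linear[OF bl]])
  qed
  obtain n0 :: nat where n0: "\<And>t. \<bar>t\<bar> \<ge> real n0 \<Longrightarrow>
    d \<circ> (translation t \<circ> (e \<circ> translation (- t))) = (translation t \<circ> (e \<circ> translation (- t))) \<circ> d"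
    using translated_commute[OF d e] by blast
  have eq: "cinner (\<rho> d (\<rho> (translation (1 * real (n + n0))) (\<rho> e x))) y =
      cinner (\<rho> e (\<rho> (translation (-1 * real (n + n0))) (\<rho> d x))) y" for n
  proof -
    define t where "t = real (n + n0)"
    have "cinner (\<rho> d (\<rho> (translation t) (\<rho> e x))) y = cinner (\<rho> d (\<rho> (translation t) (\<rho> e (\<rho> (translation (- t)) x)))) y"
      by (simp add: inv[OF x])
    also have "\<dots> = cinner (\<rho> (d \<circ> (translation t \<circ> (e \<circ> translation (- t)))) x) y"
      by (simp add: comp tD dD Diff3_compose_closed del: o_apply)
    also have "d \<circ> (translation t \<circ> (e \<circ> translation (- t))) = translation t \<circ> (e \<circ> (translation (- t) \<circ> d))"
      using n0[of t] by (simp add: t_def comp_assoc)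
    also have "cinner (\<rho> \<dots> x) y = cinner (\<rho> (translation t) (\<rho> e (\<rho> (translation (- t)) (\<rho> d x)))) (\<rho> (translation t) y)"
      by (simp add: comp tD dD Diff3_compose_closed inv[OF y] del: o_apply)
    also have "\<dots> = cinner (\<rho> e (\<rho> (translation (- t)) (\<rho> d x))) y"
      by (rule unitary_groupD(3)[OF R(1)[OF tD]])
    finally show ?thesis by (simp add: t_def)
  qed
  show ?thesis
    by (rule LIMSEQ_unique[OF lim[of 1 d n0 e, unfolded eq] lim[of "-1" e n0 d]]) (auto simp: dD)
qed

text \<open>
  The compression \<open>T h\<close> depends only on the double coset of \<open>h\<close> and is strongly continuous in \<open>h\<close>, so
  it is a limit of compressions of compactly supported diffeomorphisms. Multiplication of operators is
  only separately continuous in the strong topology; hence the two limits are taken one after the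
  other.
\<close>

lemma compressions_commute:
  fixes \<rho> :: "(rp1 \<Rightarrow> rp1) \<Rightarrow> 'h::complex_hilbert_space \<Rightarrow> 'h"
  assumes rep: "unitary_rep Diff3 C3_topology \<rho>"
    and P: "bounded_linear P" "\<And>x. P x \<in> invariant_vectors PSL2 \<rho>" "\<And>x. x \<in> invariant_vectors PSL2 \<rho> \<Longrightarrow> P x = x"
      "\<And>x y. cinner (P x) y = cinner x (P y)"
    and f: "f \<in> carrier Diff3" and g: "g \<in> carrier Diff3"
  shows "P (\<rho> f (P (\<rho> g (P x)))) = P (\<rho> g (P (\<rho> f (P x))))"
proof -
  note R = unitary_repD[OF rep]
  note comp = Diff3_rep_compose[OF rep]
  have KD: "k \<in> carrier Diff3" if "k \<in> PSL2" for k using that PSL2_subset by blast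
  have inv: "\<rho> k (P x) = P x" if "k \<in> PSL2" for k x using P(2) that by (auto simp: invariant_vectors_def)
  have Pinv: "P (\<rho> k x) = P x" if k: "k \<in> PSL2" for k x
  proof (rule cinner_eqI)
    fix y
    have "cinner (P (\<rho> k x)) y = cinner (\<rho> k x) (\<rho> k (P y))" by (simp add: P(4) inv[OF k])
    also have "\<dots> = cinner (P x) y" by (simp add: P(4) unitary_groupD(3)[OF R(1)[OF KD[OF k]]])
    finally show "cinner (P (\<rho> k x)) y = cinner (P x) y" .
  qed
  define T where "T h x = P (\<rho> h (P x))" for h x
  have TK: "T (k \<circ> (h \<circ> k')) = T h" if "k \<in> PSL2" "k' \<in> PSL2" "h \<in> carrier Diff3" for k k' h
    by (rule ext) (simp add: T_def comp KD that Diff3_compose_closed inv Pinv del: o_apply)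
  have Tbl: "bounded_linear (T h)" if "h \<in> carrier Diff3" for h
    unfolding T_def using bounded_linear_compose[OF P(1) bounded_linear_compose[OF unitary_groupD(6)[OF R(1)[OF that]] P(1)]] .
  have Tlim: "(\<lambda>n. T (F n) x) \<longlonglongrightarrow> T h x" if "limitin C3_topology F h sequentially" for F h x
    unfolding T_def by (intro bounded_linear.tendsto[OF P(1)] unitary_rep_tendsto[OF rep that])
  have orth: "cinner (x - P x) y = 0" if "y \<in> invariant_vectors PSL2 \<rho>" for x y
    using P(3)[OF that] P(4)[of x y] by (simp add: cinner_diff_left)
  have base: "T d (T e x) = T e (T d x)" if "compactly_supported d" "compactly_supported e" for d e x
  proof (rule cinner_eqI)
    fix y
    show "cinner (T d (T e x)) y = cinner (T e (T d x)) y"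
      using compactly_supported_compressions_commute[OF rep P(2) orth that P(2) P(2), of x y]
      by (simp add: T_def P(4) P(3)[OF P(2)])
  qed
  have approx: "\<exists>F. (\<forall>n. F n \<in> carrier Diff3 \<and> (\<exists>d. compactly_supported d \<and> T (F n) = T d)) \<and> (\<forall>x. (\<lambda>n. T (F n) x) \<longlonglongrightarrow> T h x)"
    if h: "h \<in> carrier Diff3" for h
  proof -
    obtain k k' F where F: "k \<in> PSL2" "k' \<in> PSL2" "\<And>n. F n \<in> carrier Diff3"
      "limitin C3_topology F (k \<circ> (h \<circ> k')) sequentially"
      "\<And>n. compactly_supported (lft 0 (-1) 1 0 \<circ> (F n \<circ> lft 0 1 (-1) 0))"
      using double_coset_approximation[OF h] by blast
    have w: "lft 0 (-1) 1 0 \<in> PSL2" "lft 0 1 (-1) 0 \<in> PSL2" by (auto intro!: lft_in_PSL2)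
    show ?thesis
    proof (intro exI[of _ F] conjI allI)
      show "F n \<in> carrier Diff3" for n by (rule F(3))
      show "\<exists>d. compactly_supported d \<and> T (F n) = T d" for n using F(5)[of n] TK[OF w F(3)[of n]] by metis
      show "(\<lambda>n. T (F n) x) \<longlonglongrightarrow> T h x" for x using Tlim[OF F(4), of x] TK[OF F(1,2) h] by simp
    qed
  qed
  obtain F where F: "\<And>n. F n \<in> carrier Diff3" "\<And>n. \<exists>d. compactly_supported d \<and> T (F n) = T d" "\<And>x. (\<lambda>n. T (F n) x) \<longlonglongrightarrow> T f x"
    using approx[OF f] by blast
  obtain H where H: "\<And>n. H n \<in> carrier Diff3" "\<And>n. \<exists>d. compactly_supported d \<and> T (H n) = T d" "\<And>x. (\<lambda>n. T (H n) x) \<longlonglongrightarrow> T g x"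
    using approx[OF g] by blast
  have FH: "T (F n) (T (H m) x) = T (H m) (T (F n) x)" for n m x
    using F(2)[of n] H(2)[of m] base by metis
  have fH: "T f (T (H m) x) = T (H m) (T f x)" for m x
  proof (rule LIMSEQ_unique)
    show "(\<lambda>n. T (F n) (T (H m) x)) \<longlonglongrightarrow> T f (T (H m) x)" by (rule F(3))
    show "(\<lambda>n. T (F n) (T (H m) x)) \<longlonglongrightarrow> T (H m) (T f x)"
      unfolding FH by (intro bounded_linear.tendsto[OF Tbl[OF H(1)]] F(3))
  qed
  have "T f (T g x) = T g (T f x)"
  proof (rule LIMSEQ_unique)
    show "(\<lambda>m. T (H m) (T f x)) \<longlonglongrightarrow> T g (T f x)" by (rule H(3))
    show "(\<lambda>m. T (H m) (T f x)) \<longlonglongrightarrow> T f (T g x)"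
      unfolding fH[symmetric] by (intro bounded_linear.tendsto[OF Tbl[OF f]] H(3))
  qed
  then show ?thesis by (simp add: T_def P(3)[OF P(2)])
qed

theorem theorem1:
  shows "spherical_subgroup TYPE('h::complex_hilbert_space) Diff3 C3_topology PSL2"
  unfolding spherical_subgroup_def
proof (intro conjI allI impI)
  show "subgroup PSL2 Diff3" by (rule subgroup_PSL2)
  fix \<rho> :: "(rp1 \<Rightarrow> rp1) \<Rightarrow> 'h \<Rightarrow> 'h"
  assume irr: "irreducible_unitary_rep Diff3 C3_topology \<rho>"
  then have rep: "unitary_rep Diff3 C3_topology \<rho>" by (simp add: irreducible_unitary_rep_def)
  note V = invariant_vectors_subspace[OF rep PSL2_subset]
  obtain P where P: "bounded_linear P" "\<And>a x. P (a *\<^sub>C x) = a *\<^sub>C P x" "\<And>x. P x \<in> invariant_vectors PSL2 \<rho>"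
    "\<And>x. x \<in> invariant_vectors PSL2 \<rho> \<Longrightarrow> P x = x" "\<And>x y. cinner (P x) y = cinner x (P y)"
    using orthogonal_projection_exists[OF V] by blast
  show "cdim_le (invariant_vectors PSL2 \<rho>) 1"
  proof (rule commuting_compressions_imp_cdim_le_1[OF group_Diff3 irr V P])
    fix f g x y assume A: "f \<in> carrier Diff3" "g \<in> carrier Diff3"
      "x \<in> invariant_vectors PSL2 \<rho>" "y \<in> invariant_vectors PSL2 \<rho>"
    have "cinner (P (\<rho> f (P (\<rho> g (P x))))) y = cinner (P (\<rho> g (P (\<rho> f (P x))))) y"
      by (simp only: compressions_commute[OF rep P(1,3,4,5) A(1,2)])
    then show "cinner (\<rho> f (P (\<rho> g x))) y = cinner (\<rho> g (P (\<rho> f x))) y"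
      by (simp add: P(4)[OF A(3)] P(4)[OF A(4)] P(5))
  qed
qed

end
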